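(* Let $D\subset\mathbb{C}$ be a Jordan domain with analytic boundary and let $f$ be a meromorphic function on some open neighborhood of the closure of $D$. Assume that $f$ has no critical point on $\partial D$ and that $f(\partial D)$ is a Jordan curve whose bounded face contains $0$. Let $M$ and $N$ be the number of zeros and the number of poles of $f$ in $D$, respectively, counting multiplicity. Then there is an injective holomorphic function $\phi:D\to\mathbb{C}$ and a rational map $r$ of degree $\max(M,N)$ such that $$f=r\circ\phi \quad\text{on } D.$$ Moreover, the rational map $r$ may be chosen so that all of its zeros and poles (in $\widehat{\mathbb{C}}$) are in $\phi(D)$, except for a pole of multiplicity $M-N$ at $\infty$ if $M\geq N$, or a zero of multiplicity $N-M$ at $\infty$ if $N\geq M$.
   Context: $\widehat{\mathbb{C}}$ denotes the Riemann sphere. A Jordan domain is the bounded component (face) of the complement in $\mathbb{C}$ of a Jordan curve; its boundary is analytic if that curve is an analytic Jordan curve. The bounded face of a Jordan curve in $\mathbb{C}$ is the bounded component of its complement. *)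

theory Defs
  imports "HOL-Complex_Analysis.Complex_Analysis"
begin

definition jordan_curve :: "complex set \<Rightarrow> bool" where
  "jordan_curve C \<longleftrightarrow>
     (\<exists>g. simple_path g \<and> pathfinish g = pathstart g \<and> path_image g = C)"

(* The bounded face of a Jordan curve C is inside C. The library defines inside C as the set of
   points whose component in the complement of C is bounded. *)
lemma inside_unique_bounded_component:
  assumes "jordan_curve C"
  shows "{F \<in> components (- C). bounded F} = {inside C}"
proof -
  obtain g where g: "simple_path g" "pathfinish g = pathstart g" "path_image g = C"
    using assms unfolding jordan_curve_def by blast
  have ne: "inside C \<noteq> {}" and con: "connected (inside C)"
    and bd: "bounded (inside C)"
    using Jordan_inside_outside[OF g(1,2)] g(3) by auto
  have sub: "inside C \<subseteq> - C"
    by (auto simp: inside_def)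
  obtain x where x: "x \<in> inside C" using ne by blast
  have eq: "connected_component_set (- C) y = inside C" if y: "y \<in> inside C" for y
  proof
    show "connected_component_set (- C) y \<subseteq> inside C"
      using y inside_same_component by fastforce
    show "inside C \<subseteq> connected_component_set (- C) y"
      by (rule connected_component_maximal[OF y con sub])
  qed
  have "inside C \<in> components (- C)"
    using eq[OF x] x sub unfolding components_iff by blast
  moreover have "F = inside C" if F: "F \<in> components (- C)" "bounded F" for F
  proof -
    obtain y where y: "y \<in> - C" "F = connected_component_set (- C) y"
      using F(1) unfolding components_iff by blast
    with F(2) have "y \<in> inside C" by (simp add: inside_def)
    with y(2) eq show ?thesis by simp
  qed
  ultimately show ?thesis using bd by blast
qed

definition analytic_jordan_curve :: "complex set \<Rightarrow> bool" where
  "analytic_jordan_curve C \<longleftrightarrow>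
     (\<exists>A g. open A \<and> sphere 0 1 \<subseteq> A \<and> g holomorphic_on A \<and> inj_on g A \<and> C = g ` sphere 0 1)"

lemma analytic_jordan_curve_imp_jordan_curve:
  assumes "analytic_jordan_curve C"
  shows "jordan_curve C"
proof -
  obtain A g where A: "sphere 0 1 \<subseteq> A" "g holomorphic_on A" "inj_on g A"
    and C: "C = g ` sphere 0 1"
    using assms unfolding analytic_jordan_curve_def by blast
  have "simple_path (g \<circ> circlepath 0 1)"
  proof (rule simple_path_continuous_image)
    show "simple_path (circlepath 0 1)" by (simp add: simple_path_circlepath)
    show "continuous_on (path_image (circlepath 0 1)) g"
      using A(1,2) by (auto intro: continuous_on_subset holomorphic_on_imp_continuous_on)
    show "inj_on g (path_image (circlepath 0 1))"
      using A(1,3) by (auto intro: inj_on_subset)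
  qed
  moreover have "pathfinish (g \<circ> circlepath 0 1) = pathstart (g \<circ> circlepath 0 1)"
    by (simp add: pathfinish_compose pathstart_compose)
  moreover have "path_image (g \<circ> circlepath 0 1) = C"
    by (simp add: path_image_compose C)
  ultimately show ?thesis unfolding jordan_curve_def by blast
qed

definition analytic_jordan_domain :: "complex set \<Rightarrow> bool" where
  "analytic_jordan_domain D \<longleftrightarrow> (\<exists>C. analytic_jordan_curve C \<and> D = inside C)"

(* None is the point at infinity, as in Alexandroff_compactification. *)
type_synonym riemann_sphere = "complex option"

(* The sphere-valued map given by a meromorphic function f. The library's convention for
   nicely_meromorphic_on puts f z = 0 at a pole z. *)
definition sphere_val :: "(complex \<Rightarrow> complex) \<Rightarrow> complex \<Rightarrow> riemann_sphere" where
  "sphere_val f z = (if is_pole f z then None else Some (f z))"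

definition num_zeros :: "(complex \<Rightarrow> complex) \<Rightarrow> complex set \<Rightarrow> nat" where
  "num_zeros f D = (\<Sum>z\<in>{z\<in>D. sphere_val f z = Some 0}. nat (zorder f z))"

definition num_poles :: "(complex \<Rightarrow> complex) \<Rightarrow> complex set \<Rightarrow> nat" where
  "num_poles f D = (\<Sum>z\<in>{z\<in>D. sphere_val f z = None}. nat (- zorder f z))"

(* The self-map of the sphere induced by p / q, for coprime p and q with q nonzero. *)
fun quotient_map :: "complex poly \<Rightarrow> complex poly \<Rightarrow> riemann_sphere \<Rightarrow> riemann_sphere" where
  "quotient_map p q (Some z) = (if poly q z = 0 then None else Some (poly p z / poly q z))"
| "quotient_map p q None =
     (if degree q < degree p then None else Some (coeff p (degree q) / lead_coeff q))"

definition rational_map_of_degree :: "(riemann_sphere \<Rightarrow> riemann_sphere) \<Rightarrow> nat \<Rightarrow> bool" where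
  "rational_map_of_degree r d \<longleftrightarrow>
     (\<exists>p q. q \<noteq> 0 \<and> coprime p q \<and> r = quotient_map p q \<and> d = max (degree p) (degree q))"

(* The order of r at infinity, read in the chart 1 / z: a zero of multiplicity k has order k,
   a pole of multiplicity k has order -k. The order does not depend on the value 0 that is
   substituted for infinity. *)
definition order_at_infinity :: "(riemann_sphere \<Rightarrow> riemann_sphere) \<Rightarrow> int" where
  "order_at_infinity r =
     zorder (\<lambda>z. case r (Some (1 / z)) of None \<Rightarrow> 0 | Some w \<Rightarrow> w) 0"

end

theory Submission
  imports Defs "HOL-Computational_Algebra.Fundamental_Theorem_Algebra"
begin

text \<open>
  Put \<open>n = M - N\<close>. On the boundary of \<open>D\<close>, \<open>f\<close> has no critical points and its values lie on the
  Jordan curve \<open>\<Gamma>\<close> around 0, so it runs through \<open>\<Gamma>\<close> monotonically, \<open>\<bar>n\<bar>\<close> times by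
  the argument principle (in particular \<open>n \<noteq> 0\<close>). Therefore \<open>f = k powi n\<close> near the boundary
  with a univalent function \<open>k\<close> (\<open>seam_root\<close>). Glue \<open>D\<close> along \<open>k\<close> to the outside of the
  Jordan curve that is the image of the boundary, and add the point at infinity. The result is a
  sphere, and \<open>u \<mapsto> u powi n\<close> continues \<open>f\<close> to it: the continuation has the zeros and poles of
  \<open>f\<close> in \<open>D\<close>, and one of order \<open>\<bar>n\<bar>\<close> at infinity.

  If \<open>\<phi>\<close> is a conformal coordinate of the glued sphere with its pole at infinity, then \<open>f\<close> and the
  product of the powers \<open>(\<phi> - \<phi> z) powi zorder f z\<close> over the zeros and poles \<open>z\<close> in \<open>D\<close> have the same
  zeros and poles on the whole sphere. Their quotient is constant (\<open>glued_sphere_Liouville\<close>), which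
  is the factorization of \<open>f\<close> (\<open>divisor_product_representation\<close>); degree, zeros, poles and the order
  at infinity of the rational map can be read off from the product.

  The coordinate is the classical conformal welding along an analytic curve, constructed here by an
  integral equation. With Cauchy transforms along the two curves, gluing becomes the equation
  \<open>F = K F + b\<close> on the unit circle. Its kernel is the difference of two Cauchy kernels and therefore smooth
  (\<open>kernel_diff\<close>). The homogeneous equation has only the trivial solution, by the Liouville theorem on the
  sphere and on the complementary one that is glued from the other two sides
  (\<open>welding_equation_homogeneous\<close>). So the Fredholm alternative (\<open>Fredholm_circle_operator\<close>) gives
  functions on the glued sphere with a prescribed simple pole (\<open>additive_welding\<close>). The one with a pole at
  infinity is \<open>\<phi>\<close>; it is injective because multiplying \<open>\<phi> - \<phi> w0\<close> by the one with
  a pole at \<open>w0\<close> gives a nonzero constant (\<open>conformal_welding\<close>).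
\<close>

section \<open>Integrals depending holomorphically on a parameter\<close>

lemma continuous_on_parametric_integral:
  fixes f :: "'a::topological_space \<Rightarrow> real \<Rightarrow> 'b::euclidean_space"
  assumes "continuous_on (U \<times> {a..b}) (\<lambda>(x, t). f x t)"
  shows "continuous_on U (\<lambda>x. integral {a..b} (f x))"
  using integral_continuous_on_param[of U a b f] assms by simp

text \<open>
  Near a point \<open>(a, a)\<close> of the diagonal the Cauchy formula in the first variable, over a circle
  around \<open>a\<close>, expresses the kernel by its values off the diagonal. This gives joint continuity of
  kernels whose singularity on the diagonal has been removed in one variable only.
\<close>
lemma continuous_on_off_diagonal_imp_continuous_on:
  fixes K :: "complex \<Rightarrow> complex \<Rightarrow> complex"
  assumes A: "open A"
    and off: "continuous_on {(z, w) \<in> A \<times> A. z \<noteq> w} (\<lambda>(z, w). K z w)"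
    and hol: "\<And>w. w \<in> A \<Longrightarrow> (\<lambda>z. K z w) holomorphic_on A"
  shows "continuous_on (A \<times> A) (\<lambda>(z, w). K z w)"
proof -
  have near: "isCont (\<lambda>(z, w). K z w) (a, b)" if "a \<in> A" "b \<in> A" for a b
  proof (cases "a = b")
    case False
    have "{(z, w) \<in> A \<times> A. z \<noteq> w} = A \<times> A \<inter> {x. fst x \<noteq> snd x}" by auto
    moreover have "open (A \<times> A \<inter> {x. fst x \<noteq> snd x})"
      by (intro open_Int open_Times A open_Collect_neq continuous_intros)
    ultimately have "open {(z, w) \<in> A \<times> A. z \<noteq> w}" by simp
    with off False that show ?thesis
      by (subst (asm) continuous_on_eq_continuous_at) auto
  next
    case True
    obtain e where e: "e > 0" "ball a e \<subseteq> A" using openE[OF A \<open>a \<in> A\<close>] by metis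
    define r where "r = e / 3"
    have r: "r > 0" "cball a (2 * r) \<subseteq> A"
      using e by (auto simp: r_def subset_iff)
    let ?c = "circlepath a (2 * r)"
    let ?B = "ball a r \<times> ball a r"
    let ?h = "\<lambda>x t. K (?c t) (snd x) / (?c t - fst x) * vector_derivative ?c (at t)"
    have ct: "?c t \<in> A" "dist a (?c t) = 2 * r" for t
    proof -
      show "dist a (?c t) = 2 * r" using r
        by (simp add: circlepath dist_norm norm_mult)
      then show "?c t \<in> A" using r by (auto simp: subset_iff)
    qed
    have cc: "continuous_on UNIV ?c" unfolding circlepath by (intro continuous_intros)
    have ne: "?c t \<noteq> z" if "z \<in> ball a r" for z t
      using ct[of t] that r by auto
    have BA: "ball a r \<subseteq> A" using r by (auto simp: subset_iff)
    have "continuous_on (?B \<times> {0..1}) (\<lambda>(x, t). ?h x t)"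
    proof -
      have *: "continuous_on (?B \<times> {0..1})
              ((\<lambda>(z, w). K z w) \<circ> (\<lambda>y. (?c (snd y), snd (fst y))))"
      proof (rule continuous_on_compose)
        show "continuous_on (?B \<times> {0..1}) (\<lambda>y. (?c (snd y), snd (fst y)))"
          unfolding circlepath by (intro continuous_intros)
        have "w \<in> A" "?c t \<noteq> w" if "dist a w < r" for w t
          using ne[of w t] that BA by auto
        then show "continuous_on ((\<lambda>y. (?c (snd y), snd (fst y))) ` (?B \<times> {0..1})) (\<lambda>(z, w). K z w)"
          by (intro continuous_on_subset[OF off]) (use ct in auto)
      qed
      show ?thesis
        unfolding split_def vector_derivative_circlepath
        by (intro continuous_intros *[unfolded o_def split_def fst_conv snd_conv]
              continuous_on_compose2[OF cc])
           (use ne in auto)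
    qed
    then have "continuous_on ?B (\<lambda>x. integral {0..1} (?h x))"
      by (rule continuous_on_parametric_integral)
    then have "continuous_on ?B (\<lambda>x. integral {0..1} (?h x) / (2 * of_real pi * \<i>))"
      by (intro continuous_intros) auto
    moreover have "integral {0..1} (?h x) / (2 * of_real pi * \<i>) = (\<lambda>(z, w). K z w) x"
      if "x \<in> ?B" for x
    proof -
      obtain z w where x: "x = (z, w)" by force
      have "((\<lambda>u. K u w / (u - z)) has_contour_integral (2 * of_real pi * \<i> * K z w)) ?c"
        using that x r BA
        by (intro Cauchy_integral_circlepath_simple holomorphic_on_subset[OF hol])
           (auto simp: dist_norm norm_minus_commute)
      from contour_integral_unique[OF this] show ?thesis
        by (simp add: x contour_integral_integral)
    qed
    ultimately have "continuous_on ?B (\<lambda>(z, w). K z w)"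
      by (rule continuous_on_eq)
    moreover have "open ?B" by (intro open_Times) auto
    ultimately show ?thesis using True r
      by (auto simp: continuous_on_eq_continuous_at)
  qed
  show ?thesis
    by (subst continuous_on_eq_continuous_at) (use A near in \<open>auto intro: open_Times\<close>)
qed

text \<open>
  The derivative in the parameter is again a Cauchy integral, hence jointly continuous, so that
  the integral can be differentiated under the integral sign.
\<close>
lemma holomorphic_on_parametric_integral:
  fixes h :: "complex \<Rightarrow> real \<Rightarrow> complex"
  assumes A: "open A"
    and cont: "continuous_on (A \<times> {a..b}) (\<lambda>(z, t). h z t)"
    and hol: "\<And>t. t \<in> {a..b} \<Longrightarrow> (\<lambda>z. h z t) holomorphic_on A"
  shows "(\<lambda>z. integral {a..b} (h z)) holomorphic_on A"
proof -
  have loc: "\<exists>r>0. (\<lambda>z. integral {a..b} (h z)) holomorphic_on ball c r" if c: "c \<in> A" for c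
  proof -
    obtain e where e: "e > 0" "ball c e \<subseteq> A" using openE[OF A c] by metis
    define r where "r = e / 3"
    have r: "r > 0" "cball c (2 * r) \<subseteq> A" "ball c r \<subseteq> A"
      using e by (auto simp: r_def subset_iff)
    let ?c = "circlepath c (2 * r)"
    let ?d = "\<lambda>z t. integral {0..1} (\<lambda>s. h (?c s) t / (?c s - z)^2 * vector_derivative ?c (at s)) / (2 * of_real pi * \<i>)"
    have ct: "?c s \<in> A" "dist c (?c s) = 2 * r" for s
    proof -
      show "dist c (?c s) = 2 * r" using r
        by (simp add: circlepath dist_norm norm_mult)
      then show "?c s \<in> A" using r by (auto simp: subset_iff)
    qed
    have cc: "continuous_on UNIV ?c" unfolding circlepath by (intro continuous_intros)
    have ne: "?c s \<noteq> z" if "z \<in> ball c r" for z s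
      using ct[of s] that r by auto
    have der: "((\<lambda>z. h z t) has_field_derivative ?d z t) (at z within ball c r)"
      if "z \<in> ball c r" "t \<in> {a..b}" for z t
    proof -
      have hA: "(\<lambda>z. h z t) holomorphic_on cball c (2 * r)"
        using hol[OF that(2)] r holomorphic_on_subset by blast
      have "((\<lambda>z. h z t) has_field_derivative
          1 / (2 * of_real pi * \<i>) * contour_integral ?c (\<lambda>u. h u t / (u - z)^2)) (at z)"
        by (rule Cauchy_derivative_integral_circlepath)
           (use hA that r in \<open>auto intro!: holomorphic_on_imp_continuous_on
             intro: holomorphic_on_subset\<close>)
      then show ?thesis
        by (simp add: contour_integral_integral has_field_derivative_at_within)
    qed
    have "continuous_on ((ball c r \<times> {a..b}) \<times> {0..1})
        (\<lambda>(x, s). h (?c s) (snd x) / (?c s - fst x)^2 * vector_derivative ?c (at s))"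
    proof -
      have *: "continuous_on ((ball c r \<times> {a..b}) \<times> {0..1})
              ((\<lambda>(z, w). h z w) \<circ> (\<lambda>y. (?c (snd y), snd (fst y))))"
      proof (rule continuous_on_compose)
        show "continuous_on ((ball c r \<times> {a..b}) \<times> {0..1}) (\<lambda>y. (?c (snd y), snd (fst y)))"
          unfolding circlepath by (intro continuous_intros)
        show "continuous_on ((\<lambda>y. (?c (snd y), snd (fst y))) ` ((ball c r \<times> {a..b}) \<times> {0..1})) (\<lambda>(z, w). h z w)"
          by (intro continuous_on_subset[OF cont]) (use ct in auto)
      qed
      show ?thesis
        unfolding split_def vector_derivative_circlepath
        by (intro continuous_intros *[unfolded o_def split_def fst_conv snd_conv]
              continuous_on_compose2[OF cc])
           (use ne in auto)
    qed
    then have "continuous_on (ball c r \<times> {a..b}) (\<lambda>x. integral {0..1}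
        (\<lambda>s. h (?c s) (snd x) / (?c s - fst x)^2 * vector_derivative ?c (at s)))"
      by (rule continuous_on_parametric_integral)
    then have dcont: "continuous_on (ball c r \<times> {a..b}) (\<lambda>(z, t). ?d z t)"
      unfolding split_def by (intro continuous_intros) auto
    have int: "h z integrable_on {a..b}" if "z \<in> ball c r" for z
    proof (rule integrable_continuous_real)
      have "continuous_on {a..b} ((\<lambda>(z, t). h z t) \<circ> (\<lambda>t. (z, t)))"
        by (intro continuous_on_compose continuous_intros continuous_on_subset[OF cont])
           (use that r in auto)
      then show "continuous_on {a..b} (h z)" by (simp add: o_def)
    qed
    have "(\<lambda>z. integral (cbox a b) (h z)) holomorphic_on ball c r"
      by (rule leibniz_rule_holomorphic[where fx = ?d]) (use der dcont int in auto)
    then show ?thesis using r by auto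
  qed
  show ?thesis
  proof (rule analytic_imp_holomorphic)
    show "(\<lambda>z. integral {a..b} (h z)) analytic_on A"
      unfolding analytic_on_def using loc by blast
  qed
qed

definition unit_point :: "real \<Rightarrow> complex" where
  "unit_point t = exp (2 * of_real pi * \<i> * of_real t)"

text \<open>
  This is \<open>(1 / (2 \<pi> \<i>)) \<integral> F(w) dw\<close> over the unit circle, written as an integral over
  \<open>[0, 1]\<close> so that it makes sense for functions that are known only as functions of the angle.
\<close>
definition circle_mean :: "(complex \<Rightarrow> complex) \<Rightarrow> complex" where
  "circle_mean F = integral {0..1} (\<lambda>t. F (unit_point t) * unit_point t)"

lemma norm_unit_point [simp]: "norm (unit_point t) = 1"
  by (simp add: unit_point_def)

lemma unit_point_nonzero [simp]: "unit_point t \<noteq> 0"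
  by (simp add: unit_point_def)

lemma unit_point_add_int: "n \<in> \<int> \<Longrightarrow> unit_point (t + n) = unit_point t"
proof -
  assume "n \<in> \<int>"
  then obtain m where m: "n = of_int m" by (rule Ints_cases)
  have "exp (2 * of_real pi * \<i> * of_real n) = 1"
    using exp_integer_2pi[of "of_int m"] by (simp add: m mult_ac)
  then show ?thesis by (simp add: unit_point_def ring_distribs exp_add)
qed

lemma continuous_on_unit_point [continuous_intros]:
  "continuous_on S f \<Longrightarrow> continuous_on S (\<lambda>x. unit_point (f x))"
  unfolding unit_point_def by (intro continuous_intros)

lemma circlepath_unit_point: "circlepath 0 1 = unit_point"
  by (auto simp: circlepath unit_point_def fun_eq_iff)

lemma unit_circle_point:
  assumes "norm z = 1"
  obtains t where "t \<in> {0..1}" "z = unit_point t"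
proof -
  have "z \<in> path_image (circlepath 0 1)" using assms by simp
  then show ?thesis using that by (auto simp: path_image_def circlepath_unit_point)
qed

lemma circle_mean_eq: "circle_mean F = contour_integral (circlepath 0 1) F / (2 * of_real pi * \<i>)"
proof -
  have "contour_integral (circlepath 0 1) F
      = integral {0..1} (\<lambda>t. 2 * of_real pi * \<i> * (F (unit_point t) * unit_point t))"
    unfolding contour_integral_integral vector_derivative_circlepath
    by (simp add: circlepath_unit_point unit_point_def mult_ac)
  also have "\<dots> = 2 * of_real pi * \<i> * circle_mean F"
    by (simp add: circle_mean_def)
  finally show ?thesis by simp
qed

lemma circle_mean_integrable:
  "continuous_on (sphere 0 1) F \<Longrightarrow> (\<lambda>t. F (unit_point t) * unit_point t) integrable_on {0..1}"
  by (intro integrable_continuous_real continuous_on_mult continuous_on_unit_point continuous_on_id,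
      erule continuous_on_compose2)
     (auto intro!: continuous_on_unit_point)

lemma circle_mean_diff:
  "continuous_on (sphere 0 1) F \<Longrightarrow> continuous_on (sphere 0 1) G \<Longrightarrow>
    circle_mean (\<lambda>w. F w - G w) = circle_mean F - circle_mean G"
  by (simp add: circle_mean_def left_diff_distrib circle_mean_integrable Henstock_Kurzweil_Integration.integral_diff)

lemma circle_mean_cmult: "circle_mean (\<lambda>w. c * F w) = c * circle_mean F"
  by (simp add: circle_mean_def mult.assoc)

lemma circle_mean_cong:
  "(\<And>w. norm w = 1 \<Longrightarrow> F w = G w) \<Longrightarrow> circle_mean F = circle_mean G"
  by (simp add: circle_mean_def)

lemma holomorphic_on_circle_mean:
  assumes "open A"
    and "continuous_on (A \<times> sphere 0 1) (\<lambda>(z, w). K z w)"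
    and "\<And>w. w \<in> sphere 0 1 \<Longrightarrow> (\<lambda>z. K z w) holomorphic_on A"
  shows "(\<lambda>z. circle_mean (K z)) holomorphic_on A"
  unfolding circle_mean_def
proof (rule holomorphic_on_parametric_integral[OF assms(1)])
  have "continuous_on (A \<times> {0..1::real}) ((\<lambda>(z, w). K z w) \<circ> (\<lambda>x. (fst x, unit_point (snd x))))"
    by (intro continuous_on_compose continuous_on_subset[OF assms(2)] continuous_intros) auto
  then show "continuous_on (A \<times> {0..1}) (\<lambda>(z, t). K z (unit_point t) * unit_point t)"
    unfolding split_def o_def by (intro continuous_intros) auto
  show "(\<lambda>z. K z (unit_point t) * unit_point t) holomorphic_on A" for t
    by (intro holomorphic_intros assms) auto
qed

section \<open>Univalent annuli and their Cauchy kernels\<close>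

definition annulus :: "real \<Rightarrow> real \<Rightarrow> complex set" where
  "annulus a b = {z. a < norm z \<and> norm z < b}"

lemma mem_annulus [simp]: "z \<in> annulus a b \<longleftrightarrow> a < norm z \<and> norm z < b"
  by (simp add: annulus_def)

lemma open_annulus [simp, intro]: "open (annulus a b)"
  unfolding annulus_def by (intro open_Collect_conj open_Collect_less continuous_intros)

lemma connected_annulus_0 [simp, intro]: "connected (annulus a b)"
  using connected_annulus(1)[of a "0::complex" b] by (simp add: annulus_def)

lemma annulus_nonempty: "0 \<le> a \<Longrightarrow> a < b \<Longrightarrow> annulus a b \<noteq> {}"
  proof -
  assume "0 \<le> a" "a < b"
  then obtain c where "a < c" "c < b" using dense by blast
  with \<open>0 \<le> a\<close> have "of_real c \<in> annulus a b" by simp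
  then show ?thesis by blast
qed

lemma one_divide_less_one: "1 < (R::real) \<Longrightarrow> 1 / R < 1"
  by simp

lemma half_annulus_subset:
  assumes "1 < R"
  shows "annulus 1 R \<subseteq> annulus (1/R) R" "annulus (1/R) 1 \<subseteq> annulus (1/R) R"
  using one_divide_less_one[OF assms] assms unfolding annulus_def subset_iff mem_Collect_eq
  by (meson less_trans)+

lemma half_annulus_nonempty:
  assumes "1 < R"
  shows "\<exists>z. z \<in> annulus 1 R" "\<exists>z. z \<in> annulus (1/R) 1"
  using annulus_nonempty[of 1 R] annulus_nonempty[of "1/R" 1] assms by fastforce+

lemma sphere_subset_annulus: "1 < R \<Longrightarrow> sphere 0 1 \<subseteq> annulus (1/R) R"
  by auto

text \<open>
  Completed at \<open>z = a\<close> by the derivative, it stays holomorphic in \<open>z\<close> and, for a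
  univalent function, has no zeros. The removable singularities below are all expressed by it.
\<close>
definition difference_quotient :: "(complex \<Rightarrow> complex) \<Rightarrow> complex \<Rightarrow> complex \<Rightarrow> complex" where
  "difference_quotient f a z = (if z = a then deriv f a else (f z - f a) / (z - a))"

lemma holomorphic_on_difference_quotient:
  assumes "f holomorphic_on A" "open A"
  shows "difference_quotient f a holomorphic_on A"
  using pole_lemma_open[OF assms, of a] by (simp add: difference_quotient_def[abs_def])

lemma difference_quotient_nonzero:
  assumes "f holomorphic_on A" "open A" "inj_on f A" "a \<in> A" "z \<in> A"
  shows "difference_quotient f a z \<noteq> 0"
  using assms holomorphic_injective_imp_regular[OF assms(1-4)]
  by (auto simp: difference_quotient_def dest: inj_onD)

lemma difference_quotient_mult: "(z - a) * difference_quotient f a z = f z - f a"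
  by (simp add: difference_quotient_def)

text \<open>
  Off the diagonal this is \<open>p'(w) / (p(w) - p(z)) - q'(w) / (q(w) - q(z))\<close>. Both Cauchy kernels have the
  principal part \<open>1 / (w - z)\<close>, so their difference is smooth; this is what makes the welding
  equation a Fredholm equation.
\<close>
definition kernel_diff :: "(complex \<Rightarrow> complex) \<Rightarrow> (complex \<Rightarrow> complex) \<Rightarrow> complex \<Rightarrow> complex \<Rightarrow> complex" where
  "kernel_diff p q z w =
     - difference_quotient (\<lambda>s. deriv p w / difference_quotient p w s
                              - deriv q w / difference_quotient q w s) w z"

text \<open>
  Off the diagonal this is \<open>(F(w) - F(z)) p'(w) / (p(w) - p(z))\<close>, the Cauchy kernel of the curve
  \<open>p\<close> with its singularity removed by subtracting the value of the density at \<open>z\<close>.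
\<close>
definition kernel_quot :: "(complex \<Rightarrow> complex) \<Rightarrow> (complex \<Rightarrow> complex) \<Rightarrow> complex \<Rightarrow> complex \<Rightarrow> complex" where
  "kernel_quot F p z w = deriv p w * difference_quotient F w z / difference_quotient p w z"

lemma kernel_diff_off_diagonal:
  assumes "p holomorphic_on A" "open A" "inj_on p A" "q holomorphic_on A" "inj_on q A"
    and "w \<in> A" "z \<noteq> w"
  shows "kernel_diff p q z w = deriv p w / (p w - p z) - deriv q w / (q w - q z)"
proof -
  have "deriv p w \<noteq> 0" "deriv q w \<noteq> 0"
    using assms holomorphic_injective_imp_regular by blast+
  then have "kernel_diff p q z w = - ((deriv p w / ((p z - p w) / (z - w))
               - deriv q w / ((q z - q w) / (z - w))) / (z - w))"
    using assms(7) by (simp add: kernel_diff_def difference_quotient_def)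
  also have "\<dots> = deriv p w / (p w - p z) - deriv q w / (q w - q z)"
  proof -
    have *: "(a / (x / c) - b / (y / c)) / c = a / x - b / y" if "c \<noteq> 0" for a b c x y :: complex
      using that by (simp add: diff_divide_distrib)
    have "deriv p w / (p w - p z) = - (deriv p w / (p z - p w))"
         "deriv q w / (q w - q z) = - (deriv q w / (q z - q w))"
      by (metis minus_diff_eq minus_divide_right)+
    then show ?thesis using assms(7) *[of "z - w" "deriv p w" "p z - p w" "deriv q w" "q z - q w"] by (simp del: divide_divide_eq_right)
  qed
  finally show ?thesis .
qed

lemma kernel_quot_off_diagonal:
  assumes "z \<noteq> w"
  shows "kernel_quot F p z w = (F w - F z) * (deriv p w / (p w - p z))"
proof -
  have "kernel_quot F p z w = deriv p w * (F z - F w) / (p z - p w)"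
    using assms by (simp add: kernel_quot_def difference_quotient_def)
  also have "\<dots> = (F w - F z) * (deriv p w / (p w - p z))"
    by (metis (no_types, lifting) minus_diff_eq minus_divide_divide minus_mult_right mult.commute times_divide_eq_right)
  finally show ?thesis .
qed

lemma holomorphic_on_kernel_diff:
  assumes "p holomorphic_on A" "open A" "inj_on p A" "q holomorphic_on A" "inj_on q A" "w \<in> A"
  shows "(\<lambda>z. kernel_diff p q z w) holomorphic_on A"
  unfolding kernel_diff_def
  by (intro holomorphic_intros holomorphic_on_difference_quotient assms)
     (use assms difference_quotient_nonzero in blast)+

lemma holomorphic_on_kernel_quot:
  assumes "p holomorphic_on A" "open A" "inj_on p A" "F holomorphic_on A" "w \<in> A"
  shows "(\<lambda>z. kernel_quot F p z w) holomorphic_on A"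
  unfolding kernel_quot_def
  by (intro holomorphic_intros holomorphic_on_difference_quotient assms)
     (use assms difference_quotient_nonzero in blast)

lemma continuous_on_fst_snd:
  assumes "continuous_on A f"
  shows "continuous_on {(z, w) \<in> A \<times> A. P z w} (\<lambda>x. f (fst x))"
    and "continuous_on {(z, w) \<in> A \<times> A. P z w} (\<lambda>x. f (snd x))"
  by (rule continuous_on_compose2[OF assms]; force intro: continuous_intros)+

lemma continuous_on_kernel_diff:
  assumes "p holomorphic_on A" "open A" "inj_on p A" "q holomorphic_on A" "inj_on q A"
  shows "continuous_on (A \<times> A) (\<lambda>(z, w). kernel_diff p q z w)"
proof (rule continuous_on_off_diagonal_imp_continuous_on[OF \<open>open A\<close>])
  let ?S = "{(z, w) \<in> A \<times> A. z \<noteq> w}"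
  have c: "continuous_on A p" "continuous_on A q" "continuous_on A (deriv p)" "continuous_on A (deriv q)"
    using assms by (auto intro!: holomorphic_on_imp_continuous_on holomorphic_deriv)
  have "continuous_on ?S (\<lambda>x. deriv p (snd x) / (p (snd x) - p (fst x))
                            - deriv q (snd x) / (q (snd x) - q (fst x)))"
    using assms by (intro continuous_on_diff continuous_on_divide continuous_on_fst_snd c)
                   (auto dest: inj_onD)
  then show "continuous_on ?S (\<lambda>(z, w). kernel_diff p q z w)"
    by (rule continuous_on_eq) (use kernel_diff_off_diagonal[OF assms] in auto)
qed (use holomorphic_on_kernel_diff assms in blast)

lemma continuous_on_kernel_quot:
  assumes "p holomorphic_on A" "open A" "inj_on p A" "F holomorphic_on A"
  shows "continuous_on (A \<times> A) (\<lambda>(z, w). kernel_quot F p z w)"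
proof (rule continuous_on_off_diagonal_imp_continuous_on[OF \<open>open A\<close>])
  let ?S = "{(z, w) \<in> A \<times> A. z \<noteq> w}"
  have c: "continuous_on A p" "continuous_on A F" "continuous_on A (deriv p)"
    using assms by (auto intro!: holomorphic_on_imp_continuous_on holomorphic_deriv)
  have "continuous_on ?S (\<lambda>x. (F (snd x) - F (fst x)) * (deriv p (snd x) / (p (snd x) - p (fst x))))"
    using assms by (intro continuous_on_diff continuous_on_mult continuous_on_divide continuous_on_fst_snd c)
                   (auto dest: inj_onD)
  then show "continuous_on ?S (\<lambda>(z, w). kernel_quot F p z w)"
    by (rule continuous_on_eq) (use kernel_quot_off_diagonal in auto)
qed (use holomorphic_on_kernel_quot assms in blast)

section \<open>Seams and winding numbers\<close>

text \<open>
  A collar of an analytic Jordan curve: a univalent map of an annulus that sends the inner half to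
  the inside of the image of the unit circle and the outer half to its outside. Two seams
  \<open>g\<close> and \<open>k\<close> on the same annulus glue the inside of the first curve to the outside
  of the second one, by identifying \<open>g z\<close> with \<open>k z\<close>. Together with the point at
  infinity this is a sphere, and a function on it is a triple: a function on the inside of the first
  curve, one on the annulus and one on the outside of the second curve, which agree on the two
  halves of the annulus.
\<close>
definition seam :: "real \<Rightarrow> (complex \<Rightarrow> complex) \<Rightarrow> bool" where
  "seam R p \<longleftrightarrow> 1 < R \<and> p holomorphic_on annulus (1/R) R \<and> inj_on p (annulus (1/R) R)
     \<and> p ` annulus (1/R) 1 \<subseteq> inside (p ` sphere 0 1)
     \<and> p ` annulus 1 R \<subseteq> outside (p ` sphere 0 1)"

lemma seam_mono:
  assumes "seam R p" "1 < r" "r \<le> R"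
  shows "seam r p"
proof -
  have "1 / R \<le> 1 / r" using assms by (simp add: frac_le)
  then have "annulus (1/r) r \<subseteq> annulus (1/R) R" "annulus (1/r) 1 \<subseteq> annulus (1/R) 1"
            "annulus 1 r \<subseteq> annulus 1 R"
    using assms by auto
  then show ?thesis
    using assms unfolding seam_def
    by (blast intro: holomorphic_on_subset inj_on_subset)
qed

lemma univalent_circle_simple_path:
  assumes "1 < R" "p holomorphic_on annulus (1/R) R" "inj_on p (annulus (1/R) R)"
  shows "simple_path (p \<circ> circlepath 0 1)" "pathfinish (p \<circ> circlepath 0 1) = pathstart (p \<circ> circlepath 0 1)"
    "path_image (p \<circ> circlepath 0 1) = p ` sphere 0 1" "valid_path (p \<circ> circlepath 0 1)"
proof -
  have sub: "path_image (circlepath 0 1) \<subseteq> annulus (1/R) R"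
    using sphere_subset_annulus[OF assms(1)] by simp
  show "simple_path (p \<circ> circlepath 0 1)"
    using sub assms
    by (intro simple_path_continuous_image)
       (auto simp: simple_path_circlepath intro: continuous_on_subset holomorphic_on_imp_continuous_on inj_on_subset)
  show "pathfinish (p \<circ> circlepath 0 1) = pathstart (p \<circ> circlepath 0 1)"
    by (simp add: pathfinish_compose pathstart_compose)
  show "path_image (p \<circ> circlepath 0 1) = p ` sphere 0 1"
    by (simp add: path_image_compose)
  show "valid_path (p \<circ> circlepath 0 1)"
    using sub assms by (intro valid_path_compose_holomorphic[where S="annulus (1/R) R"]) auto
qed

lemma circle_mean_winding_number:
  assumes "1 < R" "p holomorphic_on annulus (1/R) R" "c \<notin> p ` sphere 0 1"
  shows "circle_mean (\<lambda>w. deriv p w / (p w - c)) = winding_number (p \<circ> circlepath 0 1) c"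
proof -
  have sub: "path_image (circlepath 0 1) \<subseteq> annulus (1/R) R"
    using sphere_subset_annulus[OF assms(1)] by simp
  have v: "valid_path (p \<circ> circlepath 0 1)"
    using sub assms by (intro valid_path_compose_holomorphic[where S="annulus (1/R) R"]) auto
  have "contour_integral (p \<circ> circlepath 0 1) (\<lambda>w. 1 / (w - c))
      = contour_integral (circlepath 0 1) (\<lambda>w. deriv p w * (1 / (p w - c)))"
    by (rule contour_integral_comp_analyticW[where s = "annulus (1/R) R"])
       (use assms sub in \<open>auto simp: analytic_on_open\<close>)
  then show ?thesis
    using v assms(3)
    by (simp add: winding_number_valid_path path_image_compose circle_mean_eq)
qed

text \<open>
  The difference between the winding number of the curve about \<open>p z\<close> and that of the unit circle
  about \<open>z\<close> is the integral of a smooth kernel, hence holomorphic in \<open>z\<close> across the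
  circle. It vanishes on the outer half, therefore also on the inner half: a seam is positively oriented.
\<close>
lemma winding_number_seam:
  assumes "seam R p"
  shows "z \<in> annulus (1/R) 1 \<Longrightarrow> circle_mean (\<lambda>w. deriv p w / (p w - p z)) = 1"
    and "z \<in> annulus 1 R \<Longrightarrow> circle_mean (\<lambda>w. deriv p w / (p w - p z)) = 0"
    and "a \<in> inside (p ` sphere 0 1) \<Longrightarrow> winding_number (p \<circ> circlepath 0 1) a = 1"
proof -
  let ?A = "annulus (1/R) R"
  have R: "1 < R" and hol: "p holomorphic_on ?A" and inj: "inj_on p ?A"
    and inn: "p ` annulus (1/R) 1 \<subseteq> inside (p ` sphere 0 1)"
    and out: "p ` annulus 1 R \<subseteq> outside (p ` sphere 0 1)"
    using assms by (auto simp: seam_def)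
  note path = univalent_circle_simple_path[OF R hol inj]
  define E where "E z = circle_mean (kernel_diff p (\<lambda>z. z) z)" for z
  have sA: "sphere 0 1 \<subseteq> ?A" by (rule sphere_subset_annulus[OF R])
  have holE: "E holomorphic_on ?A"
    unfolding E_def
  proof (rule holomorphic_on_circle_mean)
    show "continuous_on (?A \<times> sphere 0 1) (\<lambda>(z, w). kernel_diff p (\<lambda>z. z) z w)"
      by (rule continuous_on_subset[OF continuous_on_kernel_diff[OF hol _ inj]])
         (use sA in \<open>auto intro: holomorphic_intros\<close>)
    show "(\<lambda>z. kernel_diff p (\<lambda>z. z) z w) holomorphic_on ?A" if "w \<in> sphere 0 1" for w
      by (rule holomorphic_on_kernel_diff[OF hol _ inj]) (use that sA in \<open>auto intro: holomorphic_intros\<close>)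
  qed auto
  have cp: "continuous_on (sphere 0 1) p" "continuous_on (sphere 0 1) (deriv p)"
    using continuous_on_subset[OF holomorphic_on_imp_continuous_on sA] hol holomorphic_deriv[OF hol]
    by auto
  have E: "E z = winding_number (p \<circ> circlepath 0 1) (p z) - winding_number (circlepath 0 1) z"
    if "z \<in> ?A" "norm z \<noteq> 1" for z
  proof -
    have nz: "p z \<notin> p ` sphere 0 1" using that inj sA by (auto dest: inj_onD)
    have nw: "p w \<noteq> p z" if "norm w = 1" for w
      using nz that by (metis image_eqI mem_sphere_0)
    have "E z = circle_mean (\<lambda>w. deriv p w / (p w - p z) - 1 / (w - z))"
      unfolding E_def
      by (rule circle_mean_cong, subst kernel_diff_off_diagonal[OF hol _ inj])
         (use that sA in \<open>auto intro: holomorphic_intros\<close>)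
    also have "\<dots> = circle_mean (\<lambda>w. deriv p w / (p w - p z)) - circle_mean (\<lambda>w. 1 / (w - z))"
      by (rule circle_mean_diff; intro continuous_intros cp) (use that nw in auto)
    also have "circle_mean (\<lambda>w. 1 / (w - z)) = winding_number (circlepath 0 1) z"
      using that by (simp add: circle_mean_eq winding_number_valid_path)
    also have "circle_mean (\<lambda>w. deriv p w / (p w - p z)) = winding_number (p \<circ> circlepath 0 1) (p z)"
      by (rule circle_mean_winding_number[OF R hol nz])
    finally show ?thesis .
  qed
  have wout: "winding_number (p \<circ> circlepath 0 1) c = 0" if "c \<in> outside (p ` sphere 0 1)" for c
    using winding_number_zero_in_outside[of "p \<circ> circlepath 0 1" c] path that
    by (simp add: simple_path_imp_path)
  have E0: "E z = 0" if "z \<in> ?A" for z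
  proof (rule analytic_continuation_open[of "annulus 1 R" ?A E "\<lambda>_. 0"])
    have "winding_number (circlepath 0 1) z = 0" if "norm z > 1" for z
      by (rule winding_number_zero_outside[where s="cball 0 1"]) (use that in auto)
    then show "E z = 0" if "z \<in> annulus 1 R" for z
    proof -
      have "1 / R < norm z" using that one_divide_less_one[OF R] unfolding mem_annulus by linarith
      moreover have "p z \<in> outside (p ` sphere 0 1)" using out that by blast
      ultimately show ?thesis using that E[of z] wout \<open>\<And>z. norm z > 1 \<Longrightarrow> winding_number (circlepath 0 1) z = 0\<close>
        by auto
    qed
    show "annulus 1 R \<subseteq> ?A"  "annulus 1 R \<noteq> {}"
      using half_annulus_subset[OF R] R annulus_nonempty[of 1 R] by auto
  qed (use that holE in auto)
  have win: "winding_number (p \<circ> circlepath 0 1) (p z) = 1" if "z \<in> annulus (1/R) 1" for z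
  proof -
    have "winding_number (circlepath 0 1) z = 1"
      using that by (intro winding_number_circlepath) auto
    then show ?thesis using E[of z] E0[of z] that R by auto
  qed
  show "circle_mean (\<lambda>w. deriv p w / (p w - p z)) = 1" if "z \<in> annulus (1/R) 1"
  proof -
    have "p z \<in> inside (p ` sphere 0 1)" using inn that by blast
    then have "p z \<notin> p ` sphere 0 1" by (simp add: inside_def)
    then show ?thesis using circle_mean_winding_number[OF R hol] win[OF that] by simp
  qed
  show "circle_mean (\<lambda>w. deriv p w / (p w - p z)) = 0" if "z \<in> annulus 1 R"
  proof -
    have "p z \<in> outside (p ` sphere 0 1)" using out that by blast
    moreover from this have "p z \<notin> p ` sphere 0 1" by (simp add: outside_def)
    ultimately show ?thesis using circle_mean_winding_number[OF R hol] wout by simp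
  qed
  show "winding_number (p \<circ> circlepath 0 1) a = 1" if "a \<in> inside (p ` sphere 0 1)"
  proof -
    obtain z where z: "z \<in> annulus (1/R) 1" using half_annulus_nonempty(2)[OF R] by blast
    have "winding_number (p \<circ> circlepath 0 1) constant_on inside (p ` sphere 0 1)"
    proof (rule winding_number_constant)
      show "connected (inside (p ` sphere 0 1))"
        using Jordan_inside_outside[OF path(1,2)] path(3) by simp
      show "inside (p ` sphere 0 1) \<inter> path_image (p \<circ> circlepath 0 1) = {}"
        using path(3) by (auto simp: inside_def)
    qed (use path in \<open>auto simp: simple_path_imp_path\<close>)
    then show ?thesis using win[OF z] z inn that unfolding constant_on_def by (metis image_subset_iff)
  qed
qed

lemma seam_facts:
  assumes "seam R p"
  shows "1 < R" "p holomorphic_on annulus (1/R) R" "inj_on p (annulus (1/R) R)"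
    "\<And>z. z \<in> annulus (1/R) 1 \<Longrightarrow> p z \<in> inside (p ` sphere 0 1)"
    "\<And>z. z \<in> annulus 1 R \<Longrightarrow> p z \<in> outside (p ` sphere 0 1)"
    "open (inside (p ` sphere 0 1))" "connected (inside (p ` sphere 0 1))" "bounded (inside (p ` sphere 0 1))"
    "open (outside (p ` sphere 0 1))" "connected (outside (p ` sphere 0 1))" "\<not> bounded (outside (p ` sphere 0 1))"
    "inside (p ` sphere 0 1) \<noteq> {}"
    "compact (p ` sphere 0 1)"
proof -
  show *: "1 < R" "p holomorphic_on annulus (1/R) R" "inj_on p (annulus (1/R) R)"
    "\<And>z. z \<in> annulus (1/R) 1 \<Longrightarrow> p z \<in> inside (p ` sphere 0 1)"
    "\<And>z. z \<in> annulus 1 R \<Longrightarrow> p z \<in> outside (p ` sphere 0 1)"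
    using assms by (auto simp: seam_def)
  note path = univalent_circle_simple_path[OF *(1-3)]
  show "open (inside (p ` sphere 0 1))" "connected (inside (p ` sphere 0 1))" "bounded (inside (p ` sphere 0 1))"
    "open (outside (p ` sphere 0 1))" "connected (outside (p ` sphere 0 1))" "\<not> bounded (outside (p ` sphere 0 1))"
    "inside (p ` sphere 0 1) \<noteq> {}"
    using Jordan_inside_outside[OF path(1,2)] path(3) by auto
  show "compact (p ` sphere 0 1)"
    using compact_simple_path_image[OF path(1)] path(3) by simp
qed

lemma not_inside_and_outside: "\<not> (x \<in> inside S \<and> x \<in> outside S)"
  using inside_Int_outside by blast

lemma annulus_cases:
  assumes "z \<in> annulus (1/R) R"
  obtains "z \<in> annulus (1/R) 1" | "z \<in> sphere 0 1" | "z \<in> annulus 1 R"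
  using assms by (cases "norm z" "1::real" rule: linorder_cases) auto

section \<open>The Liouville theorem on a glued sphere\<close>

text \<open>
  The maximum principle on a compact surface. The functions \<open>u1\<close>, \<open>v\<close> and \<open>u2\<close> are one
  holomorphic function on the sphere that is glued from the outside of the curve of \<open>p\<close>, the annulus
  and the inside of the curve of \<open>q\<close>. Its modulus attains a maximum, so the function is constant,
  and its value at infinity is 0.
\<close>
theorem glued_sphere_Liouville:
  assumes p: "seam R p" and q: "seam R q"
    and u1: "u1 holomorphic_on outside (p ` sphere 0 1)" and lim: "(u1 \<longlongrightarrow> 0) at_infinity"
    and u2: "u2 holomorphic_on inside (q ` sphere 0 1)"
    and v: "v holomorphic_on annulus (1/R) R"
    and vp: "\<And>z. z \<in> annulus 1 R \<Longrightarrow> u1 (p z) = v z"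
    and vq: "\<And>z. z \<in> annulus (1/R) 1 \<Longrightarrow> u2 (q z) = v z"
  shows "z \<in> annulus (1/R) R \<Longrightarrow> v z = 0"
    and "w \<in> outside (p ` sphere 0 1) \<Longrightarrow> u1 w = 0"
    and "w \<in> inside (q ` sphere 0 1) \<Longrightarrow> u2 w = 0"
proof -
  let ?A = "annulus (1/R) R"
  let ?P = "p ` sphere 0 1" and ?Q = "q ` sphere 0 1"
  note fp = seam_facts[OF p] and fq = seam_facts[OF q]
  define \<rho> where "\<rho> = (1 + R) / 2"
  have \<rho>: "1 < \<rho>" "\<rho> < R" using fp(1) by (auto simp: \<rho>_def)
  then have \<rho>': "1 / R < 1 / \<rho>" "1 / \<rho> < 1" by (auto simp: frac_less2)
  define T where "T = {z::complex. 1 / \<rho> \<le> norm z \<and> norm z \<le> \<rho>}"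
  \<comment> \<open>The sphere is covered by the closed annulus T and by the parts X1 (closed) and
    X2 (compact) of the two sides that are bounded by its boundary circles.\<close>
  define X1 where "X1 = - (inside ?P \<union> p ` annulus (1/R) \<rho>)"
  define X2 where "X2 = - (outside ?Q \<union> q ` annulus (1/\<rho>) R)"
  have TA: "T \<subseteq> ?A" using \<rho> \<rho>' by (auto simp: T_def)
  have compT: "compact T"
  proof -
    have "T = cball 0 \<rho> - ball 0 (1/\<rho>)" by (auto simp: T_def)
    then show ?thesis by (simp add: compact_diff)
  qed
  have sub: "annulus (1/R) \<rho> \<subseteq> ?A" "annulus (1/\<rho>) R \<subseteq> ?A" "annulus 1 R \<subseteq> ?A" "annulus (1/R) 1 \<subseteq> ?A"
    using \<rho> \<rho>' half_annulus_subset[OF fp(1)] by auto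
  have op: "open (p ` annulus (1/R) \<rho>)" "open (q ` annulus (1/\<rho>) R)"
    using sub fp fq by (auto intro!: open_mapping_thm3 intro: holomorphic_on_subset inj_on_subset)
  have X1: "closed X1" unfolding X1_def using op fp by auto
  have X1_sub: "X1 \<subseteq> outside ?P"
  proof -
    have "sphere 0 1 \<subseteq> annulus (1/R) \<rho>" using \<rho> \<rho>' by auto
    then have "?P \<subseteq> p ` annulus (1/R) \<rho>" by (rule image_mono)
    then show ?thesis using inside_Un_outside[of ?P] unfolding X1_def by blast
  qed
  have X2_sub: "X2 \<subseteq> inside ?Q"
  proof -
    have "sphere 0 1 \<subseteq> annulus (1/\<rho>) R" using \<rho> \<rho>' by auto
    then have "?Q \<subseteq> q ` annulus (1/\<rho>) R" by (rule image_mono)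
    then show ?thesis using inside_Un_outside[of ?Q] unfolding X2_def by blast
  qed
  have X2: "compact X2"
    unfolding compact_eq_bounded_closed
    using X2_sub bounded_subset[OF fq(8)] op fq by (auto simp: X2_def)
  have out_cases: "w \<in> X1 \<or> (\<exists>z\<in>T. z \<in> annulus 1 R \<and> w = p z)" if w: "w \<in> outside ?P" for w
  proof (rule disjCI)
    assume "\<not> (\<exists>z\<in>T. z \<in> annulus 1 R \<and> w = p z)"
    moreover have "z \<in> T \<and> z \<in> annulus 1 R" if z: "z \<in> annulus (1/R) \<rho>" "w = p z" for z
    proof -
      have "z \<notin> annulus (1/R) 1" "z \<notin> sphere 0 1"
        using z fp(4)[of z] w inside_Int_outside[of ?P] by (auto simp: outside_def)
      then show ?thesis using z \<rho> \<rho>'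
        unfolding T_def mem_Collect_eq mem_annulus mem_sphere_0 by linarith
    qed
    ultimately show "w \<in> X1" using w inside_Int_outside[of ?P] unfolding X1_def by blast
  qed
  have in_cases: "w \<in> X2 \<or> (\<exists>z\<in>T. z \<in> annulus (1/R) 1 \<and> w = q z)" if w: "w \<in> inside ?Q" for w
  proof (rule disjCI)
    assume "\<not> (\<exists>z\<in>T. z \<in> annulus (1/R) 1 \<and> w = q z)"
    moreover have "z \<in> T \<and> z \<in> annulus (1/R) 1" if z: "z \<in> annulus (1/\<rho>) R" "w = q z" for z
    proof -
      have "z \<notin> annulus 1 R" "z \<notin> sphere 0 1"
        using z fq(5)[of z] w inside_Int_outside[of ?Q] by (auto simp: inside_def)
      then show ?thesis using z \<rho> \<rho>'
        unfolding T_def mem_Collect_eq mem_annulus mem_sphere_0 by linarith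
    qed
    ultimately show "w \<in> X2" using w inside_Int_outside[of ?Q] unfolding X2_def by blast
  qed
  have A_cases: "z \<in> T \<or> p z \<in> X1 \<and> z \<in> annulus 1 R \<or> q z \<in> X2 \<and> z \<in> annulus (1/R) 1" if z: "z \<in> ?A" for z
  proof (cases "norm z > \<rho>")
    case True
    then have "z \<in> annulus 1 R" using z \<rho> by auto
    moreover have "p z \<notin> p ` annulus (1/R) \<rho>"
      using True z fp(3) sub by (auto dest: inj_onD)
    ultimately show ?thesis using fp(5)[of z] not_inside_and_outside[of "p z" ?P] by (auto simp: X1_def)
  next
    case False
    show ?thesis
    proof (cases "norm z < 1 / \<rho>")
      case True
      then have "z \<in> annulus (1/R) 1" using z \<rho>' by auto
      moreover have "q z \<notin> q ` annulus (1/\<rho>) R"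
        using True z fq(3) sub by (auto dest: inj_onD)
      ultimately show ?thesis using fq(4)[of z] not_inside_and_outside[of "q z" ?Q] by (auto simp: X2_def)
    qed (use False in \<open>auto simp: T_def\<close>)
  qed
  define V where "V = (\<lambda>z. norm (v z)) ` T \<union> (\<lambda>w. norm (u2 w)) ` X2 \<union> (\<lambda>w. norm (u1 w)) ` X1"
  have inV: "z \<in> T \<Longrightarrow> norm (v z) \<in> V" "w \<in> X2 \<Longrightarrow> norm (u2 w) \<in> V" "w \<in> X1 \<Longrightarrow> norm (u1 w) \<in> V"
    for z w by (auto simp: V_def)
  have V3: "norm (v z) \<in> V" if "z \<in> ?A" for z
    using A_cases[OF that] inV(1)[of z] inV(2)[of "q z"] inV(3)[of "p z"] vp[of z] vq[of z]
    by (elim disjE) (auto simp del: mem_annulus)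
  have V1: "norm (u1 w) \<in> V" if "w \<in> outside ?P" for w
    using out_cases[OF that] inV(3)[of w] inV(1) vp by (auto simp del: mem_annulus)
  have V2: "norm (u2 w) \<in> V" if "w \<in> inside ?Q" for w
    using in_cases[OF that] inV(2)[of w] inV(1) vq by (auto simp del: mem_annulus)
  have V0: "s = 0" if "s \<in> V" for s
  proof (rule ccontr)
    assume "s \<noteq> 0"
    with that have s: "s > 0" by (auto simp: V_def)
    \<comment> \<open>A positive value is not approached near infinity, so only a bounded part of X1 matters.\<close>
    obtain B where B: "\<And>w. B \<le> norm w \<Longrightarrow> norm (u1 w) < s"
      using tendstoD[OF lim s] by (auto simp: eventually_at_infinity)
    define V' where "V' = (\<lambda>z. norm (v z)) ` T \<union> (\<lambda>w. norm (u2 w)) ` X2 \<union> (\<lambda>w. norm (u1 w)) ` (X1 \<inter> cball 0 B)"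
    have sV: "s \<in> V'" using that B by (force simp: V_def V'_def not_le[symmetric])
    have "compact V'"
      unfolding V'_def using compT X2 X1 TA X1_sub X2_sub u1 u2 v
      by (intro compact_Un compact_continuous_image continuous_on_norm holomorphic_on_imp_continuous_on)
         (auto intro: holomorphic_on_subset closed_Int_compact)
    then obtain m where m: "m \<in> V'" "\<And>x. x \<in> V' \<Longrightarrow> x \<le> m"
      using compact_attains_sup[of V'] sV by (metis empty_iff)
    have ms: "m \<ge> s" using m(2)[OF sV] .
    have V_le: "x \<le> m" if x: "x \<in> V" for x
    proof (cases "x \<in> V'")
      case False
      then obtain w where "x = norm (u1 w)" "w \<notin> cball 0 B"
        using x unfolding V_def V'_def by blast
      then show ?thesis using B[of w] ms by auto
    qed (use m in auto)
    have le1: "norm (u1 w) \<le> m" if "w \<in> outside ?P" for w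
      by (intro V_le V1 that)
    have le2: "norm (u2 w) \<le> m" if "w \<in> inside ?Q" for w
      by (intro V_le V2 that)
    have le3: "norm (v z) \<le> m" if "z \<in> ?A" for z
      by (intro V_le V3 that)
    \<comment> \<open>Wherever the maximum is attained, the function is constant there and on the adjacent
      pieces; on the outer piece this contradicts the limit at infinity.\<close>
    have c1: False if w: "w \<in> outside ?P" "norm (u1 w) = m" for w
    proof -
      have "u1 constant_on outside ?P"
        by (rule maximum_modulus_principle[OF u1 _ _ _ order_refl w(1)]) (use fp le1 w in auto)
      then have *: "norm (u1 x) = m" if "x \<in> outside ?P" for x
        using w that unfolding constant_on_def by metis
      obtain x where "x \<in> outside ?P" "norm x > B"
        using fp(11) unfolding bounded_iff by (auto simp: not_le)
      then show False using *[of x] B[of x] ms by auto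
    qed
    have c3: False if z: "z \<in> ?A" "norm (v z) = m" for z
    proof -
      have "v constant_on ?A"
        by (rule maximum_modulus_principle[OF v _ _ _ order_refl z(1)]) (use le3 z in auto)
      then have *: "norm (v x) = m" if "x \<in> ?A" for x
        using z that unfolding constant_on_def by metis
      obtain x where x: "x \<in> annulus 1 R" using half_annulus_nonempty(1)[OF fp(1)] by blast
      then have "x \<in> ?A" using sub by blast
      then show False using *[of x] c1[OF fp(5)[OF x]] vp[OF x] by auto
    qed
    have c2: False if w: "w \<in> inside ?Q" "norm (u2 w) = m" for w
    proof -
      have "u2 constant_on inside ?Q"
        by (rule maximum_modulus_principle[OF u2 _ _ _ order_refl w(1)]) (use fq le2 w in auto)
      then have *: "norm (u2 x) = m" if "x \<in> inside ?Q" for x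
        using w that unfolding constant_on_def by metis
      obtain x where x: "x \<in> annulus (1/R) 1" using half_annulus_nonempty(2)[OF fp(1)] by blast
      then have "x \<in> ?A" using sub by blast
      then show False using *[OF fq(4)[OF x]] c3[of x] vq[OF x] by auto
    qed
    show False using m(1) c1 c2 c3 TA X1_sub X2_sub unfolding V'_def by blast
  qed
  show "z \<in> ?A \<Longrightarrow> v z = 0" using V0[OF V3] by simp
  show "w \<in> outside ?P \<Longrightarrow> u1 w = 0" using V0[OF V1] by simp
  show "w \<in> inside ?Q \<Longrightarrow> u2 w = 0" using V0[OF V2] by simp
qed

section \<open>Cauchy transforms and the welding equation\<close>

definition cauchy_transform :: "(complex \<Rightarrow> complex) \<Rightarrow> (complex \<Rightarrow> complex) \<Rightarrow> complex \<Rightarrow> complex" where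
  "cauchy_transform p F c = circle_mean (\<lambda>w. F w * (deriv p w / (p w - c)))"

lemma continuous_on_sphere_seam:
  assumes "seam R p"
  shows "continuous_on (sphere 0 1) p" "continuous_on (sphere 0 1) (deriv p)"
  using continuous_on_subset[OF holomorphic_on_imp_continuous_on sphere_subset_annulus]
     seam_facts(1,2)[OF assms] holomorphic_deriv[OF seam_facts(2)[OF assms]]
  by auto

lemma continuous_on_snd_compose: "continuous_on S f \<Longrightarrow> continuous_on (U \<times> S) (\<lambda>x. f (snd x))"
  by (rule continuous_on_compose2) (auto intro: continuous_intros)

lemma holomorphic_on_cauchy_transform:
  assumes p: "seam R p" and F: "continuous_on (sphere 0 1) F"
  shows "cauchy_transform p F holomorphic_on - p ` sphere 0 1"
  unfolding cauchy_transform_def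
proof (rule holomorphic_on_circle_mean)
  show "open (- p ` sphere 0 1)"
    using seam_facts(13)[OF p] by (auto intro: compact_imp_closed)
  show "continuous_on ((- p ` sphere 0 1) \<times> sphere 0 1) (\<lambda>(z, w). F w * (deriv p w / (p w - z)))"
    unfolding split_def
    by (intro continuous_intros continuous_on_snd_compose continuous_on_sphere_seam[OF p] F) auto
  show "(\<lambda>z. F w * (deriv p w / (p w - z))) holomorphic_on - p ` sphere 0 1"
    if "w \<in> sphere 0 1" for w
    by (intro holomorphic_intros) (use that in auto)
qed

text \<open>
  In the coordinate \<open>s = 1 / c\<close> at infinity, \<open>c\<close> times the transform is
  \<open>circle_mean (\<lambda>w. F w * deriv p w / (s * p w - 1))\<close>, which is holomorphic at \<open>s = 0\<close>.
\<close>
lemma cauchy_transform_at_infinity: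
  assumes p: "seam R p" and F: "continuous_on (sphere 0 1) F"
  obtains a where "((\<lambda>c. c * cauchy_transform p F c) \<longlongrightarrow> a) at_infinity"
proof -
  obtain B where B: "B > 0" "\<And>w. w \<in> sphere 0 1 \<Longrightarrow> norm (p w) < B"
    using compact_imp_bounded[OF seam_facts(13)[OF p]] bounded_pos_less by (metis image_eqI)
  define H where "H s = circle_mean (\<lambda>w. F w * deriv p w / (s * p w - 1))" for s
  have ne: "s * p w \<noteq> 1" if "s \<in> ball 0 (1/B)" "w \<in> sphere 0 1" for s w
  proof
    assume "s * p w = 1"
    then have "norm s * norm (p w) = 1" by (metis norm_mult norm_one)
    moreover have "norm s * norm (p w) \<le> norm s * B" using B(2)[OF that(2)] by (simp add: mult_left_mono)
    moreover have "norm s * B < 1" using that(1) B(1) by (simp add: field_simps)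
    ultimately show False by linarith
  qed
  have "H holomorphic_on ball 0 (1/B)"
    unfolding H_def
  proof (rule holomorphic_on_circle_mean)
    show "continuous_on (ball 0 (1/B) \<times> sphere 0 1) (\<lambda>(s, w). F w * deriv p w / (s * p w - 1))"
      unfolding split_def
      by (intro continuous_intros continuous_on_snd_compose continuous_on_sphere_seam[OF p] F)
         (use ne in auto)
    show "(\<lambda>s. F w * deriv p w / (s * p w - 1)) holomorphic_on ball 0 (1/B)"
      if "w \<in> sphere 0 1" for w
      by (intro holomorphic_intros) (use ne that in auto)
  qed auto
  then have "isCont H 0"
    using B(1) by (intro continuous_on_interior[of "ball 0 (1/B)"] holomorphic_on_imp_continuous_on) auto
  then have "((\<lambda>c. H (inverse c)) \<longlongrightarrow> H 0) at_infinity"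
    by (rule isCont_tendsto_compose[OF _ tendsto_inverse_0])
  moreover have "c * cauchy_transform p F c = H (inverse c)" if "c \<noteq> 0" for c
  proof -
    have "c * (x * (y / (z - c))) = x * y / (inverse c * z - 1)" for x y z
    proof -
      have "inverse c * z - 1 = (z - c) / c" using that by (simp add: field_simps)
      then show ?thesis by simp
    qed
    then show ?thesis by (simp add: cauchy_transform_def H_def flip: circle_mean_cmult)
  qed
  then have "\<forall>\<^sub>F c in at_infinity. H (inverse c) = c * cauchy_transform p F c"
    by (intro eventually_mono[OF eventually_not_equal_at_infinity[of 0]]) metis
  ultimately have "((\<lambda>c. c * cauchy_transform p F c) \<longlongrightarrow> H 0) at_infinity"
    by (rule Lim_transform_eventually)
  then show thesis by (rule that)
qed

lemma tendsto_0_at_infinity_if_times: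
  fixes f :: "complex \<Rightarrow> complex"
  assumes "((\<lambda>c. c * f c) \<longlongrightarrow> a) at_infinity"
  shows "(f \<longlongrightarrow> 0) at_infinity"
proof -
  have "((\<lambda>c. inverse c * (c * f c)) \<longlongrightarrow> 0 * a) at_infinity"
    by (intro tendsto_intros assms tendsto_inverse_0)
  moreover have "\<forall>\<^sub>F c in at_infinity. inverse c * (c * f c) = f c"
    by (intro eventually_mono[OF eventually_not_equal_at_infinity[of 0]]) simp
  ultimately show ?thesis by (simp add: Lim_transform_eventually)
qed

lemma cauchy_transform_tendsto_0:
  assumes "seam R p" "continuous_on (sphere 0 1) F"
  shows "(cauchy_transform p F \<longlongrightarrow> 0) at_infinity"
  using cauchy_transform_at_infinity[OF assms] tendsto_0_at_infinity_if_times by blast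

text \<open>
  The Plemelj jump formula in analytic form: each one-sided transform continues holomorphically to the
  whole annulus, and the two continuations differ by the density. The function \<open>Q\<close> is the
  continuation from the outside.
\<close>
lemma cauchy_transform_jump:
  assumes p: "seam R p" and F: "F holomorphic_on annulus (1/R) R"
  obtains Q where "Q holomorphic_on annulus (1/R) R"
    "\<And>z. z \<in> annulus (1/R) 1 \<Longrightarrow> cauchy_transform p F (p z) = Q z + F z"
    "\<And>z. z \<in> annulus 1 R \<Longrightarrow> cauchy_transform p F (p z) = Q z"
proof
  let ?A = "annulus (1/R) R"
  let ?Q = "\<lambda>z. circle_mean (kernel_quot F p z)"
  note fp = seam_facts[OF p]
  have sA: "sphere 0 1 \<subseteq> ?A" by (rule sphere_subset_annulus[OF fp(1)])
  have cF: "continuous_on (sphere 0 1) F"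
    using F sA by (blast intro: continuous_on_subset holomorphic_on_imp_continuous_on)
  show "?Q holomorphic_on ?A"
  proof (rule holomorphic_on_circle_mean)
    show "continuous_on (?A \<times> sphere 0 1) (\<lambda>(z, w). kernel_quot F p z w)"
      by (rule continuous_on_subset[OF continuous_on_kernel_quot[OF fp(2) _ fp(3) F]])
         (use sA in auto)
    show "(\<lambda>z. kernel_quot F p z w) holomorphic_on ?A" if "w \<in> sphere 0 1" for w
      by (rule holomorphic_on_kernel_quot[OF fp(2) _ fp(3) F]) (use that sA in auto)
  qed auto
  have *: "?Q z = cauchy_transform p F (p z) - F z * circle_mean (\<lambda>w. deriv p w / (p w - p z))"
    if "z \<in> ?A" "norm z \<noteq> 1" for z
  proof -
    have nw: "p w \<noteq> p z" if "norm w = 1" for w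
      using inj_onD[OF fp(3), of w z] \<open>z \<in> ?A\<close> \<open>norm z \<noteq> 1\<close> sA that by auto
    have "?Q z = circle_mean (\<lambda>w. F w * (deriv p w / (p w - p z)) - F z * (deriv p w / (p w - p z)))"
      by (rule circle_mean_cong, subst kernel_quot_off_diagonal) (use that in \<open>auto simp: left_diff_distrib diff_divide_distrib\<close>)
    also have "\<dots> = cauchy_transform p F (p z) - F z * circle_mean (\<lambda>w. deriv p w / (p w - p z))"
      unfolding cauchy_transform_def circle_mean_cmult[symmetric]
      by (rule circle_mean_diff; intro continuous_intros continuous_on_sphere_seam[OF p] cF)
         (use nw in auto)
    finally show ?thesis .
  qed
  show "cauchy_transform p F (p z) = ?Q z + F z" if "z \<in> annulus (1/R) 1" for z
    using *[of z] winding_number_seam(1)[OF p that] that fp(1) by auto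
  show "cauchy_transform p F (p z) = ?Q z" if "z \<in> annulus 1 R" for z
    using *[of z] winding_number_seam(2)[OF p that] that half_annulus_subset[OF fp(1)] by auto
qed

text \<open>
  On the annulus this is the difference of the Cauchy transforms along the two curves, each
  taken in its own plane. The singularities on the circle cancel.
\<close>
definition welding_operator :: "(complex \<Rightarrow> complex) \<Rightarrow> (complex \<Rightarrow> complex) \<Rightarrow> (complex \<Rightarrow> complex) \<Rightarrow> complex \<Rightarrow> complex" where
  "welding_operator p q F z = circle_mean (\<lambda>w. kernel_diff p q z w * F w)"

lemma welding_operator_off_circle:
  assumes p: "seam R p" and q: "seam R q" and F: "continuous_on (sphere 0 1) F"
    and z: "z \<in> annulus (1/R) R" "norm z \<noteq> 1"
  shows "welding_operator p q F z = cauchy_transform p F (p z) - cauchy_transform q F (q z)"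
proof -
  let ?A = "annulus (1/R) R"
  note fp = seam_facts[OF p] and fq = seam_facts[OF q]
  have sA: "sphere 0 1 \<subseteq> ?A" by (rule sphere_subset_annulus[OF fp(1)])
  have nw: "p w \<noteq> p z" "q w \<noteq> q z" if "norm w = 1" for w
    using inj_onD[OF fp(3), of w z] inj_onD[OF fq(3), of w z] z sA that by auto
  have "welding_operator p q F z = circle_mean (\<lambda>w. F w * (deriv p w / (p w - p z)) - F w * (deriv q w / (q w - q z)))"
    unfolding welding_operator_def
    by (rule circle_mean_cong, subst kernel_diff_off_diagonal[OF fp(2) _ fp(3) fq(2,3)])
       (use z sA in \<open>auto simp: algebra_simps\<close>)
  also have "\<dots> = cauchy_transform p F (p z) - cauchy_transform q F (q z)"
    unfolding cauchy_transform_def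
    by (rule circle_mean_diff; intro continuous_intros continuous_on_sphere_seam[OF p] continuous_on_sphere_seam[OF q] F)
       (use nw in auto)
  finally show ?thesis .
qed

text \<open>
  Why solving \<open>F = K F + b1 + b2\<close>, with \<open>K\<close> the welding operator, solves the gluing problem.
  By the jump formula, the outer transform along \<open>g\<close> plus \<open>\<beta>1\<close> and the inner transform along
  \<open>k\<close> minus \<open>\<beta>2\<close> continue to the same function on the annulus. These two live on the
  complementary sphere, glued from the outside of the first curve and the inside of the second, where they
  vanish by the Liouville theorem. What is left of the jump formula expresses \<open>F\<close> on each side by
  the other two transforms.
\<close>
lemma welding_equation_solution:
  assumes g: "seam R g" and k: "seam R k"
    and F: "F holomorphic_on annulus (1/R) R"
    and b: "b1 holomorphic_on annulus (1/R) R" "b2 holomorphic_on annulus (1/R) R"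
    and \<beta>1: "\<beta>1 holomorphic_on outside (g ` sphere 0 1)" "(\<beta>1 \<longlongrightarrow> 0) at_infinity"
    and b1: "\<And>z. z \<in> annulus 1 R \<Longrightarrow> b1 z = \<beta>1 (g z)"
    and \<beta>2: "\<beta>2 holomorphic_on inside (k ` sphere 0 1)"
    and b2: "\<And>z. z \<in> annulus (1/R) 1 \<Longrightarrow> b2 z = \<beta>2 (k z)"
    and eq: "\<And>z. z \<in> annulus (1/R) R \<Longrightarrow> F z = welding_operator g k F z + b1 z + b2 z"
  shows "z \<in> annulus (1/R) 1 \<Longrightarrow> cauchy_transform g F (g z) = F z - b1 z"
    and "z \<in> annulus 1 R \<Longrightarrow> cauchy_transform k F (k z) = b2 z - F z"
proof -
  let ?A = "annulus (1/R) R"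
  note fg = seam_facts[OF g] and fk = seam_facts[OF k]
  have sA: "sphere 0 1 \<subseteq> ?A" by (rule sphere_subset_annulus[OF fg(1)])
  have sub: "annulus 1 R \<subseteq> ?A" "annulus (1/R) 1 \<subseteq> ?A"
    by (rule half_annulus_subset[OF fg(1)])+
  have cF: "continuous_on (sphere 0 1) F"
    using F sA by (blast intro: continuous_on_subset holomorphic_on_imp_continuous_on)
  obtain Qg where Qg: "Qg holomorphic_on ?A"
    "\<And>z. z \<in> annulus (1/R) 1 \<Longrightarrow> cauchy_transform g F (g z) = Qg z + F z"
    "\<And>z. z \<in> annulus 1 R \<Longrightarrow> cauchy_transform g F (g z) = Qg z"
    using cauchy_transform_jump[OF g F] by blast
  obtain Qk where Qk: "Qk holomorphic_on ?A"
    "\<And>z. z \<in> annulus (1/R) 1 \<Longrightarrow> cauchy_transform k F (k z) = Qk z + F z"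
    "\<And>z. z \<in> annulus 1 R \<Longrightarrow> cauchy_transform k F (k z) = Qk z"
    using cauchy_transform_jump[OF k F] by blast
  have diff: "F z = Qg z - Qk z + b1 z + b2 z" if "z \<in> ?A" for z
  proof (rule analytic_continuation_open[of "annulus 1 R" ?A F])
    show "F z = Qg z - Qk z + b1 z + b2 z" if "z \<in> annulus 1 R" for z
      using that eq[of z] welding_operator_off_circle[OF g k cF, of z] Qg(3)[OF that] Qk(3)[OF that] sub
      by auto
    show "annulus 1 R \<noteq> {}" using fg(1) annulus_nonempty[of 1 R] by auto
  qed (use that F Qg Qk b sub in \<open>auto intro!: holomorphic_intros\<close>)
  have lim: "((\<lambda>w. cauchy_transform g F w + \<beta>1 w) \<longlongrightarrow> 0) at_infinity"
    using tendsto_add[OF cauchy_transform_tendsto_0[OF g cF] \<beta>1(2)] by simp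
  have hol1: "(\<lambda>w. cauchy_transform g F w + \<beta>1 w) holomorphic_on outside (g ` sphere 0 1)"
    by (intro holomorphic_intros \<beta>1 holomorphic_on_subset[OF holomorphic_on_cauchy_transform[OF g cF]])
       (auto simp: outside_def)
  have hol2: "(\<lambda>w. cauchy_transform k F w - \<beta>2 w) holomorphic_on inside (k ` sphere 0 1)"
    by (intro holomorphic_intros \<beta>2 holomorphic_on_subset[OF holomorphic_on_cauchy_transform[OF k cF]])
       (auto simp: inside_def)
  \<comment> \<open>Here \<open>diff\<close> says that this function is also \<open>Qk z + F z - b2 z\<close>, the inner
    transform along k minus the datum on that side.\<close>
  have v0: "Qg z + b1 z = 0" if "z \<in> ?A" for z
    by (rule glued_sphere_Liouville(1)[OF g k hol1 lim hol2 _ _ _ that])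
       (use Qg Qk b b1 b2 diff sub in \<open>auto intro!: holomorphic_intros simp: subset_iff\<close>)
  show "cauchy_transform g F (g z) = F z - b1 z" if "z \<in> annulus (1/R) 1"
    using Qg(2)[OF that] v0[of z] that sub by (auto simp: add_eq_0_iff subset_iff)
  show "cauchy_transform k F (k z) = b2 z - F z" if "z \<in> annulus 1 R"
    using Qk(3)[OF that] v0[of z] diff[of z] that sub by (auto simp: add_eq_0_iff subset_iff)
qed

text \<open>
  With zero data the previous lemma makes \<open>F\<close> a holomorphic function on the sphere glued from the
  inside of the first curve and the outside of the second one that vanishes at infinity.
\<close>
lemma welding_equation_homogeneous:
  assumes g: "seam R g" and k: "seam R k"
    and F: "F holomorphic_on annulus (1/R) R"
    and eq: "\<And>z. z \<in> annulus (1/R) R \<Longrightarrow> F z = welding_operator g k F z"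
    and z: "z \<in> annulus (1/R) R"
  shows "F z = 0"
proof -
  let ?A = "annulus (1/R) R"
  have sA: "sphere 0 1 \<subseteq> ?A" by (rule sphere_subset_annulus[OF seam_facts(1)[OF g]])
  have cF: "continuous_on (sphere 0 1) F"
    using F sA by (blast intro: continuous_on_subset holomorphic_on_imp_continuous_on)
  have *: "z \<in> annulus (1/R) 1 \<Longrightarrow> cauchy_transform g F (g z) = F z"
     "z \<in> annulus 1 R \<Longrightarrow> cauchy_transform k F (k z) = - F z" for z
    using welding_equation_solution[OF g k F, of "\<lambda>_. 0" "\<lambda>_. 0" "\<lambda>_. 0" "\<lambda>_. 0"] eq by auto
  have "((\<lambda>w. - cauchy_transform k F w) \<longlongrightarrow> - 0) at_infinity"
    by (intro tendsto_minus cauchy_transform_tendsto_0[OF k cF])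
  then show ?thesis
    by (intro glued_sphere_Liouville(1)[OF k g _ _ _ F _ _ z,
          of "\<lambda>w. - cauchy_transform k F w" "cauchy_transform g F"])
       (use * in \<open>auto intro!: holomorphic_intros
           holomorphic_on_subset[OF holomorphic_on_cauchy_transform[OF k cF]]
           holomorphic_on_subset[OF holomorphic_on_cauchy_transform[OF g cF]]
           simp: outside_def inside_def simp del: mem_annulus\<close>)
qed

section \<open>The Fredholm alternative on the circle\<close>

text \<open>
  The dimension argument inside an arbitrary real vector space: the image of a basis is an independent set of
  the same cardinality, hence again a basis.
\<close>
lemma injective_endomorphism_of_span_surjective:
  fixes L :: "'a::real_vector \<Rightarrow> 'a"
  assumes L: "linear L" and B: "finite B" and maps: "L ` span B \<subseteq> span B"
    and inj: "\<And>v. v \<in> span B \<Longrightarrow> L v = 0 \<Longrightarrow> v = 0" and w: "w \<in> span B"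
  shows "\<exists>v\<in>span B. L v = w"
proof -
  obtain C where C: "C \<subseteq> B" "independent C" "B \<subseteq> span C"
    using maximal_independent_subset[of B] by blast
  have span: "span C = span B"
    using C span_mono[OF C(1)] span_minimal[OF C(3) subspace_span] by blast
  have fin: "finite C" using B C finite_subset by blast
  have injL: "inj_on L (span C)"
    using linear_injective_on_subspace_0[OF L subspace_span, of C] inj span by blast
  have ind: "independent (L ` C)"
    using linear_independent_injective_image[OF L C(2) injL] .
  have card: "card (L ` C) = card C"
    using card_image inj_on_subset[OF injL] span_superset by blast
  have LC: "L ` C \<subseteq> span C"
    using maps span span_superset[of C] by blast
  have "w \<in> span (L ` C)"
  proof (rule ccontr)
    assume w': "w \<notin> span (L ` C)"
    then have "independent (insert w (L ` C))"
      by (rule independent_insertI[OF _ ind])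
    moreover have "insert w (L ` C) \<subseteq> span C" using LC w span by blast
    ultimately have "card (insert w (L ` C)) \<le> card C"
      using independent_span_bound[OF fin] by blast
    moreover have "w \<notin> L ` C" using w' span_base[of w "L ` C"] by auto
    ultimately show False using card fin by simp
  qed
  then show ?thesis
    using linear_span_image[OF L, of C] span by auto
qed

text \<open>
  For operators of the form finite rank plus contraction. Inverting \<open>1 - K1\<close> by the contraction
  principle reduces the equation to one on the finite-dimensional range of the remaining
  operator, where injectivity implies surjectivity.
\<close>
theorem Fredholm_alternative:
  fixes K0 K1 :: "'a::{real_normed_vector, complete_space} \<Rightarrow> 'a"
  assumes K0: "linear K0" and K1: "linear K1"
    and small: "c < 1" "\<And>x. norm (K1 x) \<le> c * norm x"
    and fin: "finite B" "range K0 \<subseteq> span B"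
    and inj: "\<And>x. x = K0 x + K1 x \<Longrightarrow> x = 0"
  shows "\<exists>x. x = K0 x + K1 x + y"
proof -
  have ex1: "\<exists>!x. K1 x + y = x" for y
  proof (rule banach_fix_type[of "max c 0"])
    show "\<forall>x x'. dist (K1 x + y) (K1 x' + y) \<le> max c 0 * dist x x'"
    proof (intro allI)
      fix x x'
      have "dist (K1 x + y) (K1 x' + y) = norm (K1 (x - x'))"
        by (simp add: dist_norm linear_diff[OF K1])
      also have "\<dots> \<le> max c 0 * dist x x'"
        using small(2)[of "x - x'"] mult_right_mono[of c "max c 0" "norm (x - x')"]
        by (simp add: dist_norm)
      finally show "dist (K1 x + y) (K1 x' + y) \<le> max c 0 * dist x x'" .
    qed
  qed (use small in auto)
  define R where "R y = (THE x. K1 x + y = x)" for y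
  have R: "K1 (R y) + y = R y" for y
    unfolding R_def by (rule theI') (rule ex1)
  have Runiq: "R y = x" if "K1 x + y = x" for x y
    using ex1[of y] R[of y] that by blast
  have linR: "linear R"
  proof (rule linearI; rule Runiq)
    show "K1 (R a + R b) + (a + b) = R a + R b" for a b
    proof -
      have "K1 (R a + R b) + (a + b) = (K1 (R a) + a) + (K1 (R b) + b)"
        by (simp add: linear_add[OF K1] add_ac)
      then show ?thesis by (simp only: R)
    qed
    show "K1 (r *\<^sub>R R a) + r *\<^sub>R a = r *\<^sub>R R a" for r a
    proof -
      have "K1 (r *\<^sub>R R a) + r *\<^sub>R a = r *\<^sub>R (K1 (R a) + a)"
        by (simp add: linear_scale[OF K1] scaleR_add_right)
      then show ?thesis by (simp only: R)
    qed
  qed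
  have linRK: "linear (\<lambda>x. R (K0 x))"
    using linear_compose[OF K0 linR] by (simp add: o_def)
  define C where "C = R ` B"
  have RK: "R (K0 x) \<in> span C" for x
    using fin(2) linear_span_image[OF linR, of B] unfolding C_def by blast
  define L where "L v = v - R (K0 v)" for v
  have "\<exists>v\<in>span C. L v = R (K0 (R y))"
  proof (rule injective_endomorphism_of_span_surjective)
    show "linear L" unfolding L_def by (intro linear_compose_sub linear_ident linRK)
    show "finite C" using fin by (simp add: C_def)
    show "L ` span C \<subseteq> span C" using RK by (auto simp: L_def intro: span_diff)
    show "v = 0" if "L v = 0" for v
    proof (rule inj)
      have "v = R (K0 v)" using that by (simp add: L_def)
      then show "v = K0 v + K1 v" using R[of "K0 v"] by (simp add: add.commute)
    qed
  qed (rule RK)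
  then obtain v where v: "v - R (K0 v) = R (K0 (R y))" by (auto simp: L_def)
  let ?x = "R y + v"
  have "R (K0 ?x + y) = R (K0 (R y)) + R (K0 v) + R y"
    by (simp add: linear_add[OF linR] linear_add[OF K0])
  also have "\<dots> = ?x" using v by (simp add: algebra_simps)
  finally have "K1 ?x + (K0 ?x + y) = ?x" using R[of "K0 ?x + y"] by simp
  then show ?thesis by (metis add.assoc add.commute)
qed

lemma bcontfun_of_circle_function:
  fixes a :: "complex \<Rightarrow> complex"
  assumes "continuous_on (sphere 0 1) a"
  shows "(\<lambda>t. a (unit_point t)) \<in> bcontfun"
proof -
  have "compact (a ` sphere 0 1)" by (intro compact_continuous_image assms) auto
  then obtain b where "\<And>w. w \<in> sphere 0 1 \<Longrightarrow> norm (a w) \<le> b"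
    using compact_imp_bounded[of "a ` sphere 0 1"] unfolding bounded_iff by blast
  moreover have "continuous_on UNIV (\<lambda>t. a (unit_point t))"
    by (rule continuous_on_compose2[OF assms]) (auto intro: continuous_intros)
  ultimately show ?thesis by (intro bcontfun_normI[of _ b]) auto
qed

definition circle_bcontfun :: "(complex \<Rightarrow> complex) \<Rightarrow> (real \<Rightarrow>\<^sub>C complex)" where
  "circle_bcontfun a = Bcontfun (\<lambda>t. a (unit_point t))"

lemma apply_circle_bcontfun:
  "continuous_on (sphere 0 1) a \<Longrightarrow> apply_bcontfun (circle_bcontfun a) t = a (unit_point t)"
  by (simp add: circle_bcontfun_def Bcontfun_inverse bcontfun_of_circle_function)

text \<open>
  Functions on the circle are treated as bounded continuous functions of the angle on the whole real line,
  because these form a complete normed space; every function in the range is periodic.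
\<close>
definition circle_operator :: "(complex \<times> complex \<Rightarrow> complex) \<Rightarrow> (real \<Rightarrow>\<^sub>C complex) \<Rightarrow> (real \<Rightarrow>\<^sub>C complex)" where
  "circle_operator \<kappa> x =
     circle_bcontfun (\<lambda>z. integral {0..1} (\<lambda>s. \<kappa> (z, unit_point s) * apply_bcontfun x s * unit_point s))"

lemma circle_kernel_continuous:
  assumes "continuous_on (sphere 0 1 \<times> sphere 0 1) \<kappa>"
  shows "continuous_on (sphere 0 1 \<times> {0..1}) (\<lambda>(z, s). \<kappa> (z, unit_point s) * apply_bcontfun x s * unit_point s)"
proof -
  have "continuous_on (sphere 0 1 \<times> {0..1}) (\<lambda>y. \<kappa> (fst y, unit_point (snd y)))"
    by (rule continuous_on_compose2[OF assms]) (auto intro!: continuous_intros)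
  then show ?thesis
    unfolding split_def
    by (intro continuous_intros continuous_on_snd_compose continuous_on_apply_bcontfun)
qed

lemma apply_circle_operator:
  assumes "continuous_on (sphere 0 1 \<times> sphere 0 1) \<kappa>"
  shows "apply_bcontfun (circle_operator \<kappa> x) t
      = integral {0..1} (\<lambda>s. \<kappa> (unit_point t, unit_point s) * apply_bcontfun x s * unit_point s)"
  unfolding circle_operator_def
  by (subst apply_circle_bcontfun)
     (use continuous_on_parametric_integral[OF circle_kernel_continuous[OF assms]] in auto)

lemma circle_kernel_integrable:
  assumes "continuous_on (sphere 0 1 \<times> sphere 0 1) \<kappa>"
  shows "(\<lambda>s. \<kappa> (unit_point t, unit_point s) * apply_bcontfun x s * unit_point s) integrable_on {0..1}"
proof (rule integrable_continuous_real)
  have "continuous_on {0..1} (\<lambda>s. \<kappa> (unit_point t, unit_point s))"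
    by (rule continuous_on_compose2[OF assms]) (auto intro!: continuous_intros)
  then show "continuous_on {0..1} (\<lambda>s. \<kappa> (unit_point t, unit_point s) * apply_bcontfun x s * unit_point s)"
    by (intro continuous_on_mult continuous_on_apply_bcontfun continuous_on_unit_point continuous_on_id)
qed

lemma linear_circle_operator:
  assumes "continuous_on (sphere 0 1 \<times> sphere 0 1) \<kappa>"
  shows "linear (circle_operator \<kappa>)"
proof (rule linearI; rule bcontfun_eqI)
  note int = circle_kernel_integrable[OF assms]
  show "apply_bcontfun (circle_operator \<kappa> (x + y)) t = apply_bcontfun (circle_operator \<kappa> x + circle_operator \<kappa> y) t" for x y t
    by (simp only: apply_circle_operator[OF assms] plus_bcontfun.rep_eq
          Henstock_Kurzweil_Integration.integral_add[OF int int, symmetric])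
       (simp add: algebra_simps)
  show "apply_bcontfun (circle_operator \<kappa> (r *\<^sub>R x)) t = apply_bcontfun (r *\<^sub>R circle_operator \<kappa> x) t" for r x t
    by (simp only: apply_circle_operator[OF assms] scaleR_bcontfun.rep_eq
          Henstock_Kurzweil_Integration.integral_cmul[symmetric])
       (simp add: scaleR_conv_of_real mult_ac)
qed

lemma circle_operator_add:
  assumes "continuous_on (sphere 0 1 \<times> sphere 0 1) \<kappa>" "continuous_on (sphere 0 1 \<times> sphere 0 1) \<nu>"
  shows "circle_operator (\<lambda>p. \<kappa> p + \<nu> p) x = circle_operator \<kappa> x + circle_operator \<nu> x"
proof (rule bcontfun_eqI)
  note int = circle_kernel_integrable[OF assms(1)] circle_kernel_integrable[OF assms(2)]
  have c: "continuous_on (sphere 0 1 \<times> sphere 0 1) (\<lambda>p. \<kappa> p + \<nu> p)" by (intro continuous_intros assms)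
  show "apply_bcontfun (circle_operator (\<lambda>p. \<kappa> p + \<nu> p) x) t = apply_bcontfun (circle_operator \<kappa> x + circle_operator \<nu> x) t" for t
    by (simp only: apply_circle_operator[OF c] apply_circle_operator[OF assms(1)] apply_circle_operator[OF assms(2)]
          plus_bcontfun.rep_eq Henstock_Kurzweil_Integration.integral_add[OF int, symmetric])
       (simp add: algebra_simps)
qed

lemma norm_circle_operator_le:
  assumes "continuous_on (sphere 0 1 \<times> sphere 0 1) \<kappa>"
    and "\<And>p. p \<in> sphere 0 1 \<times> sphere 0 1 \<Longrightarrow> norm (\<kappa> p) \<le> c"
  shows "norm (circle_operator \<kappa> x) \<le> c * norm x"
proof (rule norm_bound)
  fix t
  have "norm (integral {0..1} (\<lambda>s. \<kappa> (unit_point t, unit_point s) * apply_bcontfun x s * unit_point s))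
      \<le> integral {0..1::real} (\<lambda>s. c * norm x)"
    by (rule integral_norm_bound_integral[OF circle_kernel_integrable[OF assms(1)]])
       (auto simp: norm_mult intro!: mult_mono assms(2) norm_bounded order_trans[OF norm_ge_zero assms(2)[of "(1,1)"]])
  then show "norm (apply_bcontfun (circle_operator \<kappa> x) t) \<le> c * norm x"
    by (simp add: apply_circle_operator[OF assms(1)])
qed

text \<open>
  Finite sums of products \<open>a(z) b(w)\<close>, whose integral operators have finite rank.
\<close>
inductive degenerate_kernel :: "(complex \<times> complex \<Rightarrow> complex) \<Rightarrow> bool" where
  tensor: "continuous_on UNIV a \<Longrightarrow> continuous_on UNIV b \<Longrightarrow> degenerate_kernel (\<lambda>p. a (fst p) * b (snd p))"
| add: "degenerate_kernel \<kappa> \<Longrightarrow> degenerate_kernel \<nu> \<Longrightarrow> degenerate_kernel (\<lambda>p. \<kappa> p + \<nu> p)"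

lemma degenerate_kernel_mult_tensor:
  assumes "degenerate_kernel \<kappa>" "continuous_on UNIV a" "continuous_on UNIV b"
  shows "degenerate_kernel (\<lambda>p. \<kappa> p * (a (fst p) * b (snd p)))"
  using assms(1)
proof induction
  case (tensor c d)
  have "degenerate_kernel (\<lambda>p. (c (fst p) * a (fst p)) * (d (snd p) * b (snd p)))"
    by (rule degenerate_kernel.tensor[where a = "\<lambda>z. c z * a z" and b = "\<lambda>z. d z * b z"])
       (intro continuous_on_mult assms tensor)+
  then show ?case by (simp add: mult_ac)
next
  case (add \<kappa> \<nu>)
  then show ?case using degenerate_kernel.add[OF add.IH] by (simp add: distrib_right)
qed

lemma degenerate_kernel_mult:
  assumes "degenerate_kernel \<nu>" "degenerate_kernel \<kappa>"
  shows "degenerate_kernel (\<lambda>p. \<kappa> p * \<nu> p)"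
  using assms(1)
proof induction
  case (tensor a b)
  then show ?case using degenerate_kernel_mult_tensor[OF assms(2)] by blast
next
  case (add \<nu> \<mu>)
  then show ?case using degenerate_kernel.add[OF add.IH] by (simp add: distrib_left)
qed

lemma degenerate_kernel_const: "degenerate_kernel (\<lambda>p. c)"
  using degenerate_kernel.tensor[of "\<lambda>_. c" "\<lambda>_. 1"] by (simp add: continuous_intros)

lemma degenerate_kernel_real_polynomial:
  fixes f :: "complex \<times> complex \<Rightarrow> real"
  assumes "real_polynomial_function f"
  shows "degenerate_kernel (\<lambda>p. of_real (f p))"
  using assms
proof induction
  case (linear f)
  have c: "continuous_on UNIV (\<lambda>z. complex_of_real (f (z, 0)))" "continuous_on UNIV (\<lambda>w. complex_of_real (f (0, w)))"
    by (intro continuous_intros bounded_linear.continuous_on[OF linear])+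
  have "f p = f (fst p, 0) + f (0, snd p)" for p
    using linear_add[OF bounded_linear.linear[OF linear], of "(fst p, 0)" "(0, snd p)"] by simp
  then have eq: "(\<lambda>p. complex_of_real (f p)) = (\<lambda>p. of_real (f (fst p, 0)) * 1 + 1 * of_real (f (0, snd p)))"
    by (intro ext) (metis mult.right_neutral mult_1 of_real_add)
  have "continuous_on UNIV (\<lambda>_::complex. 1::complex)" by (rule continuous_on_const)
  from degenerate_kernel.add[OF degenerate_kernel.tensor[OF c(1) this] degenerate_kernel.tensor[OF this c(2)]]
  show ?case by (simp only: eq)
qed (auto simp: degenerate_kernel_const degenerate_kernel.add degenerate_kernel_mult)

lemma degenerate_kernel_continuous:
  "degenerate_kernel \<kappa> \<Longrightarrow> continuous_on S \<kappa>"
proof (induction rule: degenerate_kernel.induct)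
  case (tensor a b)
  show ?case
    by (intro continuous_on_mult continuous_on_compose2[OF tensor(1)] continuous_on_compose2[OF tensor(2)])
       (auto intro: continuous_intros)
qed (auto intro: continuous_intros)

text \<open>
  The Stone-Weierstrass theorem, since polynomials in the real coordinates of both variables are degenerate.
\<close>
lemma degenerate_kernel_approximation:
  fixes \<kappa> :: "complex \<times> complex \<Rightarrow> complex"
  assumes "compact S" "continuous_on S \<kappa>" "0 < e"
  obtains \<nu> where "degenerate_kernel \<nu>" "\<And>p. p \<in> S \<Longrightarrow> norm (\<kappa> p - \<nu> p) < e"
proof -
  obtain g where g: "polynomial_function g" "\<And>p. p \<in> S \<Longrightarrow> norm (\<kappa> p - g p) < e"
    using Stone_Weierstrass_polynomial_function[OF assms] by blast
  have "real_polynomial_function (Re \<circ> g)" "real_polynomial_function (Im \<circ> g)"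
    using g(1) bounded_linear_Re bounded_linear_Im unfolding polynomial_function_def by blast+
  then have "degenerate_kernel (\<lambda>p. of_real (Re (g p)) + \<i> * of_real (Im (g p)))"
    by (auto dest!: degenerate_kernel_real_polynomial simp: o_def
        intro!: degenerate_kernel.add degenerate_kernel_mult degenerate_kernel_const)
  then have "degenerate_kernel g" by (simp add: complex_eq[symmetric])
  with g that show thesis by blast
qed

text \<open>
  A product kernel has range in the complex line spanned by \<open>a\<close>, that is, in the real span of
  \<open>a\<close> and \<open>\<i> a\<close>.
\<close>
lemma degenerate_kernel_finite_rank:
  "degenerate_kernel \<kappa> \<Longrightarrow> \<exists>B. finite B \<and> range (circle_operator \<kappa>) \<subseteq> span B"
proof (induction rule: degenerate_kernel.induct)
  case (tensor a b)
  have ca: "continuous_on (sphere 0 1) a" "continuous_on (sphere 0 1) (\<lambda>z. \<i> * a z)"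
    using continuous_on_subset[OF tensor(1)] by (auto intro!: continuous_intros)
  let ?e = "circle_bcontfun a" and ?f = "circle_bcontfun (\<lambda>z. \<i> * a z)"
  have "circle_operator (\<lambda>p. a (fst p) * b (snd p)) x \<in> span {?e, ?f}" for x
  proof -
    define c where "c = integral {0..1} (\<lambda>s. b (unit_point s) * apply_bcontfun x s * unit_point s)"
    have "circle_operator (\<lambda>p. a (fst p) * b (snd p)) x = Re c *\<^sub>R ?e + Im c *\<^sub>R ?f"
    proof (rule bcontfun_eqI)
      fix t
      have "apply_bcontfun (circle_operator (\<lambda>p. a (fst p) * b (snd p)) x) t = a (unit_point t) * c"
        by (subst apply_circle_operator)
           (use degenerate_kernel_continuous[OF degenerate_kernel.tensor[OF tensor]] in
             \<open>auto simp: c_def mult.assoc\<close>)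
      also have "\<dots> = apply_bcontfun (Re c *\<^sub>R ?e + Im c *\<^sub>R ?f) t"
        by (simp add: apply_circle_bcontfun[OF ca(1)] apply_circle_bcontfun[OF ca(2)] complex_eq_iff algebra_simps)
      finally show "apply_bcontfun (circle_operator (\<lambda>p. a (fst p) * b (snd p)) x) t = apply_bcontfun (Re c *\<^sub>R ?e + Im c *\<^sub>R ?f) t" .
    qed
    then show ?thesis by (simp add: span_add span_scale span_base)
  qed
  then show ?case by (intro exI[of _ "{?e, ?f}"]) auto
next
  case (add \<kappa> \<nu>)
  then obtain B C where "finite B" "range (circle_operator \<kappa>) \<subseteq> span B"
    "finite C" "range (circle_operator \<nu>) \<subseteq> span C" by blast
  moreover have "span B \<subseteq> span (B \<union> C)" "span C \<subseteq> span (B \<union> C)"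
    by (intro span_mono; blast)+
  ultimately have "circle_operator \<kappa> x + circle_operator \<nu> x \<in> span (B \<union> C)" for x
    by (intro span_add) blast+
  then show ?case
    using add.hyps \<open>finite B\<close> \<open>finite C\<close>
    by (intro exI[of _ "B \<union> C"]) (auto simp: circle_operator_add degenerate_kernel_continuous)
qed

text \<open>
  A degenerate kernel within distance 1/2 of the given one leaves a contraction as remainder.
\<close>
theorem Fredholm_circle_operator:
  assumes \<kappa>: "continuous_on (sphere 0 1 \<times> sphere 0 1) \<kappa>"
    and inj: "\<And>x. x = circle_operator \<kappa> x \<Longrightarrow> x = 0"
  shows "\<exists>x. x = circle_operator \<kappa> x + y"
proof -
  let ?S = "sphere 0 1 \<times> sphere 0 1 :: (complex \<times> complex) set"
  obtain \<nu> where \<nu>: "degenerate_kernel \<nu>" "\<And>p. p \<in> ?S \<Longrightarrow> norm (\<kappa> p - \<nu> p) < 1 / 2"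
    using degenerate_kernel_approximation[of ?S \<kappa> "1/2"] \<kappa> by (auto simp: compact_Times)
  obtain B where B: "finite B" "range (circle_operator \<nu>) \<subseteq> span B"
    using degenerate_kernel_finite_rank[OF \<nu>(1)] by blast
  have c\<nu>: "continuous_on ?S \<nu>" by (rule degenerate_kernel_continuous[OF \<nu>(1)])
  have cd: "continuous_on ?S (\<lambda>p. \<kappa> p - \<nu> p)" by (intro continuous_intros \<kappa> c\<nu>)
  have split: "circle_operator \<kappa> x = circle_operator \<nu> x + circle_operator (\<lambda>p. \<kappa> p - \<nu> p) x" for x
    using circle_operator_add[OF c\<nu> cd, of x] by simp
  show ?thesis
    unfolding split
    by (rule Fredholm_alternative[where c = "1/2", OF linear_circle_operator[OF c\<nu>]
          linear_circle_operator[OF cd] _ _ B])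
       (use norm_circle_operator_le[OF cd, of "1/2"] \<nu>(2) inj in \<open>auto simp: less_imp_le split\<close>)
qed

section \<open>Conformal welding of two seams\<close>

lemma continuous_on_circle_kernel_diff:
  assumes g: "seam R g" and k: "seam R k"
  shows "continuous_on (sphere 0 1 \<times> sphere 0 1) (\<lambda>(z, w). kernel_diff g k z w)"
  using sphere_subset_annulus[OF seam_facts(1)[OF g]]
  by (intro continuous_on_subset[OF continuous_on_kernel_diff[OF seam_facts(2)[OF g] _
        seam_facts(3)[OF g] seam_facts(2,3)[OF k]]]) auto

text \<open>
  The right-hand side of the welding equation is defined and holomorphic on the annulus,
  so a solution on the circle extends by the equation itself.
\<close>
lemma circle_solution_extends:
  assumes g: "seam R g" and k: "seam R k" and b: "b holomorphic_on annulus (1/R) R"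
    and x: "x = circle_operator (\<lambda>(z, w). kernel_diff g k z w) x + circle_bcontfun b"
  obtains F where "F holomorphic_on annulus (1/R) R"
    "\<And>z. z \<in> annulus (1/R) R \<Longrightarrow> F z = welding_operator g k F z + b z"
    "\<And>t. apply_bcontfun x t = F (unit_point t)"
proof -
  let ?A = "annulus (1/R) R"
  note fg = seam_facts[OF g] and fk = seam_facts[OF k]
  have sA: "sphere 0 1 \<subseteq> ?A" by (rule sphere_subset_annulus[OF fg(1)])
  have cb: "continuous_on (sphere 0 1) b"
    using b sA by (blast intro: continuous_on_subset holomorphic_on_imp_continuous_on)
  define F where "F z = integral {0..1} (\<lambda>s. kernel_diff g k z (unit_point s) * apply_bcontfun x s * unit_point s) + b z" for z
  have "(\<lambda>z. integral {0..1} (\<lambda>s. kernel_diff g k z (unit_point s) * apply_bcontfun x s * unit_point s)) holomorphic_on ?A"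
  proof (rule holomorphic_on_parametric_integral)
    have "continuous_on (?A \<times> {0..1}) (\<lambda>y. case (fst y, unit_point (snd y)) of (z, w) \<Rightarrow> kernel_diff g k z w)"
      by (rule continuous_on_compose2[OF continuous_on_kernel_diff[OF fg(2) _ fg(3) fk(2,3)]])
         (use sA in \<open>auto intro!: continuous_intros\<close>)
    then show "continuous_on (?A \<times> {0..1}) (\<lambda>(z, s). kernel_diff g k z (unit_point s) * apply_bcontfun x s * unit_point s)"
      unfolding split_def fst_conv snd_conv
      by (intro continuous_intros continuous_on_snd_compose continuous_on_apply_bcontfun)
    show "(\<lambda>z. kernel_diff g k z (unit_point t) * apply_bcontfun x t * unit_point t) holomorphic_on ?A" for t
      by (intro holomorphic_intros holomorphic_on_kernel_diff[OF fg(2) _ fg(3) fk(2,3)])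
        (use subsetD[OF sA, of "unit_point t"] in auto)
  qed auto
  then have "F holomorphic_on ?A"
    unfolding F_def by (intro holomorphic_intros b)
  moreover have xF: "apply_bcontfun x t = F (unit_point t)" for t
    by (subst x, simp add: F_def apply_circle_operator[OF continuous_on_circle_kernel_diff[OF g k]]
          apply_circle_bcontfun[OF cb])
  moreover have "F z = welding_operator g k F z + b z" for z
    unfolding welding_operator_def circle_mean_def xF[symmetric] by (simp add: F_def)
  ultimately show thesis using that by blast
qed

text \<open>
  By the Fredholm alternative, existence follows from the uniqueness statement
  \<open>welding_equation_homogeneous\<close>.
\<close>
theorem welding_equation_solvable:
  assumes g: "seam R g" and k: "seam R k" and b: "b holomorphic_on annulus (1/R) R"
  obtains F where "F holomorphic_on annulus (1/R) R"
    "\<And>z. z \<in> annulus (1/R) R \<Longrightarrow> F z = welding_operator g k F z + b z"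
proof -
  let ?A = "annulus (1/R) R"
  let ?\<kappa> = "\<lambda>(z, w). kernel_diff g k z w"
  have sA: "sphere 0 1 \<subseteq> ?A" by (rule sphere_subset_annulus[OF seam_facts(1)[OF g]])
  have z0: "circle_bcontfun (\<lambda>_. 0) = 0"
    by (rule bcontfun_eqI) (simp add: apply_circle_bcontfun)
  have "\<exists>x. x = circle_operator ?\<kappa> x + circle_bcontfun b"
  proof (rule Fredholm_circle_operator[OF continuous_on_circle_kernel_diff[OF g k]])
    fix x assume "x = circle_operator ?\<kappa> x"
    then have "x = circle_operator ?\<kappa> x + circle_bcontfun (\<lambda>_. 0)" by (simp add: z0)
    then obtain F where F: "F holomorphic_on ?A"
      "\<And>z. z \<in> ?A \<Longrightarrow> F z = welding_operator g k F z + 0" "\<And>t. apply_bcontfun x t = F (unit_point t)"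
      using circle_solution_extends[OF g k, of "\<lambda>_. 0" x] by auto
    show "x = 0"
    proof (rule bcontfun_eqI)
      fix t
      have "unit_point t \<in> ?A" by (rule subsetD[OF sA]) simp
      then show "apply_bcontfun x t = apply_bcontfun 0 t"
        using welding_equation_homogeneous[OF g k F(1)] F(2,3) by simp
    qed
  qed
  then show thesis using circle_solution_extends[OF g k b] that by metis
qed

text \<open>
  The additive Cousin problem on the glued sphere: there is a function with the prescribed singular
  parts \<open>\<beta>1\<close> on the first piece and \<open>\<beta>2\<close> on the second. The limit \<open>a\<close> is the
  derivative of the holomorphic part at infinity.
\<close>
theorem additive_welding:
  assumes g: "seam R g" and k: "seam R k"
    and b: "b1 holomorphic_on annulus (1/R) R" "b2 holomorphic_on annulus (1/R) R"
    and \<beta>1: "\<beta>1 holomorphic_on outside (g ` sphere 0 1)" "(\<beta>1 \<longlongrightarrow> 0) at_infinity"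
    and b1: "\<And>z. z \<in> annulus 1 R \<Longrightarrow> b1 z = \<beta>1 (g z)"
    and \<beta>2: "\<beta>2 holomorphic_on inside (k ` sphere 0 1)"
    and b2: "\<And>z. z \<in> annulus (1/R) 1 \<Longrightarrow> b2 z = \<beta>2 (k z)"
  obtains \<Phi> \<eta> F a where "\<Phi> holomorphic_on inside (g ` sphere 0 1)" "\<eta> holomorphic_on outside (k ` sphere 0 1)"
    "F holomorphic_on annulus (1/R) R" "((\<lambda>w. w * \<eta> w) \<longlongrightarrow> a) at_infinity"
    "\<And>z. z \<in> annulus (1/R) 1 \<Longrightarrow> F z = \<Phi> (g z) + b1 z"
    "\<And>z. z \<in> annulus 1 R \<Longrightarrow> F z = \<eta> (k z) + b2 z"
proof -
  let ?A = "annulus (1/R) R"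
  have sA: "sphere 0 1 \<subseteq> ?A" by (rule sphere_subset_annulus[OF seam_facts(1)[OF g]])
  obtain F where F: "F holomorphic_on ?A" "\<And>z. z \<in> ?A \<Longrightarrow> F z = welding_operator g k F z + (b1 z + b2 z)"
    using welding_equation_solvable[OF g k, of "\<lambda>z. b1 z + b2 z"] b by (auto intro: holomorphic_intros)
  have cF: "continuous_on (sphere 0 1) F"
    using F(1) sA by (blast intro: continuous_on_subset holomorphic_on_imp_continuous_on)
  note sol = welding_equation_solution[OF g k F(1) b \<beta>1 b1 \<beta>2 b2]
  obtain a where a: "((\<lambda>c. c * cauchy_transform k F c) \<longlongrightarrow> a) at_infinity"
    using cauchy_transform_at_infinity[OF k cF] by blast
  show thesis
  proof (rule that[of "cauchy_transform g F" "\<lambda>w. - cauchy_transform k F w" F "- a"])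
    show "cauchy_transform g F holomorphic_on inside (g ` sphere 0 1)"
      by (rule holomorphic_on_subset[OF holomorphic_on_cauchy_transform[OF g cF]]) (auto simp: inside_def)
    show "(\<lambda>w. - cauchy_transform k F w) holomorphic_on outside (k ` sphere 0 1)"
      by (intro holomorphic_intros holomorphic_on_subset[OF holomorphic_on_cauchy_transform[OF k cF]])
         (auto simp: outside_def)
    show "((\<lambda>w. w * - cauchy_transform k F w) \<longlongrightarrow> - a) at_infinity"
      using tendsto_minus[OF a] by simp
    show "F z = cauchy_transform g F (g z) + b1 z" if "z \<in> annulus (1/R) 1" for z
      using sol(1)[OF _ _ _ that] F(2) by (simp add: add.assoc)
    show "F z = - cauchy_transform k F (k z) + b2 z" if "z \<in> annulus 1 R" for z
      using sol(2)[OF _ _ _ that] F(2) by (simp add: add.assoc)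
  qed (rule F(1))
qed

text \<open>
  To prescribe a pole at \<open>w\<close> as a datum on the collar, \<open>w\<close> must be off the collar.
\<close>
lemma seam_shrink_avoiding:
  assumes g: "seam R g" and w: "w \<in> inside (g ` sphere 0 1)"
  obtains r where "1 < r" "r \<le> R" "w \<notin> g ` annulus (1/r) r"
proof (cases "w \<in> g ` annulus (1/R) R")
  case True
  then obtain z where z: "w = g z" "z \<in> annulus (1/R) R" by blast
  note fg = seam_facts[OF g]
  have "norm z < 1"
  proof (rule ccontr)
    assume "\<not> norm z < 1"
    then have "z \<in> sphere 0 1 \<or> z \<in> annulus 1 R" using z by auto
    then show False using fg(5)[of z] z w not_inside_and_outside[of w "g ` sphere 0 1"]
      by (auto simp: inside_def)
  qed
  moreover have z0: "norm z > 0" using z fg(1) by (metis less_trans mem_annulus zero_less_divide_1_iff zero_less_one)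
  ultimately have "1 < 1 / norm z" by simp
  then obtain r where r: "1 < r" "r < 1 / norm z" using dense by blast
  define r' where "r' = min r R"
  have r': "1 < r'" "r' \<le> R" "r' \<le> r" using r fg(1) by (auto simp: r'_def)
  have "norm z < 1 / r" using r z0 by (simp add: field_simps)
  also have "\<dots> \<le> 1 / r'" using r' by (simp add: frac_le)
  finally have nz: "z \<notin> annulus (1/r') r'" by simp
  have "1 / R \<le> 1 / r'" using r' by (simp add: frac_le)
  then have "annulus (1/r') r' \<subseteq> annulus (1/R) R" using r' by auto
  then have "w \<notin> g ` annulus (1/r') r'"
    using nz z fg(3) by (auto dest!: inj_onD subsetD)
  with r' that show thesis by blast
next
  case False
  then show thesis using that[of R] seam_facts(1)[OF g] by simp
qed

text \<open>
  Uniformization of the glued sphere. The coordinate is the function \<open>(\<phi>, F, \<psi>)\<close> that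
  behaves like \<open>w\<close> at infinity and has no other singularity. To see that it takes a value
  \<open>\<phi> w0\<close> only at \<open>w0\<close>, solve the additive problem again for a function with a single simple
  pole at \<open>w0\<close> that vanishes at infinity. The product of this function and
  \<open>\<phi> - \<phi> w0\<close> has no poles, so it is a constant \<open>c\<close>, and \<open>c \<noteq> 0\<close> rules out further
  zeros of \<open>\<phi> - \<phi> w0\<close>.
\<close>
theorem conformal_welding:
  assumes g: "seam R g" and k: "seam R k"
  obtains \<phi> \<psi> F where
    "\<phi> holomorphic_on inside (g ` sphere 0 1)" "inj_on \<phi> (inside (g ` sphere 0 1))"
    "\<psi> holomorphic_on outside (k ` sphere 0 1)" "((\<lambda>w. \<psi> w - w) \<longlongrightarrow> 0) at_infinity"
    "F holomorphic_on annulus (1/R) R"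
    "\<And>z. z \<in> annulus (1/R) 1 \<Longrightarrow> F z = \<phi> (g z)"
    "\<And>z. z \<in> annulus 1 R \<Longrightarrow> F z = \<psi> (k z)"
    "\<And>w u. w \<in> inside (g ` sphere 0 1) \<Longrightarrow> u \<in> outside (k ` sphere 0 1) \<Longrightarrow> \<psi> u \<noteq> \<phi> w"
    "\<And>w z. w \<in> inside (g ` sphere 0 1) \<Longrightarrow> norm z = 1 \<Longrightarrow> F z \<noteq> \<phi> w"
proof -
  let ?A = "annulus (1/R) R" and ?D = "inside (g ` sphere 0 1)" and ?E = "outside (k ` sphere 0 1)"
  note fg = seam_facts[OF g] and fk = seam_facts[OF k]
  obtain \<phi> \<eta> F a where \<phi>: "\<phi> holomorphic_on ?D" and \<eta>: "\<eta> holomorphic_on ?E"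
    and F: "F holomorphic_on ?A" and limT: "((\<lambda>w. w * \<eta> w) \<longlongrightarrow> a) at_infinity"
    and F_in: "\<And>z. z \<in> annulus (1/R) 1 \<Longrightarrow> F z = \<phi> (g z) + 0"
    and F_out: "\<And>z. z \<in> annulus 1 R \<Longrightarrow> F z = \<eta> (k z) + k z"
    using additive_welding[where ?b1.0 = "\<lambda>_. 0" and ?b2.0 = k and ?\<beta>1.0 = "\<lambda>_. 0" and ?\<beta>2.0 = "\<lambda>z. z",
        OF g k holomorphic_on_const fk(2) holomorphic_on_const tendsto_const refl holomorphic_on_ident refl]
    by blast
  define \<psi> where "\<psi> w = \<eta> w + w" for w
  have \<psi>: "\<psi> holomorphic_on ?E" unfolding \<psi>_def by (intro holomorphic_intros \<eta>)
  have lim\<psi>: "((\<lambda>w. \<psi> w - w) \<longlongrightarrow> 0) at_infinity"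
    using tendsto_0_at_infinity_if_times[OF limT] by (simp add: \<psi>_def)
  have sep: "(\<forall>w\<in>?D. \<phi> w = \<phi> w0 \<longrightarrow> w = w0) \<and> (\<forall>u\<in>?E. \<psi> u \<noteq> \<phi> w0) \<and> (\<forall>z. norm z = 1 \<longrightarrow> F z \<noteq> \<phi> w0)"
    if w0: "w0 \<in> ?D" for w0
  proof -
    obtain r where r: "1 < r" "r \<le> R" "w0 \<notin> g ` annulus (1/r) r"
      using seam_shrink_avoiding[OF g w0] by blast
    let ?B = "annulus (1/r) r"
    have gr: "seam r g" and kr: "seam r k" using seam_mono g k r by blast+
    note fgr = seam_facts[OF gr] and fkr = seam_facts[OF kr]
    have sB: "sphere 0 1 \<subseteq> ?B" by (rule sphere_subset_annulus[OF r(1)])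
    have "1 / R \<le> 1 / r" using r by (simp add: frac_le)
    then have BA: "?B \<subseteq> ?A" "annulus (1/r) 1 \<subseteq> annulus (1/R) 1" "annulus 1 r \<subseteq> annulus 1 R"
      using r by auto
    have F': "F holomorphic_on ?B" using F BA holomorphic_on_subset by blast
    have ne: "w \<noteq> w0" if "w \<in> outside (g ` sphere 0 1)" for w
      using that w0 not_inside_and_outside by blast
    have b1: "(\<lambda>z. 1 / (g z - w0)) holomorphic_on ?B"
      using r(3) by (intro holomorphic_intros fgr(2)) auto
    have \<beta>1: "(\<lambda>z. 1 / (z - w0)) holomorphic_on outside (g ` sphere 0 1)"
      using ne by (intro holomorphic_intros) auto
    have "filterlim (\<lambda>z. z + - w0) at_infinity at_infinity"
      by (rule tendsto_add_filterlim_at_infinity'[OF filterlim_ident tendsto_const])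
    then have lim\<beta>: "((\<lambda>z. 1 / (z - w0)) \<longlongrightarrow> 0) at_infinity"
      using filterlim_compose[OF tendsto_inverse_0] by (simp add: field_simps)
    obtain V W G c where V: "V holomorphic_on ?D" and W: "W holomorphic_on ?E"
      and G: "G holomorphic_on ?B" and limW: "((\<lambda>w. w * W w) \<longlongrightarrow> c) at_infinity"
      and G_in: "\<And>z. z \<in> annulus (1/r) 1 \<Longrightarrow> G z = V (g z) + 1 / (g z - w0)"
      and G_out: "\<And>z. z \<in> annulus 1 r \<Longrightarrow> G z = W (k z) + 0"
      using additive_welding[where ?b2.0 = "\<lambda>_. 0" and ?\<beta>2.0 = "\<lambda>_. 0",
          OF gr kr b1 holomorphic_on_const \<beta>1 lim\<beta> refl holomorphic_on_const refl]
      by blast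
    \<comment> \<open>The product on the first piece; the pole at w0 cancels against the zero of the first factor.\<close>
    define E where "E w = difference_quotient \<phi> w0 w + (\<phi> w - \<phi> w0) * V w" for w
    have limW0: "(W \<longlongrightarrow> 0) at_infinity" by (rule tendsto_0_at_infinity_if_times[OF limW])
    have lim: "((\<lambda>w. (\<psi> w - \<phi> w0) * W w - c) \<longlongrightarrow> 0) at_infinity"
    proof -
      have "((\<lambda>w. w * W w + (\<psi> w - w - \<phi> w0) * W w - c) \<longlongrightarrow> c + (0 - \<phi> w0) * 0 - c) at_infinity"
        by (intro tendsto_intros limW limW0 lim\<psi>)
      then show ?thesis by (simp add: algebra_simps)
    qed
    have hol1: "(\<lambda>w. (\<psi> w - \<phi> w0) * W w - c) holomorphic_on ?E"
      by (intro holomorphic_intros \<psi> W)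
    have hol2: "(\<lambda>w. E w - c) holomorphic_on ?D"
      unfolding E_def by (intro holomorphic_intros \<phi> V holomorphic_on_difference_quotient fg)
    have hol3: "(\<lambda>z. (F z - \<phi> w0) * G z - c) holomorphic_on ?B"
      by (intro holomorphic_intros F' G)
    have E_in: "E (g z) - c = (F z - \<phi> w0) * G z - c" if z: "z \<in> annulus (1/r) 1" for z
    proof -
      have "g z \<noteq> w0" using z r(3) half_annulus_subset[OF r(1)] by blast
      moreover have "F z = \<phi> (g z)" using F_in BA z by auto
      ultimately show ?thesis using G_in[OF z] by (simp add: E_def difference_quotient_def distrib_left)
    qed
    have E_out: "(\<psi> (k z) - \<phi> w0) * W (k z) - c = (F z - \<phi> w0) * G z - c" if z: "z \<in> annulus 1 r" for z
      using G_out[OF z] F_out[of z] z BA(3) by (auto simp: \<psi>_def simp del: mem_annulus)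
    note L = glued_sphere_Liouville[OF kr gr hol1 lim hol2 hol3]
    have const: "\<And>z. z \<in> ?B \<Longrightarrow> (F z - \<phi> w0) * G z - c = 0"
      "\<And>u. u \<in> ?E \<Longrightarrow> (\<psi> u - \<phi> w0) * W u - c = 0" "\<And>w. w \<in> ?D \<Longrightarrow> E w - c = 0"
      using L(1)[OF E_out E_in] L(2)[OF E_out E_in] L(3)[OF E_out E_in] by blast+
    \<comment> \<open>If c = 0, the second function vanishes near infinity, because the coordinate is large there.
      Then it vanishes identically, although it has a pole at w0.\<close>
    have c: "c \<noteq> 0"
    proof
      assume c0: "c = 0"
      obtain B where B: "\<And>w. B \<le> norm w \<Longrightarrow> norm (\<psi> w - w) < 1"
        using tendstoD[OF lim\<psi>, of 1] by (auto simp: eventually_at_infinity)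
      define B' where "B' = max B (norm (\<phi> w0) + 1)"
      have zero: "W w = 0" if "w \<in> ?E" "norm w > B'" for w
      proof -
        have "\<psi> w \<noteq> \<phi> w0"
        proof
          assume "\<psi> w = \<phi> w0"
          then have "norm (\<phi> w0 - w) < 1" using B[of w] that by (auto simp: B'_def)
          then show False using that norm_triangle_ineq2[of w "\<phi> w0"]
            by (simp add: B'_def norm_minus_commute)
        qed
        then show ?thesis using const(2)[of w] that c0 by simp
      qed
      have W0: "W w = 0" if "w \<in> ?E" for w
      proof (rule analytic_continuation_open[of "?E \<inter> {w. norm w > B'}" ?E W "\<lambda>_. 0"])
        show "open (?E \<inter> {w. norm w > B'})"
          by (intro open_Int fk open_Collect_less continuous_intros)
        show "?E \<inter> {w. norm w > B'} \<noteq> {}"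
          using fk(11) unfolding bounded_iff by (auto simp: not_le)
      qed (use fk W zero that in auto)
      have G0: "G z = 0" if "z \<in> ?B" for z
      proof (rule analytic_continuation_open[of "annulus 1 r" ?B G "\<lambda>_. 0"])
        show "annulus 1 r \<noteq> {}" using half_annulus_nonempty(1)[OF r(1)] by blast
        show "G z = 0" if "z \<in> annulus 1 r" for z using G_out[OF that] W0 fkr(5)[OF that] by simp
        show "annulus 1 r \<subseteq> ?B" by (rule half_annulus_subset[OF r(1)])
      qed (use G that in auto)
      have "(w0 - w0) * V w0 + 1 = 0"
      proof (rule analytic_continuation_open[of "g ` annulus (1/r) 1" ?D "\<lambda>w. (w - w0) * V w + 1" "\<lambda>_. 0"])
        show "open (g ` annulus (1/r) 1)"
          using half_annulus_subset[OF r(1)] fgr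
          by (auto intro!: open_mapping_thm3 intro: holomorphic_on_subset inj_on_subset)
        show "g ` annulus (1/r) 1 \<noteq> {}" using half_annulus_nonempty(2)[OF r(1)] by blast
        show "g ` annulus (1/r) 1 \<subseteq> ?D" using fgr(4) by blast
        show "(w - w0) * V w + 1 = 0" if w: "w \<in> g ` annulus (1/r) 1" for w
        proof -
          obtain z where z: "w = g z" "z \<in> annulus (1/r) 1" using w by blast
          then have zB: "z \<in> ?B" using half_annulus_subset[OF r(1)] by blast
          then have "w \<noteq> w0" using z r(3) by blast
          moreover have "V w + 1 / (w - w0) = 0" using G_in[OF z(2)] G0[OF zB] z by simp
          ultimately show ?thesis by (simp add: field_simps)
        qed
      qed (use fg w0 V in \<open>auto intro!: holomorphic_intros\<close>)
      then show False by simp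
    qed
    have 1: "w = w0" if "w \<in> ?D" "\<phi> w = \<phi> w0" for w
      using const(3)[OF that(1)] that c by (auto simp: E_def difference_quotient_def split: if_splits)
    have 2: "\<psi> u \<noteq> \<phi> w0" if "u \<in> ?E" for u
      using const(2)[OF that] c by auto
    have 3: "F z \<noteq> \<phi> w0" if "norm z = 1" for z
      using const(1)[of z] sB that c by auto
    show ?thesis using 1 2 3 by blast
  qed
  show thesis
  proof (rule that[OF \<phi> _ \<psi> lim\<psi> F])
    show "inj_on \<phi> ?D" using sep by (auto intro!: inj_onI)
  qed (use F_in F_out sep in \<open>auto simp: \<psi>_def\<close>)
qed

section \<open>Univalence near the circle\<close>

lemma image_reflected_circle:
  fixes p :: "complex \<Rightarrow> complex"
  shows "(\<lambda>z. p (1 / z)) ` sphere 0 1 = p ` sphere 0 1"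
proof -
  have "(\<lambda>z. 1 / z) ` sphere 0 1 = (sphere 0 1 :: complex set)"
    by (auto simp: norm_divide image_iff intro!: bexI[of _ "1 / _"])
  then show ?thesis by (metis image_image)
qed
text \<open>
  Every point of a Jordan curve is in the closure of both sides, and the image of the annulus is a
  neighbourhood of the curve; so its two halves cannot lie on the same side.
\<close>
lemma seam_or_reflected_seam:
  assumes R: "1 < R" and p: "p holomorphic_on annulus (1/R) R" "inj_on p (annulus (1/R) R)"
  shows "seam R p \<or> seam R (\<lambda>z. p (1 / z))"
proof -
  let ?A = "annulus (1/R) R" and ?C = "p ` sphere 0 1"
  note path = univalent_circle_simple_path[OF R p]
  have J: "open (inside ?C)" "open (outside ?C)" "inside ?C \<union> outside ?C = - ?C" "inside ?C \<inter> outside ?C = {}"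
    "frontier (inside ?C) = ?C" "frontier (outside ?C) = ?C"
    using Jordan_inside_outside[OF path(1,2)] path(3) by auto
  have sA: "sphere 0 1 \<subseteq> ?A" by (rule sphere_subset_annulus[OF R])
  have side: "p ` B \<subseteq> inside ?C \<or> p ` B \<subseteq> outside ?C" if B: "connected B" "B \<subseteq> ?A" "B \<inter> sphere 0 1 = {}" for B
  proof -
    have "connected (p ` B)"
      by (rule connected_continuous_image[OF holomorphic_on_imp_continuous_on[OF holomorphic_on_subset[OF p(1) B(2)]] B(1)])
    moreover have "p ` B \<subseteq> inside ?C \<union> outside ?C"
      unfolding J(3) using B p(2) sA by (auto dest!: inj_onD)
    ultimately show ?thesis
      using connectedD[of "p ` B" "inside ?C" "outside ?C"] J by blast
  qed
  have A_split: "?A = annulus (1/R) 1 \<union> sphere 0 1 \<union> annulus 1 R"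
    using half_annulus_subset[OF R] sA by (auto elim!: annulus_cases)
  have op: "open (p ` ?A)" by (rule open_mapping_thm3[OF p(1) _ p(2)]) simp
  have not_one_sided: False if "open X" "X \<inter> (p ` annulus (1/R) 1 \<union> p ` annulus 1 R) = {}"
      "X \<inter> ?C = {}" "frontier X = ?C" for X
  proof -
    have "p 1 \<in> closure X" using that(4) by (auto simp: frontier_def)
    moreover have "p 1 \<in> p ` ?A" by (intro imageI subsetD[OF sA]) simp
    ultimately have "X \<inter> p ` ?A \<noteq> {}"
      using open_Int_closure_eq_empty[OF op, of X] by blast
    then show False using that(2,3) unfolding A_split by blast
  qed
  have in_side: "p ` annulus (1/R) 1 \<subseteq> inside ?C \<or> p ` annulus (1/R) 1 \<subseteq> outside ?C"
    and out_side: "p ` annulus 1 R \<subseteq> inside ?C \<or> p ` annulus 1 R \<subseteq> outside ?C"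
    by (rule side; use half_annulus_subset[OF R] in auto)+
  have disj: "inside ?C \<inter> ?C = {}" "outside ?C \<inter> ?C = {}" using J(3) by auto
  have not_in: "\<not> (p ` annulus (1/R) 1 \<subseteq> inside ?C \<and> p ` annulus 1 R \<subseteq> inside ?C)"
    using not_one_sided[OF J(2) _ disj(2) J(6)] J(4) by blast
  have not_out: "\<not> (p ` annulus (1/R) 1 \<subseteq> outside ?C \<and> p ` annulus 1 R \<subseteq> outside ?C)"
    using not_one_sided[OF J(1) _ disj(1) J(5)] J(4) by blast
  show ?thesis
  proof (cases "p ` annulus (1/R) 1 \<subseteq> inside ?C")
    case True
    then have "p ` annulus 1 R \<subseteq> outside ?C" using not_in out_side by blast
    with True R p show ?thesis by (simp add: seam_def)
  next
    case False
    then have *: "p ` annulus (1/R) 1 \<subseteq> outside ?C" "p ` annulus 1 R \<subseteq> inside ?C"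
      using in_side out_side not_out by blast+
    have R0: "R > 0" using R by simp
    have inv: "1 / z \<in> ?A" "z \<noteq> 0" if "z \<in> ?A" for z
    proof -
      have "0 < norm z" using that R by (auto intro: less_trans[of 0 "1/R"])
      then show "z \<noteq> 0" "1 / z \<in> ?A" using that R0 by (auto simp: norm_divide field_simps)
    qed
    have inv1: "1 / z \<in> annulus 1 R" if "z \<in> annulus (1/R) 1" for z
    proof -
      have "0 < norm z" using that R by (auto intro: less_trans[of 0 "1/R"])
      then show ?thesis using that R0 by (auto simp: norm_divide field_simps)
    qed
    have inv2: "1 / z \<in> annulus (1/R) 1" if "z \<in> annulus 1 R" for z
    proof -
      have "0 < norm z" using that by auto
      then show ?thesis using that R0 by (auto simp: norm_divide field_simps)
    qed
    have img: "(\<lambda>z. p (1 / z)) ` sphere 0 1 = ?C"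
      by (rule image_reflected_circle)
    have "(p \<circ> (\<lambda>z. 1 / z)) holomorphic_on ?A"
      using inv by (intro holomorphic_on_compose_gen[OF _ p(1)] holomorphic_intros) auto
    moreover have "inj_on (\<lambda>z. p (1 / z)) ?A"
      using inv by (auto intro!: inj_onI dest!: inj_onD[OF p(2)])
    ultimately have "seam R (\<lambda>z. p (1 / z))"
      unfolding seam_def img using R * inv1 inv2 by (auto simp: o_def image_subset_iff simp del: mem_annulus)
    then show ?thesis ..
  qed
qed

text \<open>
  The alternative \<open>z \<mapsto> p (1 / z)\<close> would run through the curve backwards with winding number 1.
\<close>
lemma seam_if_winding_number_1:
  assumes R: "1 < R" and p: "p holomorphic_on annulus (1/R) R" "inj_on p (annulus (1/R) R)"
    and c: "c \<notin> p ` sphere 0 1" and w: "winding_number (p \<circ> circlepath 0 1) c = 1"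
  shows "seam R p" "c \<in> inside (p ` sphere 0 1)"
proof -
  let ?C = "p ` sphere 0 1"
  note path = univalent_circle_simple_path[OF R p]
  show cin: "c \<in> inside ?C"
  proof (rule ccontr)
    assume "c \<notin> inside ?C"
    then have "c \<in> outside ?C" using c inside_Un_outside[of ?C] by blast
    then have "winding_number (p \<circ> circlepath 0 1) c = 0"
      using winding_number_zero_in_outside[of "p \<circ> circlepath 0 1" c] path
      by (simp add: simple_path_imp_path)
    with w show False by simp
  qed
  show "seam R p"
  proof (rule ccontr)
    assume "\<not> seam R p"
    then have s: "seam R (\<lambda>z. p (1 / z))" using seam_or_reflected_seam[OF R p] by blast
    have img: "(\<lambda>z. p (1 / z)) ` sphere 0 1 = ?C"
      by (rule image_reflected_circle)
    have "((\<lambda>z. p (1 / z)) \<circ> circlepath 0 1) = reversepath (p \<circ> circlepath 0 1)"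
    proof
      fix t :: real
      have "1 / unit_point t = unit_point (1 - t)"
      proof -
        have "unit_point (1 - t) = unit_point (- t)" using unit_point_add_int[of 1 "-t"] by simp
        also have "\<dots> = 1 / unit_point t" by (simp add: unit_point_def exp_minus inverse_eq_divide)
        finally show ?thesis by simp
      qed
      then show "((\<lambda>z. p (1 / z)) \<circ> circlepath 0 1) t = reversepath (p \<circ> circlepath 0 1) t"
        by (simp add: circlepath_unit_point reversepath_def)
    qed
    moreover have "winding_number ((\<lambda>z. p (1 / z)) \<circ> circlepath 0 1) c = 1"
      using winding_number_seam(3)[OF s] cin img by simp
    moreover have "winding_number (reversepath (p \<circ> circlepath 0 1)) c = - winding_number (p \<circ> circlepath 0 1) c"
      using path c by (intro winding_number_reversepath) (auto simp: simple_path_imp_path)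
    ultimately show False using w by simp
  qed
qed

text \<open>
  Pairs of distinct points with equal images in ever thinner annuli would accumulate at a pair of points
  of the circle. These coincide by injectivity on the circle, which contradicts local injectivity.
\<close>
lemma injective_near_circle:
  fixes p :: "complex \<Rightarrow> complex"
  assumes R: "1 < R" and p: "continuous_on (annulus (1/R) R) p" and inj: "inj_on p (sphere 0 1)"
    and loc: "\<And>z. norm z = 1 \<Longrightarrow> \<exists>e>0. inj_on p (ball z e)"
  obtains r where "1 < r" "r \<le> R" "inj_on p (annulus (1/r) r)"
proof (rule ccontr)
  let ?A = "annulus (1/R) R"
  note goal = that
  assume "\<not> thesis"
  then have no: "\<not> inj_on p (annulus (1/r) r)" if "1 < r" "r \<le> R" for r using goal that by blast
  define \<rho> where "\<rho> n = 1 + (R - 1) / real (Suc n)" for n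
  have \<rho>: "1 < \<rho> n" "\<rho> n \<le> R" for n
  proof -
    have "(R - 1) / real (Suc n) \<le> (R - 1) / 1" by (rule divide_left_mono) (use R in auto)
    moreover have "(R - 1) / real (Suc n) > 0" using R by simp
    ultimately show "1 < \<rho> n" "\<rho> n \<le> R" by (auto simp: \<rho>_def)
  qed
  have lim\<rho>: "\<rho> \<longlonglongrightarrow> 1"
  proof -
    have "(\<lambda>n. 1 + (R - 1) * inverse (real (Suc n))) \<longlonglongrightarrow> 1 + (R - 1) * 0"
      by (intro tendsto_intros LIMSEQ_inverse_real_of_nat)
    then show ?thesis by (simp add: \<rho>_def[abs_def] field_simps)
  qed
  have "\<forall>n. \<exists>x. fst x \<in> annulus (1 / \<rho> n) (\<rho> n) \<and> snd x \<in> annulus (1 / \<rho> n) (\<rho> n) \<and> fst x \<noteq> snd x \<and> p (fst x) = p (snd x)"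
    using no[OF \<rho>] unfolding inj_on_def by (metis fst_conv snd_conv)
  then obtain x where x: "\<And>n. fst (x n) \<in> annulus (1 / \<rho> n) (\<rho> n)" "\<And>n. snd (x n) \<in> annulus (1 / \<rho> n) (\<rho> n)"
    "\<And>n. fst (x n) \<noteq> snd (x n)" "\<And>n. p (fst (x n)) = p (snd (x n))"
    by metis
  have le: "norm z \<le> R" if "z \<in> annulus (1 / \<rho> n) (\<rho> n)" for z n
    using that \<rho>[of n] by auto
  have "\<forall>n. x n \<in> cball 0 R \<times> cball 0 R"
    using le[OF x(1)] le[OF x(2)] by (auto simp: mem_Times_iff)
  then obtain l s where l: "strict_mono s" "(x \<circ> s) \<longlonglongrightarrow> l"
    using compact_Times[OF compact_cball compact_cball] unfolding compact_def by metis
  have lf: "(\<lambda>n. fst (x (s n))) \<longlonglongrightarrow> fst l" and ls: "(\<lambda>n. snd (x (s n))) \<longlonglongrightarrow> snd l"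
    using tendsto_fst[OF l(2)] tendsto_snd[OF l(2)] by (simp_all add: o_def)
  have lim\<rho>': "(\<lambda>n. \<rho> (s n)) \<longlonglongrightarrow> 1" "(\<lambda>n. 1 / \<rho> (s n)) \<longlonglongrightarrow> 1"
    using LIMSEQ_subseq_LIMSEQ[OF lim\<rho> l(1)] tendsto_divide[OF tendsto_const LIMSEQ_subseq_LIMSEQ[OF lim\<rho> l(1)], of 1]
    by (simp_all add: o_def)
  have norm1: "norm c = 1" if "\<And>n. y n \<in> annulus (1 / \<rho> n) (\<rho> n)" "(\<lambda>n. y (s n)) \<longlonglongrightarrow> c" for y c
  proof -
    have "(\<lambda>n. norm (y (s n))) \<longlonglongrightarrow> 1"
      by (rule tendsto_sandwich[OF _ _ lim\<rho>'(2) lim\<rho>'(1)]) (use that(1) in \<open>auto intro!: always_eventually less_imp_le\<close>)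
    then show ?thesis by (rule LIMSEQ_unique[OF tendsto_norm[OF that(2)]])
  qed
  have n1: "norm (fst l) = 1" "norm (snd l) = 1"
    by (rule norm1[OF x(1) lf], rule norm1[OF x(2) ls])
  have isC: "isCont p c" if "norm c = 1" for c
  proof -
    have "c \<in> ?A" using that sphere_subset_annulus[OF R] by auto
    then show ?thesis using p by (simp add: continuous_on_eq_continuous_at)
  qed
  have "(\<lambda>n. p (fst (x (s n)))) \<longlonglongrightarrow> p (fst l)" "(\<lambda>n. p (snd (x (s n)))) \<longlonglongrightarrow> p (snd l)"
    using isCont_tendsto_compose[OF isC[OF n1(1)] lf] isCont_tendsto_compose[OF isC[OF n1(2)] ls] .
  then have "p (fst l) = p (snd l)" unfolding x(4) by (rule LIMSEQ_unique)
  then have eq: "fst l = snd l" using inj n1 by (auto dest: inj_onD)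
  obtain e where e: "e > 0" "inj_on p (ball (fst l) e)" using loc[OF n1(1)] by blast
  have "\<forall>\<^sub>F n in sequentially. dist (fst (x (s n))) (fst l) < e \<and> dist (snd (x (s n))) (fst l) < e"
    using tendstoD[OF lf e(1)] tendstoD[OF ls e(1)] eq by (auto intro: eventually_conj)
  then obtain n where "dist (fst (x (s n))) (fst l) < e" "dist (snd (x (s n))) (fst l) < e"
    using eventually_happens'[OF sequentially_bot] by fastforce
  then have "fst (x (s n)) = snd (x (s n))"
    using inj_onD[OF e(2) x(4)[of "s n"]] by (simp add: dist_commute)
  then show False using x(3) by blast
qed

section \<open>Univalent roots of a covering of a Jordan curve\<close>

lemma exp_lifts_differ_by_constant:
  fixes f g :: "'a::topological_space \<Rightarrow> complex"
  assumes S: "connected S" and f: "continuous_on S f" and g: "continuous_on S g"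
    and eq: "\<And>x. x \<in> S \<Longrightarrow> exp (f x) = exp (g x)"
  obtains m :: int where "\<And>x. x \<in> S \<Longrightarrow> f x = g x + 2 * of_real pi * \<i> * of_int m"
proof -
  have val: "\<exists>m::int. f x - g x = 2 * of_real pi * \<i> * of_int m" if "x \<in> S" for x
    using eq[OF that] unfolding exp_eq by (auto simp: algebra_simps)
  have "(\<lambda>x. f x - g x) constant_on S"
  proof (rule continuous_discrete_range_constant[OF S])
    fix x assume x: "x \<in> S"
    show "\<exists>e>0. \<forall>y. y \<in> S \<and> f y - g y \<noteq> f x - g x \<longrightarrow> e \<le> norm (f y - g y - (f x - g x))"
    proof (intro exI[of _ "2 * pi"] conjI allI impI)
      fix y assume y: "y \<in> S \<and> f y - g y \<noteq> f x - g x"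
      obtain m n :: int where mn: "f x - g x = 2 * of_real pi * \<i> * of_int m" "f y - g y = 2 * of_real pi * \<i> * of_int n"
        using val x y by meson
      then have "m \<noteq> n" using y by auto
      then have "1 \<le> \<bar>n - m\<bar>" by linarith
      then have "1 \<le> \<bar>real_of_int (n - m)\<bar>" by linarith
      moreover have "f y - g y - (f x - g x) = 2 * of_real pi * \<i> * of_int (n - m)"
        unfolding mn by (simp add: algebra_simps)
      ultimately show "2 * pi \<le> norm (f y - g y - (f x - g x))"
        by (simp add: norm_mult del: of_int_diff)
    qed simp
  qed (intro continuous_intros f g)
  then obtain c where c: "\<And>x. x \<in> S \<Longrightarrow> f x - g x = c" unfolding constant_on_def by blast
  show thesis
  proof (cases "S = {}")
    case False
    then obtain x where "x \<in> S" by blast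
    with val c obtain m :: int where "c = 2 * of_real pi * \<i> * of_int m" by metis
    then show thesis using that[of m] c by (metis diff_add_cancel add.commute)
  qed (use that in auto)
qed

text \<open>
  Between two points with the same value there is an interior extremum (or the function is constant), and a
  function with an extremum at an interior point is not injective near it.
\<close>
lemma locally_injective_real_imp_inj:
  fixes \<theta> :: "real \<Rightarrow> real"
  assumes cont: "continuous_on UNIV \<theta>" and loc: "\<And>t. \<exists>e>0. inj_on \<theta> (ball t e)"
  shows "inj \<theta>"
proof (rule ccontr)
  assume "\<not> inj \<theta>"
  then obtain a b where ab: "a < b" "\<theta> a = \<theta> b"
    unfolding inj_def by (metis linorder_neqE_linordered_idom)
  have c: "continuous_on S \<theta>" for S using cont continuous_on_subset by blast
  have no_extremum: False if x: "a < x" "x < b" and ext: "(\<forall>y\<in>{a..b}. \<theta> y \<le> \<theta> x) \<or> (\<forall>y\<in>{a..b}. \<theta> x \<le> \<theta> y)" for x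
  proof -
    obtain e where e: "e > 0" "inj_on \<theta> (ball x e)" using loc by blast
    define d where "d = min (e / 2) (min (x - a) (b - x))"
    have d: "d > 0" "d < e" "x - d \<ge> a" "x + d \<le> b" using e x by (auto simp: d_def)
    have "{x - d..x + d} \<subseteq> ball x e" using d by (auto simp: dist_real_def)
    then have "inj_on \<theta> {x - d..x + d}" using e inj_on_subset by blast
    then have "(\<theta> (x - d) < \<theta> x \<and> \<theta> x < \<theta> (x + d)) \<or> (\<theta> (x + d) < \<theta> x \<and> \<theta> x < \<theta> (x - d))"
      using d by (intro continuous_inj_imp_mono c) auto
    moreover have "x - d \<in> {a..b}" "x + d \<in> {a..b}" using d x by auto
    ultimately show False using ext by fastforce
  qed
  obtain u where u: "u \<in> {a..b}" "\<And>y. y \<in> {a..b} \<Longrightarrow> \<theta> y \<le> \<theta> u"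
    using continuous_attains_sup[of "{a..b}" \<theta>] c ab by auto
  obtain v where v: "v \<in> {a..b}" "\<And>y. y \<in> {a..b} \<Longrightarrow> \<theta> v \<le> \<theta> y"
    using continuous_attains_inf[of "{a..b}" \<theta>] c ab by auto
  have "\<not> (a < u \<and> u < b)" "\<not> (a < v \<and> v < b)" using no_extremum u v by blast+
  then have "\<theta> u = \<theta> a" "\<theta> v = \<theta> a" using u(1) v(1) ab by (auto simp: not_less le_less)
  then have "\<theta> y = \<theta> a" if "y \<in> {a..b}" for y using u(2)[OF that] v(2)[OF that] by simp
  moreover have m: "(a + b) / 2 \<in> {a..b}" "a < (a + b) / 2" "(a + b) / 2 < b" using ab by auto
  ultimately have "\<forall>y\<in>{a..b}. \<theta> y \<le> \<theta> ((a + b) / 2)" by (metis order_refl)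
  then show False using no_extremum[OF m(2,3)] by blast
qed

lemma continuous_circle_lift:
  fixes \<tau> :: "real \<Rightarrow> complex"
  assumes "continuous_on UNIV \<tau>" "\<And>t. norm (\<tau> t) = 1"
  obtains \<theta> where "continuous_on UNIV \<theta>" "\<And>t. \<tau> t = exp (\<i> * of_real (\<theta> t))"
proof -
  have "\<tau> t \<noteq> 0" for t using assms(2)[of t] by auto
  then obtain h where h: "continuous_on UNIV h" "\<And>t. \<tau> t = exp (h t)"
    using continuous_logarithm_on_contractible[OF assms(1)] contractible_UNIV by auto
  have "Re (h t) = 0" for t
    using assms(2)[of t] h(2)[of t] by simp
  then have "\<tau> t = exp (\<i> * of_real (Im (h t)))" for t
    using h(2) by (metis complex_eq add_0 of_real_0)
  then show thesis using that[of "\<lambda>t. Im (h t)"] h(1) by (auto intro: continuous_intros)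
qed

text \<open>
  The closed path \<open>exp (l t)\<close> of winding number \<open>n\<close> runs on the Jordan curve \<open>\<Gamma>\<close> without
  turning back, because it is locally injective. Identify \<open>\<Gamma>\<close> with the unit circle. The path lifts to an
  angle \<open>\<theta>\<close>, which is locally injective and hence injective, with \<open>\<theta> (t + 1) = \<theta> t + 2 \<pi> d\<close>.
  A logarithm \<open>M\<close> along \<open>\<Gamma>\<close> grows by \<open>2 \<pi> \<i> e\<close> with \<open>e \<noteq> 0\<close>, because 0 is inside, and
  \<open>n = e d\<close>. So the path covers \<open>\<Gamma>\<close> exactly \<open>\<bar>d\<bar>\<close> times. If the \<open>n\<close>-th
  roots at \<open>s\<close> and \<open>t\<close> agree, then \<open>\<theta> s - \<theta> t\<close> is a multiple of \<open>2 \<pi> d\<close>,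
  so \<open>s\<close> and \<open>t\<close> differ by an integer.
\<close>
lemma root_injective_on_Jordan_curve:
  fixes l :: "real \<Rightarrow> complex" and n :: int
  assumes \<Gamma>: "jordan_curve \<Gamma>" "0 \<in> inside \<Gamma>"
    and l: "continuous_on UNIV l" "\<And>t. exp (l t) \<in> \<Gamma>" "\<And>t. l (t + 1) = l t + 2 * of_real pi * \<i> * of_int n"
    and loc: "\<And>t. \<exists>e>0. inj_on (\<lambda>t. exp (l t)) (ball t e)"
  shows "n \<noteq> 0" and "exp (l s / of_int n) = exp (l t / of_int n) \<Longrightarrow> s - t \<in> \<int>"
proof -
  obtain \<gamma> where \<gamma>: "simple_path \<gamma>" "pathfinish \<gamma> = pathstart \<gamma>" "path_image \<gamma> = \<Gamma>"
    using \<Gamma>(1) unfolding jordan_curve_def by blast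
  then obtain \<sigma> \<sigma>' where "homeomorphism \<Gamma> (sphere (0::complex) 1) \<sigma> \<sigma>'"
    using homeomorphic_simple_path_image_circle[of \<gamma> 1 0] unfolding homeomorphic_def by auto
  then have \<sigma>: "continuous_on \<Gamma> \<sigma>" "continuous_on (sphere 0 1) \<sigma>'" "\<sigma> ` \<Gamma> = sphere 0 1" "\<sigma>' ` sphere 0 1 = \<Gamma>"
    "\<And>x. x \<in> \<Gamma> \<Longrightarrow> \<sigma>' (\<sigma> x) = x" "\<And>y. y \<in> sphere 0 1 \<Longrightarrow> \<sigma> (\<sigma>' y) = y"
    by (auto simp: homeomorphism_def)
  have 0: "0 \<notin> \<Gamma>" using \<Gamma>(2) by (auto simp: inside_def)
  have "continuous_on UNIV (\<lambda>t. \<sigma> (exp (l t)))"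
    by (rule continuous_on_compose2[OF \<sigma>(1)]) (use l in \<open>auto intro!: continuous_intros\<close>)
  moreover have "norm (\<sigma> (exp (l t))) = 1" for t
    using \<sigma>(3) l(2)[of t] by (metis imageI mem_sphere_0)
  ultimately obtain \<theta> where \<theta>: "continuous_on UNIV \<theta>" "\<And>t. \<sigma> (exp (l t)) = exp (\<i> * of_real (\<theta> t))"
    using continuous_circle_lift by (metis (no_types, lifting))
  have cont\<sigma>': "continuous_on UNIV (\<lambda>x::real. \<sigma>' (exp (\<i> * of_real x)))"
    by (rule continuous_on_compose2[OF \<sigma>(2)]) (auto intro!: continuous_intros)
  moreover have "\<sigma>' (exp (\<i> * of_real x)) \<noteq> 0" for x :: real
    using 0 \<sigma>(4) by (metis imageI mem_sphere_0 norm_exp_i_times)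
  ultimately obtain M where M: "continuous_on UNIV M" "\<And>x::real. \<sigma>' (exp (\<i> * of_real x)) = exp (M x)"
    using continuous_logarithm_on_contractible[OF cont\<sigma>'] contractible_UNIV by auto
  have lM: "exp (M (\<theta> t)) = exp (l t)" for t
    using \<theta>(2)[of t] \<sigma>(5)[OF l(2)[of t]] M(2)[of "\<theta> t"] by simp
  have cM\<theta>: "continuous_on UNIV (\<lambda>t. M (\<theta> t))"
    by (rule continuous_on_compose2[OF M(1) \<theta>(1)]) auto
  obtain c :: int where c: "\<And>t. M (\<theta> t) = l t + 2 * of_real pi * \<i> * of_int c"
    using exp_lifts_differ_by_constant[OF connected_UNIV cM\<theta> l(1) lM] by auto
  have shift: "continuous_on UNIV (\<lambda>t::real. t + a)" for a by (intro continuous_intros)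
  have cM2: "continuous_on UNIV (\<lambda>x. M (x + 2 * pi))"
    by (rule continuous_on_compose2[OF M(1) shift]) auto
  have "exp (M (x + 2 * pi)) = exp (M x)" for x
  proof -
    have "exp (\<i> * of_real (x + 2 * pi)) = exp (\<i> * of_real x)"
      by (simp add: ring_distribs exp_add mult_ac)
    then show ?thesis by (metis M(2))
  qed
  then obtain e :: int where e: "\<And>x. M (x + 2 * pi) = M x + 2 * of_real pi * \<i> * of_int e"
    using exp_lifts_differ_by_constant[OF connected_UNIV cM2 M(1)] by auto
  have e0: "e \<noteq> 0"
  proof
    assume "e = 0"
    define p where "p t = M (2 * pi * t)" for t
    have p: "path p" unfolding path_def p_def
      by (rule continuous_on_compose2[OF M(1)]) (auto intro!: continuous_intros)
    have ep: "exp \<circ> p = \<sigma>' \<circ> circlepath 0 1"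
      by (auto simp: fun_eq_iff p_def circlepath_unit_point unit_point_def mult_ac simp flip: M(2))
    have w0: "winding_number (exp \<circ> p) 0 = 0"
      unfolding winding_number_compose_exp[OF p]
      using e[of 0] \<open>e = 0\<close> by (simp add: p_def pathfinish_def pathstart_def)
    have "simple_path (\<sigma>' \<circ> circlepath 0 1)"
      by (rule simple_path_continuous_image)
         (use \<sigma> in \<open>auto simp: simple_path_circlepath intro!: inj_onI\<close>, metis mem_sphere_0 \<sigma>(6))
    moreover have "path_image (\<sigma>' \<circ> circlepath 0 1) = \<Gamma>"
      using \<sigma>(4) by (simp add: path_image_compose)
    ultimately show False
      using simple_closed_path_winding_number_inside[of "\<sigma>' \<circ> circlepath 0 1"] w0 \<Gamma>(2) unfolding ep
      by (metis zero_neq_one neg_equal_0_iff_equal)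
  qed
  have "exp (\<i> * of_real (\<theta> (t + 1))) = exp (\<i> * of_real (\<theta> t))" for t
  proof -
    have "exp (l (t + 1)) = exp (l t)"
      unfolding l(3) exp_eq by (intro exI[of _ n]) simp
    then show ?thesis by (metis \<theta>(2))
  qed
  moreover have c\<theta>1: "continuous_on UNIV (\<lambda>t. \<theta> (t + 1))"
    by (rule continuous_on_compose2[OF \<theta>(1) shift]) auto
  then have "continuous_on UNIV (\<lambda>t. \<i> * complex_of_real (\<theta> (t + 1)))"
    "continuous_on UNIV (\<lambda>t. \<i> * complex_of_real (\<theta> t))"
    using \<theta>(1) by (auto intro: continuous_intros)
  ultimately obtain d :: int where d': "\<And>t. \<i> * of_real (\<theta> (t + 1)) = \<i> * of_real (\<theta> t) + 2 * of_real pi * \<i> * of_int d"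
    using exp_lifts_differ_by_constant[OF connected_UNIV, of "\<lambda>t. \<i> * of_real (\<theta> (t + 1))" "\<lambda>t. \<i> * of_real (\<theta> t)"]
    by auto
  have d: "\<theta> (t + 1) = \<theta> t + 2 * pi * of_int d" for t
    using arg_cong[OF d'[of t], of Im] by simp
  have \<theta>m: "\<theta> (t + of_int m) = \<theta> t + 2 * pi * of_int (d * m)" for t and m :: int
  proof (induction m rule: int_induct[of _ 0])
    case (step1 i)
    then show ?case using d[of "t + of_int i"] by (simp add: algebra_simps)
  next
    case (step2 i)
    then show ?case using d[of "t + of_int i - 1"] by (simp add: algebra_simps)
  qed simp
  have Mm: "M (x + 2 * pi * of_int j) = M x + 2 * of_real pi * \<i> * of_int (e * j)" for x and j :: int
  proof (induction j rule: int_induct[of _ 0])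
    case (step1 i)
    then show ?case using e[of "x + 2 * pi * of_int i"] by (simp add: algebra_simps)
  next
    case (step2 i)
    then show ?case using e[of "x + 2 * pi * of_int i - 2 * pi"] by (simp add: algebra_simps)
  qed simp
  have inj: "inj \<theta>"
  proof (rule locally_injective_real_imp_inj[OF \<theta>(1)])
    fix t
    obtain \<epsilon> where \<epsilon>: "\<epsilon> > 0" "inj_on (\<lambda>t. exp (l t)) (ball t \<epsilon>)" using loc by blast
    have "inj_on \<theta> (ball t \<epsilon>)"
    proof (rule inj_onI)
      fix x y assume xy: "x \<in> ball t \<epsilon>" "y \<in> ball t \<epsilon>" "\<theta> x = \<theta> y"
      then have "exp (l x) = exp (l y)" using lM by metis
      then show "x = y" using \<epsilon>(2) xy by (auto dest: inj_onD)
    qed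
    then show "\<exists>e>0. inj_on \<theta> (ball t e)" using \<epsilon>(1) by blast
  qed
  have n: "n = e * d"
  proof -
    have "M (\<theta> (0 + 1)) - M (\<theta> 0) = 2 * of_real pi * \<i> * of_int n"
      unfolding c using l(3)[of 0] by simp
    moreover have "M (\<theta> (0 + 1)) - M (\<theta> 0) = 2 * of_real pi * \<i> * of_int (e * d)"
      unfolding d Mm by simp
    ultimately show ?thesis by (simp del: of_int_mult)
  qed
  have "d \<noteq> 0"
  proof
    assume "d = 0"
    then have "\<theta> (0 + 1) = \<theta> 0" using d[of 0] by simp
    then show False using injD[OF inj, of "0 + 1" 0] by simp
  qed
  then show n0: "n \<noteq> 0" using n e0 by simp
  show "s - t \<in> \<int>" if eq: "exp (l s / of_int n) = exp (l t / of_int n)"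
  proof -
    obtain m :: int where m: "l s / of_int n = l t / of_int n + (of_int (2 * m) * pi) * \<i>"
      using eq unfolding exp_eq by blast
    have lm: "l s = l t + 2 * of_real pi * \<i> * of_int (n * m)"
    proof -
      have "l s = of_int n * (l s / of_int n)" using n0 by simp
      also have "\<dots> = l t + of_int n * ((of_int (2 * m) * pi) * \<i>)"
        unfolding m using n0 by (simp add: distrib_left)
      finally show ?thesis by (simp add: mult_ac)
    qed
    have "exp (l s) = exp (l t)" unfolding lm exp_eq by (intro exI[of _ "n * m"]) simp
    then have "exp (\<i> * of_real (\<theta> s)) = exp (\<i> * of_real (\<theta> t))" by (metis \<theta>(2))
    then obtain j :: int where "\<i> * of_real (\<theta> s) = \<i> * of_real (\<theta> t) + (of_int (2 * j) * pi) * \<i>"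
      unfolding exp_eq by blast
    from arg_cong[OF this, of Im] have j: "\<theta> s = \<theta> t + 2 * pi * of_int j" by simp
    have "M (\<theta> s) = M (\<theta> t) + 2 * of_real pi * \<i> * of_int (e * j)" unfolding j Mm ..
    then have "2 * of_real pi * \<i> * of_int (n * m) = 2 * of_real pi * \<i> * complex_of_int (e * j)"
      unfolding c lm by simp
    then have "n * m = e * j" by (simp del: of_int_mult)
    then have "j = d * m" using n e0 by simp
    then have "\<theta> s = \<theta> (t + of_int m)" using j \<theta>m by simp
    then have "s = t + of_int m" using injD[OF inj] by blast
    then show ?thesis by simp
  qed
qed

text \<open>
  The exponential function covers the annulus by a vertical strip, which is convex.
\<close>
lemma holomorphic_log_on_annulus_cover:
  assumes R: "1 < R" and f: "f holomorphic_on annulus (1/R) R" and nz: "\<And>z. z \<in> annulus (1/R) R \<Longrightarrow> f z \<noteq> 0"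
  obtains L and n :: int where "L holomorphic_on {s. \<bar>Re s\<bar> < ln R}"
    "\<And>s. \<bar>Re s\<bar> < ln R \<Longrightarrow> f (exp s) = exp (L s)"
    "\<And>s. \<bar>Re s\<bar> < ln R \<Longrightarrow> L (s + 2 * of_real pi * \<i>) = L s + 2 * of_real pi * \<i> * of_int n"
proof -
  let ?S = "{s. \<bar>Re s\<bar> < ln R}"
  have exp_in: "exp s \<in> annulus (1/R) R" if "s \<in> ?S" for s
  proof -
    have "exp (- ln R) < exp (Re s)" "exp (Re s) < exp (ln R)" using that by auto
    then show ?thesis using R by (simp add: exp_minus field_simps)
  qed
  have S: "?S = {s. Re s < ln R} \<inter> {s. - ln R < Re s}" by auto
  have conv: "convex ?S" unfolding S by (intro convex_Int convex_halfspace_Re_lt convex_halfspace_Re_gt)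
  have "(f \<circ> exp) holomorphic_on ?S"
    by (rule holomorphic_on_compose_gen[OF _ f]) (use exp_in in \<open>auto intro: holomorphic_intros\<close>)
  then obtain L where L: "L holomorphic_on ?S" "\<And>s. s \<in> ?S \<Longrightarrow> f (exp s) = exp (L s)"
    using contractible_imp_holomorphic_log[of "f \<circ> exp" ?S] convex_imp_contractible[OF conv] nz exp_in
    by (auto simp: o_def)
  have cL: "continuous_on ?S L" using L(1) by (rule holomorphic_on_imp_continuous_on)
  have cL2: "continuous_on ?S (\<lambda>s. L (s + 2 * of_real pi * \<i>))"
    by (rule continuous_on_compose2[OF cL]) (auto intro!: continuous_intros)
  have "exp (L (s + 2 * of_real pi * \<i>)) = exp (L s)" if "s \<in> ?S" for s
    using L(2)[of s] L(2)[of "s + 2 * of_real pi * \<i>"] that by (simp add: exp_add)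
  then obtain n :: int where "\<And>s. s \<in> ?S \<Longrightarrow> L (s + 2 * of_real pi * \<i>) = L s + 2 * of_real pi * \<i> * of_int n"
    using exp_lifts_differ_by_constant[OF convex_connected[OF conv] cL2 cL] by blast
  with L that show thesis by auto
qed

lemma periodic_int_shift:
  fixes L :: "complex \<Rightarrow> complex" and n :: int
  assumes "\<And>s. \<bar>Re s\<bar> < \<rho> \<Longrightarrow> L (s + 2 * of_real pi * \<i>) = L s + 2 * of_real pi * \<i> * of_int n"
    and s: "\<bar>Re s\<bar> < \<rho>"
  shows "L (s + 2 * of_real pi * \<i> * of_int m) = L s + 2 * of_real pi * \<i> * of_int (n * m)"
proof (induction m rule: int_induct[of _ 0])
  case (step1 i)
  then show ?case using assms(1)[of "s + 2 * of_real pi * \<i> * of_int i"] s by (simp add: algebra_simps)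
next
  case (step2 i)
  then show ?case using assms(1)[of "s + 2 * of_real pi * \<i> * of_int i - 2 * of_real pi * \<i>"] s by (simp add: algebra_simps)
qed simp

text \<open>
  A function on the annulus is holomorphic if its pullback to the strip is; two branches of the logarithm
  suffice as local inverses of the exponential function.
\<close>
lemma holomorphic_on_descend_exp:
  fixes H :: "complex \<Rightarrow> complex"
  assumes R: "1 < R" and G: "G holomorphic_on {s. \<bar>Re s\<bar> < ln R}"
    and H: "\<And>s. \<bar>Re s\<bar> < ln R \<Longrightarrow> H (exp s) = G s"
  shows "H holomorphic_on annulus (1/R) R"
proof -
  let ?A = "annulus (1/R) R" and ?S = "{s. \<bar>Re s\<bar> < ln R}"
  have z0: "z \<noteq> 0" if "z \<in> ?A" for z
    using that R by (auto intro: less_trans[of 0 "1/R"])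
  have Ln_in: "\<bar>Re (Ln z)\<bar> < ln R" if "1 / R < norm z" "norm z < R" for z
  proof -
    have "0 < norm z" using that(1) R by (auto intro: less_trans[of 0 "1/R"])
    moreover have "ln (norm z) < ln R" "ln (1 / R) < ln (norm z)"
      using that R calculation by (subst ln_less_cancel_iff; simp)+
    moreover have "Re (Ln z) = ln (norm z)" "ln (1 / R) = - ln R" using calculation R by (simp_all add: ln_div)
    ultimately show ?thesis by linarith
  qed
  have 1: "H holomorphic_on ?A \<inter> - \<real>\<^sub>\<le>\<^sub>0"
  proof (rule holomorphic_transform)
    show "(G \<circ> Ln) holomorphic_on ?A \<inter> - \<real>\<^sub>\<le>\<^sub>0"
      by (rule holomorphic_on_compose_gen[OF _ G]) (use Ln_in in \<open>auto intro!: holomorphic_intros\<close>)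
    show "(G \<circ> Ln) z = H z" if "z \<in> ?A \<inter> - \<real>\<^sub>\<le>\<^sub>0" for z
      using H[of "Ln z"] Ln_in[of z] z0[of z] that by auto
  qed
  have 2: "H holomorphic_on ?A \<inter> uminus -` (- \<real>\<^sub>\<le>\<^sub>0)"
  proof (rule holomorphic_transform)
    let ?l = "\<lambda>z. Ln (- z) + of_real pi * \<i>"
    show "(G \<circ> ?l) holomorphic_on ?A \<inter> uminus -` (- \<real>\<^sub>\<le>\<^sub>0)"
      by (rule holomorphic_on_compose_gen[OF _ G])
         (use Ln_in[of "- _"] in \<open>auto intro!: holomorphic_intros\<close>)
    show "(G \<circ> ?l) z = H z" if "z \<in> ?A \<inter> uminus -` (- \<real>\<^sub>\<le>\<^sub>0)" for z
      using H[of "?l z"] Ln_in[of "- z"] z0[of z] that by (auto simp: exp_add)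
  qed
  have "open (?A \<inter> - \<real>\<^sub>\<le>\<^sub>0)" by (intro open_Int open_Compl closed_nonpos_Reals_complex) auto
  moreover have "open (?A \<inter> uminus -` (- \<real>\<^sub>\<le>\<^sub>0))"
    by (intro open_Int open_vimage open_Compl closed_nonpos_Reals_complex continuous_intros) auto
  ultimately have "H holomorphic_on (?A \<inter> - \<real>\<^sub>\<le>\<^sub>0) \<union> (?A \<inter> uminus -` (- \<real>\<^sub>\<le>\<^sub>0))"
    by (intro holomorphic_on_Un 1 2)
  moreover have "?A = (?A \<inter> - \<real>\<^sub>\<le>\<^sub>0) \<union> (?A \<inter> uminus -` (- \<real>\<^sub>\<le>\<^sub>0))"
    using z0 by (auto simp: complex_nonpos_Reals_iff complex_eq_iff)
  ultimately show ?thesis by simp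
qed

text \<open>
  Near the unit circle, a function that maps the circle without critical points into a Jordan curve around 0 is
  the \<open>n\<close>-th power of a univalent function, where \<open>n\<close> is its winding number. The sign of \<open>n\<close>
  is arbitrary. The root has winding number 1, so it is a seam.
\<close>
theorem seam_root:
  assumes R: "1 < R" and f: "f holomorphic_on annulus (1/R) R" and nz: "\<And>z. z \<in> annulus (1/R) R \<Longrightarrow> f z \<noteq> 0"
    and der: "\<And>z. norm z = 1 \<Longrightarrow> deriv f z \<noteq> 0"
    and \<Gamma>: "jordan_curve \<Gamma>" "0 \<in> inside \<Gamma>" "f ` sphere 0 1 \<subseteq> \<Gamma>"
  obtains n :: int and r k where "n \<noteq> 0" "winding_number (f \<circ> circlepath 0 1) 0 = of_int n"
    "1 < r" "r \<le> R" "seam r k" "0 \<in> inside (k ` sphere 0 1)"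
    "\<And>z. z \<in> annulus (1/r) r \<Longrightarrow> k z \<noteq> 0 \<and> f z = k z powi n"
proof -
  let ?A = "annulus (1/R) R" and ?S = "{s. \<bar>Re s\<bar> < ln R}"
  obtain L and n :: int where L: "L holomorphic_on ?S"
    "\<And>s. \<bar>Re s\<bar> < ln R \<Longrightarrow> f (exp s) = exp (L s)"
    "\<And>s. \<bar>Re s\<bar> < ln R \<Longrightarrow> L (s + 2 * of_real pi * \<i>) = L s + 2 * of_real pi * \<i> * of_int n"
    using holomorphic_log_on_annulus_cover[OF R f nz] by blast
  have R0: "0 < ln R" using R by simp
  define l where "l t = L (2 * of_real pi * \<i> * of_real t)" for t :: real
  have fl: "f (unit_point t) = exp (l t)" for t
    using L(2)[of "2 * of_real pi * \<i> * of_real t"] R0 by (simp add: unit_point_def l_def)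
  have cl: "continuous_on UNIV l"
    unfolding l_def
    by (rule continuous_on_compose2[OF holomorphic_on_imp_continuous_on[OF L(1)]])
       (use R0 in \<open>auto intro!: continuous_intros\<close>)
  have l1: "l (t + 1) = l t + 2 * of_real pi * \<i> * of_int n" for t
    using L(3)[of "2 * of_real pi * \<i> * of_real t"] R0 by (simp add: l_def ring_distribs)
  have sA: "sphere 0 1 \<subseteq> ?A" by (rule sphere_subset_annulus[OF R])
  have loc: "\<exists>e>0. inj_on (\<lambda>t. exp (l t)) (ball t e)" for t
  proof -
    obtain \<epsilon> where \<epsilon>: "\<epsilon> > 0" "inj_on f (ball (unit_point t) \<epsilon>)"
      using has_complex_derivative_locally_injective[OF f, of "unit_point t"] der[of "unit_point t"]
        subsetD[OF sA, of "unit_point t"] by auto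
    have "isCont unit_point t"
      using continuous_on_unit_point[of UNIV "\<lambda>x. x"] by (simp add: continuous_on_eq_continuous_at continuous_on_id)
    then obtain \<delta> where \<delta>: "\<delta> > 0" "\<And>x. dist x t < \<delta> \<Longrightarrow> dist (unit_point x) (unit_point t) < \<epsilon>"
      using \<epsilon>(1) unfolding continuous_at_eps_delta by blast
    show ?thesis
    proof (intro exI[of _ "min \<delta> (1/2)"] conjI inj_onI)
      fix x y assume xy: "x \<in> ball t (min \<delta> (1/2))" "y \<in> ball t (min \<delta> (1/2))" "exp (l x) = exp (l y)"
      then have "unit_point x = unit_point y"
        using \<epsilon>(2) \<delta>(2)[of x] \<delta>(2)[of y] by (auto simp: fl[symmetric] dist_commute dest: inj_onD)
      moreover have "dist t x < 1 / 2" "dist t y < 1 / 2" using xy by auto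
      then have "\<bar>x - y\<bar> < 1" unfolding dist_real_def by linarith
      then have "\<bar>2 * pi * x - 2 * pi * y\<bar> < 2 * pi"
        using mult_strict_left_mono[of "\<bar>x - y\<bar>" 1 "2 * pi"] by (simp add: abs_mult flip: right_diff_distrib)
      then have im: "\<bar>Im (2 * of_real pi * \<i> * complex_of_real x) - Im (2 * of_real pi * \<i> * of_real y)\<bar> < 2 * pi"
        by simp
      ultimately have "2 * of_real pi * \<i> * complex_of_real x = 2 * of_real pi * \<i> * of_real y"
        using exp_complex_eqI[OF im] unfolding unit_point_def by blast
      then show "x = y" by simp
    qed (use \<delta> in auto)
  qed
  have in\<Gamma>: "exp (l t) \<in> \<Gamma>" for t
  proof -
    have "f (unit_point t) \<in> f ` sphere 0 1" by (intro imageI) simp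
    then show ?thesis using \<Gamma>(3) unfolding fl[symmetric] by blast
  qed
  note root = root_injective_on_Jordan_curve[OF \<Gamma>(1,2) cl in\<Gamma> l1 loc]
  define k where "k z = exp (L (Ln z) / of_int n)" for z
  have k: "k (exp s) = exp (L s / of_int n)" if "\<bar>Re s\<bar> < ln R" for s
  proof -
    obtain m :: int where "Ln (exp s) = s + (of_int (2 * m) * pi) * \<i>"
      using exp_Ln[of "exp s"] unfolding exp_eq by auto
    then have "Ln (exp s) = s + 2 * of_real pi * \<i> * of_int m" by (simp add: mult_ac)
    then have "L (Ln (exp s)) / of_int n = L s / of_int n + (of_int (2 * m) * pi) * \<i>"
      using periodic_int_shift[of "ln R" L n s m] L(3) that root(1) by (simp add: field_simps)
    then show ?thesis unfolding k_def exp_eq by blast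
  qed
  have holk: "k holomorphic_on ?A"
  proof (rule holomorphic_on_descend_exp[OF R])
    show "(\<lambda>s. exp (L s / of_int n)) holomorphic_on ?S"
      by (intro holomorphic_intros L(1)) (use root(1) in auto)
  qed (rule k)
  have ku: "k (unit_point t) = exp (l t / of_int n)" for t
    using k[of "2 * of_real pi * \<i> * of_real t"] R0 by (simp add: unit_point_def l_def)
  have fk: "f z = k z powi n" if "z \<in> ?A" for z
  proof -
    have z0: "0 < norm z" using that R by (auto intro: less_trans[of 0 "1/R"])
    have "ln (norm z) < ln R" "ln (1 / R) < ln (norm z)"
      using that z0 R by (subst ln_less_cancel_iff; simp)+
    moreover have "Re (Ln z) = ln (norm z)" "ln (1 / R) = - ln R" using z0 R by (simp_all add: ln_div)
    ultimately have "\<bar>Re (Ln z)\<bar> < ln R" by linarith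
    then have "f (exp (Ln z)) = exp (L (Ln z))" by (rule L(2))
    moreover have "exp (L (Ln z)) = k z powi n"
      unfolding k_def using root(1) by (simp add: exp_power_int)
    ultimately show ?thesis using z0 by simp
  qed
  have k_inj: "inj_on k (sphere 0 1)"
  proof (rule inj_onI)
    fix x y :: complex assume "x \<in> sphere 0 1" "y \<in> sphere 0 1" "k x = k y"
    then obtain s t where st: "x = unit_point s" "y = unit_point t" by (metis mem_sphere_0 unit_circle_point)
    then have "s - t \<in> \<int>" using \<open>k x = k y\<close> root(2) by (simp add: ku)
    then show "x = y" using unit_point_add_int[of "s - t" t] st by simp
  qed
  have k_loc: "\<exists>e>0. inj_on k (ball z e)" if z: "norm z = 1" for z
  proof -
    have zA: "z \<in> ?A" by (rule subsetD[OF sA]) (simp add: z)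
    obtain e where e: "e > 0" "ball z e \<subseteq> ?A" "inj_on f (ball z e)"
      using has_complex_derivative_locally_injective[OF f zA] der[OF z] by auto
    have "inj_on k (ball z e)"
    proof (rule inj_onI)
      fix x y assume xy: "x \<in> ball z e" "y \<in> ball z e" "k x = k y"
      then have "f x = f y" using fk e(2) by (simp add: subset_iff)
      then show "x = y" by (rule inj_onD[OF e(3) _ xy(1,2)])
    qed
    then show ?thesis using e(1) by blast
  qed
  obtain r where r: "1 < r" "r \<le> R" "inj_on k (annulus (1/r) r)"
    using injective_near_circle[OF R holomorphic_on_imp_continuous_on[OF holk] k_inj k_loc] by blast
  have "1 / R \<le> 1 / r" using r by (simp add: frac_le)
  then have rA: "annulus (1/r) r \<subseteq> ?A" using r by auto
  have holkr: "k holomorphic_on annulus (1/r) r" using holk rA holomorphic_on_subset by blast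
  have k0: "0 \<notin> k ` sphere 0 1" by (auto simp: k_def)
  have path_l: "path l" "path (\<lambda>t. l t / of_int n)"
    using cl continuous_on_subset root(1) unfolding path_def by (auto intro!: continuous_intros)
  have "k \<circ> circlepath 0 1 = exp \<circ> (\<lambda>t. l t / of_int n)"
    by (auto simp: circlepath_unit_point ku)
  then have "winding_number (k \<circ> circlepath 0 1) 0 = 1"
    using winding_number_compose_exp[OF path_l(2)] l1[of 0] root(1)
    by (simp add: pathfinish_def pathstart_def add_divide_distrib)
  note seam = seam_if_winding_number_1[OF r(1) holkr r(3) k0 this]
  have "f \<circ> circlepath 0 1 = exp \<circ> l" by (auto simp: circlepath_unit_point fl)
  then have "winding_number (f \<circ> circlepath 0 1) 0 = of_int n"
    using winding_number_compose_exp[OF path_l(1)] l1[of 0]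
    by (simp add: pathfinish_def pathstart_def)
  moreover have "k z \<noteq> 0 \<and> f z = k z powi n" if "z \<in> annulus (1/r) r" for z
    using fk[OF subsetD[OF rA that]] unfolding k_def by simp
  ultimately show thesis using that[OF root(1) _ r(1,2) seam] by blast
qed

section \<open>Zeros and poles in an analytic Jordan domain\<close>

lemma annulus_in_open:
  assumes "open A" "sphere 0 1 \<subseteq> A"
  obtains R where "1 < R" "annulus (1/R) R \<subseteq> A"
proof -
  obtain e where e: "e > 0" "(\<Union>z\<in>sphere 0 1. ball z e) \<subseteq> A"
    using compact_subset_open_imp_ball_epsilon_subset[OF compact_sphere assms] by blast
  show thesis
  proof (rule that[of "1 + e"])
    show "annulus (1 / (1 + e)) (1 + e) \<subseteq> A"
    proof
      fix z assume z: "z \<in> annulus (1 / (1 + e)) (1 + e)"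
      then have z0: "norm z > 0" using e by (auto intro: less_trans[of 0 "1 / (1 + e)"])
      have "1 - e < 1 / (1 + e)" using e by (simp add: field_simps)
      then have "\<bar>norm z - 1\<bar> < e" using z by auto
      moreover have "dist (sgn z) z = \<bar>norm z - 1\<bar>"
      proof -
        have "sgn z - z = (1 - norm z) *\<^sub>R sgn z"
          using z0 by (simp add: sgn_div_norm algebra_simps)
        then show ?thesis using z0 by (simp add: dist_norm norm_sgn)
      qed
      moreover have "sgn z \<in> sphere 0 1" using z0 by (simp add: norm_sgn)
      ultimately have "z \<in> (\<Union>z\<in>sphere 0 1. ball z e)" by (intro UN_I[of "sgn z"]) auto
      then show "z \<in> A" using e by blast
    qed
  qed (use e in simp)
qed

lemma analytic_jordan_domain_seam:
  assumes "analytic_jordan_domain D"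
  obtains R g where "seam R g" "D = inside (g ` sphere 0 1)" "frontier D = g ` sphere 0 1"
proof -
  obtain A g where A: "open A" "sphere 0 1 \<subseteq> A" "g holomorphic_on A" "inj_on g A"
    and D: "D = inside (g ` sphere 0 1)"
    using assms unfolding analytic_jordan_domain_def analytic_jordan_curve_def by blast
  obtain R where R: "1 < R" "annulus (1/R) R \<subseteq> A" using annulus_in_open[OF A(1,2)] by blast
  have g: "g holomorphic_on annulus (1/R) R" "inj_on g (annulus (1/R) R)"
    using A R holomorphic_on_subset inj_on_subset by blast+
  note path = univalent_circle_simple_path[OF R(1) g]
  have fr: "frontier D = g ` sphere 0 1"
    using Jordan_inside_outside[OF path(1,2)] path(3) D by simp
  have img: "(\<lambda>z. g (1 / z)) ` sphere 0 1 = g ` sphere 0 1"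
    by (rule image_reflected_circle)
  show thesis
    using seam_or_reflected_seam[OF R(1) g]
  proof
    assume "seam R g" then show thesis using that D fr by blast
  next
    assume "seam R (\<lambda>z. g (1 / z))"
    then show thesis by (rule that) (use img D fr in simp_all)
  qed
qed

lemma prod_power_int:
  fixes u :: "'a::field"
  assumes "u \<noteq> 0" "finite J"
  shows "(\<Prod>j\<in>J. u powi e j) = u powi (\<Sum>j\<in>J. e j)"
  using assms(2) by induction (use assms(1) in \<open>auto simp: power_int_add\<close>)

lemma seam_path_facts:
  assumes g: "seam R g"
  shows "valid_path (g \<circ> circlepath 0 1)" "path_image (g \<circ> circlepath 0 1) = g ` sphere 0 1"
    "pathfinish (g \<circ> circlepath 0 1) = pathstart (g \<circ> circlepath 0 1)"
    "\<And>c. c \<in> outside (g ` sphere 0 1) \<Longrightarrow> winding_number (g \<circ> circlepath 0 1) c = 0"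
proof -
  note path = univalent_circle_simple_path[OF seam_facts(1-3)[OF g]]
  show "valid_path (g \<circ> circlepath 0 1)" "path_image (g \<circ> circlepath 0 1) = g ` sphere 0 1"
    "pathfinish (g \<circ> circlepath 0 1) = pathstart (g \<circ> circlepath 0 1)"
    using path by auto
  show "winding_number (g \<circ> circlepath 0 1) c = 0" if "c \<in> outside (g ` sphere 0 1)" for c
    using winding_number_zero_in_outside[of "g \<circ> circlepath 0 1" c] path that
    by (simp add: simple_path_imp_path)
qed

text \<open>
  A meromorphic function on a domain and a collar of its boundary, without zeros and poles on the collar.
\<close>
locale seam_meromorphic =
  fixes R g D f
  assumes g: "seam R g" and D: "D = inside (g ` sphere 0 1)"
    and f: "f nicely_meromorphic_on D \<union> g ` annulus (1/R) R"
    and reg: "\<And>z. z \<in> annulus (1/R) R \<Longrightarrow> f analytic_on {g z} \<and> f (g z) \<noteq> 0"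
begin

abbreviation "A \<equiv> annulus (1/R) R"
abbreviation "W \<equiv> D \<union> g ` A"

text \<open>
  This is the set of zeros and poles, since a nicely meromorphic function has the value 0 at its poles.
\<close>
definition divisor :: "complex set" where "divisor = {z \<in> D. f z = 0}"

lemma open_W: "open W"
proof -
  have "open (g ` A)" by (rule open_mapping_thm3[OF seam_facts(2)[OF g] _ seam_facts(3)[OF g]]) simp
  then show ?thesis using seam_facts(6)[OF g] D by auto
qed

lemma connected_W: "connected W"
proof (rule connected_Un)
  show "connected D" using seam_facts(7)[OF g] D by simp
  show "connected (g ` A)"
    by (intro connected_continuous_image holomorphic_on_imp_continuous_on seam_facts(2)[OF g]) simp
  obtain z where "z \<in> annulus (1/R) 1" using half_annulus_nonempty(2)[OF seam_facts(1)[OF g]] by blast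
  then have "g z \<in> D" "z \<in> A" using seam_facts(4)[OF g] half_annulus_subset[OF seam_facts(1)[OF g]] D by blast+
  then show "D \<inter> g ` A \<noteq> {}" by blast
qed

lemma pole_imp_zero: "z \<in> W \<Longrightarrow> is_pole f z \<Longrightarrow> f z = 0"
  using f at_neq_bot not_tendsto_and_filterlim_at_infinity unfolding nicely_meromorphic_on_def is_pole_def by metis

lemma sphere_A: "sphere 0 1 \<subseteq> A"
  by (rule sphere_subset_annulus[OF seam_facts(1)[OF g]])

lemma W_nonzero_cosparse: "\<forall>\<^sub>\<approx>z\<in>W. f z \<noteq> 0"
proof -
  have "1 \<in> A" using sphere_A by (rule subsetD) simp
  then have "\<not> (\<forall>x\<in>W. f x = 0)" using reg by blast
  then show ?thesis
    using nicely_meromorphic_imp_constant_or_avoid[OF f open_W connected_W, of 0] by blast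
qed

lemma eventually_nonzero: "z \<in> W \<Longrightarrow> \<forall>\<^sub>F w in at z. f w \<noteq> 0"
  using W_nonzero_cosparse eventually_cosparse_open_eq[OF open_W] by blast

text \<open>
  The zeros and poles are isolated and lie in the part of \<open>D\<close> that the collar leaves over, which is compact.
\<close>
lemma finite_divisor: "finite divisor"
proof -
  let ?K = "- (outside (g ` sphere 0 1) \<union> g ` A)"
  have disj: "D \<inter> outside (g ` sphere 0 1) = {}" unfolding D by (rule inside_Int_outside)
  have op: "open (g ` A)" by (rule open_mapping_thm3[OF seam_facts(2)[OF g] _ seam_facts(3)[OF g]]) simp
  have sub: "?K \<subseteq> D"
    using inside_Un_outside[of "g ` sphere 0 1"] image_mono[OF sphere_A, of g] D by blast
  have K: "compact ?K"
    unfolding compact_eq_bounded_closed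
    using bounded_subset[OF seam_facts(8)[OF g]] sub D op seam_facts(9)[OF g] by auto
  have "{x. \<not> f x \<noteq> 0} sparse_in W"
    using W_nonzero_cosparse unfolding eventually_cosparse .
  then have "{x. \<not> f x \<noteq> 0} sparse_in ?K" by (rule sparse_in_subset) (use sub in blast)
  then have "finite (?K \<inter> {x. \<not> f x \<noteq> 0})" using K by (rule sparse_in_compact_finite)
  moreover have "divisor \<subseteq> ?K \<inter> {x. \<not> f x \<noteq> 0}"
    using reg disj by (auto simp: divisor_def simp del: mem_annulus)
  ultimately show ?thesis by (rule rev_finite_subset)
qed

lemma singularity:
  assumes "z \<in> D"
  shows "isolated_singularity_at f z" "not_essential f z" "\<exists>\<^sub>F w in at z. f w \<noteq> 0"
proof -
  have "f meromorphic_on {z}"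
    using f assms unfolding nicely_meromorphic_on_def by (auto intro: meromorphic_on_subset)
  then show "isolated_singularity_at f z" "not_essential f z"
    by (auto simp: meromorphic_at_iff)
  show "\<exists>\<^sub>F w in at z. f w \<noteq> 0"
    using eventually_nonzero[of z] assms by (intro eventually_frequently) auto
qed

lemma zorder_pole: "z \<in> D \<Longrightarrow> is_pole f z \<Longrightarrow> zorder f z < 0"
  using isolated_pole_imp_neg_zorder singularity(1) by blast

lemma zorder_zero: "z \<in> divisor \<Longrightarrow> \<not> is_pole f z \<Longrightarrow> zorder f z > 0"
  using zorder_pos_iff'[of f z] nicely_meromorphic_on_imp_analytic_at[OF f, of z] singularity(3)[of z]
  by (auto simp: divisor_def)

lemma zeros_eq: "{z \<in> D. sphere_val f z = Some 0} = {z \<in> divisor. zorder f z > 0}"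
  and poles_eq: "{z \<in> D. sphere_val f z = None} = {z \<in> divisor. zorder f z < 0}"
proof -
  have *: "is_pole f z \<longleftrightarrow> zorder f z < 0" if "z \<in> divisor" for z
  proof (cases "is_pole f z")
    case True
    then show ?thesis using zorder_pole[of z] that by (simp add: divisor_def)
  next
    case False
    then show ?thesis using zorder_zero[OF that] by simp
  qed
  have **: "z \<in> D \<and> (is_pole f z \<or> f z = 0) \<longleftrightarrow> z \<in> divisor" for z
    using pole_imp_zero[of z] by (auto simp: divisor_def)
  show "{z \<in> D. sphere_val f z = Some 0} = {z \<in> divisor. zorder f z > 0}"
    using * ** zorder_zero by (auto simp: sphere_val_def divisor_def)
  show "{z \<in> D. sphere_val f z = None} = {z \<in> divisor. zorder f z < 0}"
    using * ** by (auto simp: sphere_val_def split: if_splits)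
qed

lemma sum_zorder: "(\<Sum>z\<in>divisor. zorder f z) = int (num_zeros f D) - int (num_poles f D)"
proof -
  have "(\<Sum>z\<in>divisor. zorder f z) = (\<Sum>z\<in>divisor. int (if zorder f z > 0 then nat (zorder f z) else 0)
      - int (if zorder f z < 0 then nat (- zorder f z) else 0))"
    by (rule sum.cong) auto
  also have "\<dots> = int (\<Sum>z\<in>divisor. if zorder f z > 0 then nat (zorder f z) else 0)
      - int (\<Sum>z\<in>divisor. if zorder f z < 0 then nat (- zorder f z) else 0)"
    by (simp add: sum_subtractf)
  also have "(\<Sum>z\<in>divisor. if zorder f z > 0 then nat (zorder f z) else 0) = num_zeros f D"
    unfolding num_zeros_def zeros_eq using finite_divisor by (simp add: sum.inter_filter)
  also have "(\<Sum>z\<in>divisor. if zorder f z < 0 then nat (- zorder f z) else 0) = num_poles f D"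
    unfolding num_poles_def poles_eq using finite_divisor by (simp add: sum.inter_filter)
  finally show ?thesis .
qed

lemma winding_number_eq_zeros_minus_poles:
  "winding_number ((\<lambda>z. f (g z)) \<circ> circlepath 0 1) 0 = of_int (int (num_zeros f D) - int (num_poles f D))"
proof -
  let ?C = "g ` sphere 0 1"
  define \<gamma> where "\<gamma> = g \<circ> circlepath 0 1"
  note path = seam_path_facts[OF g, folded \<gamma>_def]
  have C_reg: "f analytic_on ?C" "0 \<notin> f ` ?C"
    using reg sphere_A by (auto simp: analytic_on_analytic_at[of f ?C] subset_iff)
  have pz: "{w \<in> W. f w = 0 \<or> w \<in> {w. is_pole f w}} = divisor"
    using pole_imp_zero reg by (auto simp: divisor_def simp del: mem_annulus)
  have CW: "?C \<subseteq> W" using sphere_A by blast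
  have w1: "winding_number \<gamma> p = 1" if "p \<in> D" for p
    using winding_number_seam(3)[OF g] that unfolding D \<gamma>_def .
  have "contour_integral \<gamma> (\<lambda>x. deriv f x * 1 / f x) = 2 * pi * \<i> *
      (\<Sum>p\<in>{w \<in> W. f w = 0 \<or> w \<in> {w. is_pole f w}}. winding_number \<gamma> p * 1 * zorder f p)"
  proof (rule argument_principle[OF open_W connected_W])
    show "f holomorphic_on W - {w. is_pole f w}"
      using nicely_meromorphic_on_imp_analytic_at[OF f]
      by (intro analytic_imp_holomorphic) (subst analytic_on_analytic_at, auto)
    show "path_image \<gamma> \<subseteq> W - {w \<in> W. f w = 0 \<or> w \<in> {w. is_pole f w}}"
      unfolding pz path(2) divisor_def using CW C_reg(2) by auto
    show "\<forall>z. z \<notin> W \<longrightarrow> winding_number \<gamma> z = 0"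
      using path(4) inside_Un_outside[of ?C] CW D by blast
    show "finite {w \<in> W. f w = 0 \<or> w \<in> {w. is_pole f w}}" unfolding pz by (rule finite_divisor)
  qed (use path in auto)
  also have "(\<Sum>p\<in>{w \<in> W. f w = 0 \<or> w \<in> {w. is_pole f w}}. winding_number \<gamma> p * 1 * zorder f p)
      = (\<Sum>p\<in>divisor. of_int (zorder f p))"
    unfolding pz by (rule sum.cong) (auto simp: divisor_def w1)
  finally have int: "contour_integral \<gamma> (\<lambda>x. deriv f x / f x)
      = 2 * pi * \<i> * of_int (int (num_zeros f D) - int (num_poles f D))"
    unfolding sum_zorder[symmetric] by simp
  have "contour_integral (f \<circ> \<gamma>) (\<lambda>w. 1 / w) = contour_integral \<gamma> (\<lambda>w. deriv f w * (1 / f w))"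
    by (rule contour_integral_comp_analyticW[OF C_reg(1)]) (use path in auto)
  moreover have "valid_path (f \<circ> \<gamma>)"
    by (rule valid_path_compose_analytic[OF path(1), of f ?C]) (use C_reg path in auto)
  ultimately have "winding_number (f \<circ> \<gamma>) 0 = of_int (int (num_zeros f D) - int (num_poles f D))"
    using C_reg(2) path(2) int
    by (subst winding_number_valid_path) (auto simp: path_image_compose)
  moreover have "f \<circ> \<gamma> = (\<lambda>z. f (g z)) \<circ> circlepath 0 1" by (auto simp: \<gamma>_def)
  ultimately show ?thesis by simp
qed

section \<open>The product formula\<close>

text \<open>
  Glue \<open>D\<close> to the outside of the curve of \<open>k\<close>. The function \<open>u \<mapsto> u powi n\<close>, with
  \<open>n\<close> the number of zeros minus the number of poles, continues \<open>f\<close> to the glued sphere, without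
  zeros and poles outside \<open>D\<close> except possibly at infinity. The product of the factors
  \<open>\<phi> - \<phi> z\<close>, raised to the orders of \<open>f\<close>, has the same zeros and poles, also at infinity, by
  univalence of the coordinate \<open>(\<phi>, F, \<psi>)\<close>. So the quotient is constant by the Liouville theorem,
  and it is 1 at infinity.
\<close>
lemma divisor_product_representation:
  assumes k: "seam R k" and 0: "0 \<in> inside (k ` sphere 0 1)"
    and fk: "\<And>z. z \<in> A \<Longrightarrow> k z \<noteq> 0 \<and> f (g z) = k z powi (\<Sum>z\<in>divisor. zorder f z)"
  obtains \<phi> where "\<phi> holomorphic_on D" "inj_on \<phi> D"
    "\<And>w. w \<in> D - divisor \<Longrightarrow> f w = (\<Prod>z\<in>divisor. (\<phi> w - \<phi> z) powi zorder f z)"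
proof -
  let ?E = "outside (k ` sphere 0 1)"
  note fg = seam_facts[OF g] and fk' = seam_facts[OF k]
  obtain \<phi> \<psi> F where \<phi>: "\<phi> holomorphic_on D" "inj_on \<phi> D"
    and \<psi>: "\<psi> holomorphic_on ?E" and lim\<psi>: "((\<lambda>w. \<psi> w - w) \<longlongrightarrow> 0) at_infinity"
    and F: "F holomorphic_on A"
    and F_in: "\<And>z. z \<in> annulus (1/R) 1 \<Longrightarrow> F z = \<phi> (g z)"
    and F_out: "\<And>z. z \<in> annulus 1 R \<Longrightarrow> F z = \<psi> (k z)"
    and ne_out: "\<And>w u. w \<in> D \<Longrightarrow> u \<in> ?E \<Longrightarrow> \<psi> u \<noteq> \<phi> w"
    and ne_circle: "\<And>w z. w \<in> D \<Longrightarrow> norm z = 1 \<Longrightarrow> F z \<noteq> \<phi> w"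
    using conformal_welding[OF g k, folded D] by blast
  have oD: "open D" using fg(6) unfolding D .
  have in_D: "g z \<in> D" if "z \<in> annulus (1/R) 1" for z using fg(4)[OF that] unfolding D .
  have divD: "divisor \<subseteq> D" by (auto simp: divisor_def)
  \<comment> \<open>With these exponents, T \<open>(\<phi> w)\<close> is the reciprocal of the product to be compared with f.\<close>
  define e where "e z = - zorder f z" for z
  define n where "n = (\<Sum>z\<in>divisor. zorder f z)"
  have n: "n = - (\<Sum>z\<in>divisor. e z)" by (simp add: n_def e_def sum_negf)
  define T where "T x = (\<Prod>z\<in>divisor. (x - \<phi> z) powi e z)" for x
  have ne_A: "F z \<noteq> \<phi> w" if z: "z \<in> A" and w: "w \<in> divisor" for z w
    using z
  proof (cases rule: annulus_cases)
    case 1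
    then have gz: "g z \<in> D" by (rule in_D)
    have "f (g z) \<noteq> 0" using reg z by blast
    then have "g z \<noteq> w" using w by (auto simp: divisor_def)
    then show ?thesis using inj_onD[OF \<phi>(2), of "g z" w] gz w divD F_in[OF 1] by auto
  next
    case 2
    then show ?thesis using ne_circle[of w z] w divD by auto
  next
    case 3
    then show ?thesis using ne_out[of w "k z"] w divD fk'(5) F_out[OF 3] by auto
  qed
  have ne_in: "\<phi> w \<noteq> \<phi> z" if "w \<in> D - divisor" "z \<in> divisor" for w z
    using that inj_onD[OF \<phi>(2), of w z] divD by auto
  have analytic_quot: "(\<lambda>w. f w * T (\<phi> w)) analytic_on {w}" if w: "w \<in> D - divisor" for w
  proof -
    have "f analytic_on {w}"
      using nicely_meromorphic_on_imp_analytic_at[OF f, of w] pole_imp_zero[of w] w by (auto simp: divisor_def)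
    moreover have "\<phi> analytic_on {w}"
      using \<phi>(1) oD w by (auto simp: analytic_at)
    ultimately show ?thesis
      unfolding T_def by (intro analytic_intros) (use ne_in[OF w] in auto)
  qed
  \<comment> \<open>At a zero or pole z0, the factor \<open>(w - z0) powi zorder f z0\<close> of f cancels against the
    factor of T at z0, up to a power of the nonvanishing difference quotient of \<open>\<phi>\<close>.\<close>
  have lim_quot: "\<exists>c. (\<lambda>w. f w * T (\<phi> w)) \<midarrow>z0\<rightarrow> c" if z0: "z0 \<in> divisor" for z0
  proof -
    have z0D: "z0 \<in> D" using z0 divD by blast
    obtain h r where h: "h z0 \<noteq> 0" "r > 0" "h holomorphic_on cball z0 r"
      "\<And>w. w \<in> cball z0 r - {z0} \<Longrightarrow> f w = h w * (w - z0) powi zorder f z0"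
      using zorder_exist[OF singularity[OF z0D]] by blast
    let ?G = "\<lambda>w. h w * (difference_quotient \<phi> z0 w powi e z0 * (\<Prod>z\<in>divisor - {z0}. (\<phi> w - \<phi> z) powi e z))"
    have "isCont h z0"
      using h(2,3) by (intro continuous_on_interior[of "cball z0 r"] holomorphic_on_imp_continuous_on) auto
    moreover have contD: "isCont \<phi> z0" "isCont (difference_quotient \<phi> z0) z0"
      using \<phi>(1) z0D oD holomorphic_on_difference_quotient[OF \<phi>(1), of z0]
      by (auto simp: continuous_on_eq_continuous_at dest!: holomorphic_on_imp_continuous_on)
    moreover have dq: "difference_quotient \<phi> z0 z0 \<noteq> 0"
      using difference_quotient_nonzero[OF \<phi>(1) oD \<phi>(2) z0D z0D] .
    moreover have ne: "\<phi> z0 \<noteq> \<phi> z" if "z \<in> divisor - {z0}" for z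
      using that inj_onD[OF \<phi>(2), of z0 z] z0D divD by auto
    ultimately have "?G \<midarrow>z0\<rightarrow> ?G z0"
      unfolding isCont_def by (intro tendsto_intros) auto
    moreover have "\<forall>\<^sub>F w in at z0. ?G w = f w * T (\<phi> w)"
    proof -
      have "\<forall>\<^sub>F w in at z0. w \<in> cball z0 r - {z0}"
        using h(2) eventually_at_ball'[of r z0 UNIV] by (auto elim!: eventually_mono)
      then show ?thesis
      proof eventually_elim
        case (elim w)
        have "(\<phi> w - \<phi> z0) powi e z0 = (w - z0) powi e z0 * difference_quotient \<phi> z0 w powi e z0"
          by (simp add: difference_quotient_mult[symmetric] power_int_mult_distrib)
        moreover have "(w - z0) powi zorder f z0 * (w - z0) powi e z0 = 1"
          using elim by (simp add: e_def power_int_minus)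
        ultimately show ?case
          unfolding T_def using h(4)[OF elim]
          by (subst prod.remove[OF finite_divisor z0]) (simp add: mult_ac)
      qed
    qed
    ultimately have "(\<lambda>w. f w * T (\<phi> w)) \<midarrow>z0\<rightarrow> ?G z0" by (rule Lim_transform_eventually)
    then show ?thesis by (rule exI)
  qed
  define u where "u = remove_sings (\<lambda>w. f w * T (\<phi> w))"
  have u_eq: "u w = f w * T (\<phi> w)" if "w \<in> D - divisor" for w
    unfolding u_def by (rule remove_sings_at_analytic[OF analytic_quot[OF that]])
  have "u analytic_on D"
  proof (subst analytic_on_analytic_at, intro ballI)
    fix z assume z: "z \<in> D"
    show "u analytic_on {z}"
    proof (cases "z \<in> divisor")
      case True
      have "isolated_singularity_at (\<lambda>w. f w * T (\<phi> w)) z"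
      unfolding isolated_singularity_at_iff_analytic_nhd
      proof (intro exI[of _ "D - (divisor - {z})"] conjI)
        have "finite (divisor - {z})" using finite_divisor by simp
        then have "open (D - (divisor - {z}))" using oD by (intro open_Diff finite_imp_closed) auto
        then show "open (D - (divisor - {z}))" .
        show "(\<lambda>w. f w * T (\<phi> w)) analytic_on (D - (divisor - {z})) - {z}"
          by (subst analytic_on_analytic_at) (use analytic_quot in auto)
      qed (use z in auto)
      then show ?thesis using lim_quot[OF True] remove_sings_analytic_at unfolding u_def by blast
    next
      case False
      then show ?thesis unfolding u_def by (intro remove_sings_analytic_on analytic_quot) (use z in auto)
    qed
  qed
  then have hol_u: "(\<lambda>w. u w - 1) holomorphic_on inside (g ` sphere 0 1)"
    unfolding D[symmetric] by (intro holomorphic_intros analytic_imp_holomorphic)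
  have ne0: "w \<noteq> 0" if "w \<in> ?E" for w
    using that 0 not_inside_and_outside by blast
  have hol_out: "(\<lambda>w. w powi n * T (\<psi> w) - 1) holomorphic_on ?E"
    unfolding T_def by (intro holomorphic_intros \<psi>) (use ne0 ne_out divD in auto)
  \<comment> \<open>Distributing the n factors w over the product turns its factors into
    \<open>(\<psi> w - \<phi> z) / w\<close>, which tend to 1.\<close>
  have "((\<lambda>w. (\<Prod>z\<in>divisor. (1 + (\<psi> w - w - \<phi> z) * inverse w) powi e z) - 1)
      \<longlongrightarrow> (\<Prod>z\<in>divisor. (1 + (0 - \<phi> z) * 0) powi e z) - 1) at_infinity"
    by (intro tendsto_intros lim\<psi> tendsto_inverse_0) auto
  moreover have "\<forall>\<^sub>F w in at_infinity. (\<Prod>z\<in>divisor. (1 + (\<psi> w - w - \<phi> z) * inverse w) powi e z) - 1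
      = w powi n * T (\<psi> w) - 1"
  proof (intro eventually_mono[OF eventually_not_equal_at_infinity[of 0]])
    fix w :: complex assume w: "w \<noteq> 0"
    have factor: "1 + (\<psi> w - w - c) * inverse w = (\<psi> w - c) * inverse w" for c
      using w by (simp add: field_simps)
    have "(\<Prod>z\<in>divisor. (1 + (\<psi> w - w - \<phi> z) * inverse w) powi e z)
        = (\<Prod>z\<in>divisor. (\<psi> w - \<phi> z) powi e z * inverse w powi e z)"
      by (simp only: factor power_int_mult_distrib)
    also have "\<dots> = T (\<psi> w) * inverse w powi (- n)"
      unfolding prod.distrib T_def n using prod_power_int[of "inverse w" divisor e] w finite_divisor by simp
    also have "inverse w powi (- n) = w powi n"
      by (simp add: power_int_inverse power_int_minus)
    finally show "(\<Prod>z\<in>divisor. (1 + (\<psi> w - w - \<phi> z) * inverse w) powi e z) - 1 = w powi n * T (\<psi> w) - 1"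
      by (simp add: mult.commute)
  qed
  ultimately have lim_out: "((\<lambda>w. w powi n * T (\<psi> w) - 1) \<longlongrightarrow> 0) at_infinity"
    using Lim_transform_eventually by fastforce
  have hol_A: "(\<lambda>z. k z powi n * T (F z) - 1) holomorphic_on A"
    unfolding T_def by (intro holomorphic_intros F fk') (use fk ne_A in auto)
  have "u w - 1 = 0" if w: "w \<in> D" for w
  proof (rule glued_sphere_Liouville(3)[OF k g hol_out lim_out hol_u hol_A])
    show "k z powi n * T (\<psi> (k z)) - 1 = k z powi n * T (F z) - 1" if "z \<in> annulus 1 R" for z
      using F_out[OF that] by simp
    show "u (g z) - 1 = k z powi n * T (F z) - 1" if z: "z \<in> annulus (1/R) 1" for z
    proof -
      have zA: "z \<in> A" using z half_annulus_subset[OF fg(1)] by blast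
      then have "g z \<in> D - divisor" using reg[OF zA] in_D[OF z] by (auto simp: divisor_def)
      then show ?thesis using u_eq fk[OF zA] F_in[OF z] by (simp add: n_def)
    qed
    show "w \<in> inside (g ` sphere 0 1)" using w D by simp
  qed
  then have prod1: "f w * T (\<phi> w) = 1" if "w \<in> D - divisor" for w
    using u_eq[OF that] that by auto
  have "f w = (\<Prod>z\<in>divisor. (\<phi> w - \<phi> z) powi zorder f z)" if w: "w \<in> D - divisor" for w
  proof -
    have "(\<Prod>z\<in>divisor. (\<phi> w - \<phi> z) powi zorder f z) * T (\<phi> w) = 1"
      unfolding T_def prod.distrib[symmetric]
      by (rule prod.neutral) (use ne_in[OF w] in \<open>auto simp: e_def power_int_minus\<close>)
    then show ?thesis using prod1[OF w] by (metis mult_cancel_right mult_zero_right zero_neq_one)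
  qed
  then show thesis using that \<phi> by blast
qed

end

section \<open>Rational maps with a prescribed divisor\<close>

text \<open>
  Only the points with \<open>e j > 0\<close> contribute, so that a divisor \<open>e\<close> gives the numerator and
  \<open>- e\<close> the denominator of the same rational function.
\<close>
definition linear_factors :: "('a \<Rightarrow> complex) \<Rightarrow> ('a \<Rightarrow> int) \<Rightarrow> 'a set \<Rightarrow> complex poly" where
  "linear_factors c e J = (\<Prod>j\<in>J. [:- c j, 1:] ^ nat (e j))"

lemma linear_factors_nonzero: "finite J \<Longrightarrow> linear_factors c e J \<noteq> 0"
  by (simp add: linear_factors_def)

lemma degree_linear_factors: "finite J \<Longrightarrow> degree (linear_factors c e J) = (\<Sum>j\<in>J. nat (e j))"
  unfolding linear_factors_def by (subst degree_prod_sum_eq) (auto simp: degree_linear_power)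

lemma poly_linear_factors: "poly (linear_factors c e J) x = (\<Prod>j\<in>J. (x - c j) ^ nat (e j))"
  by (simp add: linear_factors_def poly_prod)

lemma poly_linear_factors_eq_0:
  "finite J \<Longrightarrow> poly (linear_factors c e J) x = 0 \<longleftrightarrow> (\<exists>j\<in>J. e j > 0 \<and> x = c j)"
  by (auto simp: poly_linear_factors)

lemma coprime_linear_factors:
  assumes "finite J" "inj_on c J"
  shows "coprime (linear_factors c e J) (linear_factors c (\<lambda>j. - e j) J)"
proof (rule coprimeI)
  fix d assume d: "d dvd linear_factors c e J" "d dvd linear_factors c (\<lambda>j. - e j) J"
  show "is_unit d"
  proof (rule ccontr)
    assume "\<not> is_unit d"
    moreover have "d \<noteq> 0" using d(1) linear_factors_nonzero[OF assms(1)] by auto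
    ultimately have "degree d \<noteq> 0" by (simp add: is_unit_iff_degree)
    then obtain x where "poly d x = 0"
      using alg_closed_imp_poly_has_root[of d] by auto
    then have "poly (linear_factors c e J) x = 0" "poly (linear_factors c (\<lambda>j. - e j) J) x = 0"
      using d by (auto elim!: dvdE)
    then show False
      using assms(2) by (auto simp: poly_linear_factors_eq_0[OF assms(1)] dest: inj_onD)
  qed
qed

lemma linear_factors_quotient:
  assumes "finite J" "\<And>j. j \<in> J \<Longrightarrow> x \<noteq> c j"
  shows "poly (linear_factors c e J) x / poly (linear_factors c (\<lambda>j. - e j) J) x = (\<Prod>j\<in>J. (x - c j) powi e j)"
  unfolding poly_linear_factors prod_dividef[symmetric]
proof (rule prod.cong)
  fix j assume "j \<in> J"
  show "(x - c j) ^ nat (e j) / (x - c j) ^ nat (- e j) = (x - c j) powi e j"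
    by (cases "e j" "0::int" rule: linorder_cases) (auto simp: power_int_def field_simps)
qed simp

text \<open>
  In the coordinate \<open>w = 1 / x\<close> each factor \<open>x - c j\<close> is \<open>(1 - c j * w) / w\<close>.
\<close>
lemma order_at_infinity_linear_factors:
  assumes J: "finite J"
  shows "order_at_infinity (quotient_map (linear_factors c e J) (linear_factors c (\<lambda>j. - e j) J)) = - (\<Sum>j\<in>J. e j)"
  unfolding order_at_infinity_def
proof (rule zorder_eqI)
  let ?S = "{z. \<forall>j\<in>J. 1 - c j * z \<noteq> 0}"
  have "?S = (\<Inter>j\<in>J. {z. 1 - c j * z \<noteq> 0})" by auto
  moreover have "open \<dots>"
    by (intro open_INT J ballI open_Collect_neq continuous_intros)
  ultimately show "open ?S" by simp
  show "(\<lambda>z. \<Prod>j\<in>J. (1 - c j * z) powi e j) holomorphic_on ?S"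
    by (intro holomorphic_intros) auto
  fix w assume w: "w \<in> ?S" "w \<noteq> 0"
  have ne: "1 / w \<noteq> c j" if "j \<in> J" for j
  proof
    assume "1 / w = c j"
    then have "c j * w = 1" using w(2) by (metis nonzero_divide_eq_eq)
    then show False using w(1) that by auto
  qed
  have factor: "1 / w - c j = (1 - c j * w) * inverse w" for j using w by (simp add: field_simps)
  have "(case quotient_map (linear_factors c e J) (linear_factors c (\<lambda>j. - e j) J) (Some (1 / w)) of None \<Rightarrow> 0 | Some x \<Rightarrow> x)
      = poly (linear_factors c e J) (1 / w) / poly (linear_factors c (\<lambda>j. - e j) J) (1 / w)"
    by simp
  also have "\<dots> = (\<Prod>j\<in>J. (1 / w - c j) powi e j)"
    by (rule linear_factors_quotient[OF J]) (use ne in auto)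
  also have "\<dots> = (\<Prod>j\<in>J. (1 - c j * w) powi e j) * inverse w powi (\<Sum>j\<in>J. e j)"
    unfolding factor power_int_mult_distrib prod.distrib
    using prod_power_int[of "inverse w" J e] w J by simp
  also have "inverse w powi (\<Sum>j\<in>J. e j) = (w - 0) powi (- (\<Sum>j\<in>J. e j))"
    by (simp add: power_int_inverse power_int_minus)
  finally show "(case quotient_map (linear_factors c e J) (linear_factors c (\<lambda>j. - e j) J) (Some (1 / w)) of None \<Rightarrow> 0 | Some x \<Rightarrow> x)
      = (\<Prod>j\<in>J. (1 - c j * w) powi e j) * (w - 0) powi (- (\<Sum>j\<in>J. e j))" .
qed auto

section \<open>Factorization through a rational map\<close>

theorem theorem2:
  fixes D U \<Gamma> :: "complex set" and f :: "complex \<Rightarrow> complex" and M N :: nat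
  assumes "analytic_jordan_domain D"
    and "open U" and "closure D \<subseteq> U" and "f nicely_meromorphic_on U"
    and "\<forall>z\<in>frontier D. deriv f z \<noteq> 0"
    and "sphere_val f ` frontier D = Some ` \<Gamma>" and "jordan_curve \<Gamma>" and "0 \<in> inside \<Gamma>"
    and "M = num_zeros f D" and "N = num_poles f D"
  shows "\<exists>\<phi> r. \<phi> holomorphic_on D \<and> inj_on \<phi> D
           \<and> rational_map_of_degree r (max M N)
           \<and> (\<forall>z\<in>D. sphere_val f z = r (Some (\<phi> z)))
           \<and> (\<forall>x. r x = Some 0 \<or> r x = None \<longrightarrow> x \<in> Some ` \<phi> ` D \<or> x = None)
           \<and> (M \<ge> N \<longrightarrow> order_at_infinity r = - int (M - N))
           \<and> (N \<ge> M \<longrightarrow> order_at_infinity r = int (N - M))"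
proof -
  obtain R0 g where g0: "seam R0 g" and D: "D = inside (g ` sphere 0 1)" and frD: "frontier D = g ` sphere 0 1"
    using analytic_jordan_domain_seam[OF assms(1)] by blast
  note fg = seam_facts[OF g0]
  have 0: "0 \<notin> \<Gamma>" using assms(8) by (auto simp: inside_def)
  have CU: "g ` sphere 0 1 \<subseteq> U" using assms(3) frD by (auto simp: closure_Un_frontier)
  have DU: "D \<subseteq> U" using assms(3) closure_subset by blast
  have on_C: "\<not> is_pole f w" "f w \<in> \<Gamma>" if "w \<in> g ` sphere 0 1" for w
  proof -
    have "sphere_val f w \<in> Some ` \<Gamma>" using assms(6) that frD by blast
    then show "\<not> is_pole f w" "f w \<in> \<Gamma>" by (auto simp: sphere_val_def split: if_splits)
  qed
  \<comment> \<open>A collar of the boundary that is mapped into X contains neither zeros nor poles.\<close>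
  define X where "X = {w \<in> U. f analytic_on {w} \<and> f w \<noteq> 0}"
  have "open X"
  proof (subst open_subopen, intro ballI)
    fix w assume w: "w \<in> X"
    then obtain S where S: "open S" "w \<in> S" "f holomorphic_on S" by (auto simp: X_def analytic_at)
    have "open (S \<inter> U \<inter> f -` (- {0}))"
    proof (rule continuous_open_preimage)
      show "continuous_on (S \<inter> U) f"
        using S(3) holomorphic_on_imp_continuous_on continuous_on_subset by blast
    qed (use S assms(2) in auto)
    moreover have "S \<inter> U \<inter> f -` (- {0}) \<subseteq> X" using S by (auto simp: X_def analytic_at)
    moreover have "w \<in> S \<inter> U \<inter> f -` (- {0})" using w S by (auto simp: X_def)
    ultimately show "\<exists>T. open T \<and> w \<in> T \<and> T \<subseteq> X" by blast
  qed
  then have "open (annulus (1/R0) R0 \<inter> g -` X)"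
    by (intro continuous_open_preimage holomorphic_on_imp_continuous_on fg) auto
  moreover have "sphere 0 1 \<subseteq> annulus (1/R0) R0 \<inter> g -` X"
  proof
    fix z :: complex assume z: "z \<in> sphere 0 1"
    then have gz: "g z \<in> g ` sphere 0 1" by (rule imageI)
    then have "g z \<in> X"
      using CU on_C[OF gz] 0 nicely_meromorphic_on_imp_analytic_at[OF assms(4), of "g z"] by (auto simp: X_def)
    then show "z \<in> annulus (1/R0) R0 \<inter> g -` X"
      using z sphere_subset_annulus[OF fg(1)] by blast
  qed
  ultimately obtain R1 where R1: "1 < R1" "annulus (1/R1) R1 \<subseteq> annulus (1/R0) R0 \<inter> g -` X"
    by (rule annulus_in_open)
  define R where "R = min R0 R1"
  have R: "1 < R" "R \<le> R0" "R \<le> R1" using fg(1) R1 by (auto simp: R_def)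
  have g: "seam R g" by (rule seam_mono[OF g0 R(1,2)])
  have "1 / R1 \<le> 1 / R" using R R1 by (simp add: frac_le)
  then have RX: "annulus (1/R) R \<subseteq> g -` X" using R1(2) R(3) by (force simp del: inverse_eq_divide)
  interpret S0: seam_meromorphic R g D f
  proof
    show "f nicely_meromorphic_on D \<union> g ` annulus (1/R) R"
      by (rule nicely_meromorphic_on_subset[OF assms(4)]) (use DU RX X_def in blast)
    show "f analytic_on {g z} \<and> f (g z) \<noteq> 0" if "z \<in> annulus (1/R) R" for z
      using that RX by (auto simp: X_def)
  qed (use g D in auto)
  have fgA: "(\<lambda>z. f (g z)) holomorphic_on annulus (1/R) R"
  proof -
    have "f holomorphic_on g ` annulus (1/R) R"
      by (intro analytic_imp_holomorphic) (subst analytic_on_analytic_at, use S0.reg in blast)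
    then show ?thesis
      using holomorphic_on_compose_gen[OF seam_facts(2)[OF g], of f "g ` annulus (1/R) R"] by (simp add: o_def)
  qed
  have der: "deriv (\<lambda>z. f (g z)) z \<noteq> 0" if z: "norm z = 1" for z
  proof -
    have zA: "z \<in> annulus (1/R) R" by (rule subsetD[OF sphere_subset_annulus[OF R(1)]]) (simp add: z)
    have "deriv g z \<noteq> 0"
      by (rule holomorphic_injective_imp_regular[OF seam_facts(2)[OF g] _ seam_facts(3)[OF g] zA]) simp
    moreover have "deriv f (g z) \<noteq> 0" using assms(5) frD z by auto
    moreover have "deriv (f \<circ> g) z = deriv f (g z) * deriv g z"
      using S0.reg[OF zA] seam_facts(2)[OF g] zA
      by (intro deriv_chain) (auto intro: analytic_on_imp_differentiable_at holomorphic_on_imp_differentiable_at[of g "annulus (1/R) R"])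
    ultimately show ?thesis by (simp add: o_def)
  qed
  \<comment> \<open>The root k of f on the collar, along which D will be glued to an exterior domain.\<close>
  obtain n :: int and r k where n: "n \<noteq> 0" "winding_number ((\<lambda>z. f (g z)) \<circ> circlepath 0 1) 0 = of_int n"
    and r: "1 < r" "r \<le> R" and k: "seam r k" "0 \<in> inside (k ` sphere 0 1)"
    and kn: "\<And>z. z \<in> annulus (1/r) r \<Longrightarrow> k z \<noteq> 0 \<and> f (g z) = k z powi n"
    using seam_root[OF R(1) fgA _ der assms(7,8)] S0.reg on_C(2) by blast
  have "1 / R \<le> 1 / r" using r by (simp add: frac_le)
  then have rR: "annulus (1/r) r \<subseteq> annulus (1/R) R" using r by auto
  interpret S: seam_meromorphic r g D f
  proof
    show "f nicely_meromorphic_on D \<union> g ` annulus (1/r) r"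
      by (rule nicely_meromorphic_on_subset[OF S0.f]) (use rR in blast)
    show "f analytic_on {g z} \<and> f (g z) \<noteq> 0" if "z \<in> annulus (1/r) r" for z
      using that rR S0.reg by blast
  qed (use seam_mono[OF g r] D in auto)
  have n_eq: "n = (\<Sum>z\<in>S.divisor. zorder f z)"
    using n(2) S.winding_number_eq_zeros_minus_poles S.sum_zorder by (metis of_int_eq_iff)
  obtain \<phi> where \<phi>: "\<phi> holomorphic_on D" "inj_on \<phi> D"
    and rep: "\<And>w. w \<in> D - S.divisor \<Longrightarrow> f w = (\<Prod>z\<in>S.divisor. (\<phi> w - \<phi> z) powi zorder f z)"
    using S.divisor_product_representation[OF k] kn unfolding n_eq by blast
  let ?J = "S.divisor" and ?e = "zorder f"
  let ?p = "linear_factors \<phi> ?e ?J" and ?q = "linear_factors \<phi> (\<lambda>j. - ?e j) ?J"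
  define \<rho> where "\<rho> = quotient_map ?p ?q"
  note fin = S.finite_divisor
  have JD: "?J \<subseteq> D" by (auto simp: S.divisor_def)
  have deg: "degree ?p = M" "degree ?q = N"
  proof -
    have "(\<Sum>z\<in>?J. nat (?e z)) = (\<Sum>z\<in>{z \<in> ?J. ?e z > 0}. nat (?e z))"
      by (rule sum.mono_neutral_right[OF fin]) auto
    then show "degree ?p = M" using assms(9) S.zeros_eq by (simp add: degree_linear_factors[OF fin] num_zeros_def)
    have "(\<Sum>z\<in>?J. nat (- ?e z)) = (\<Sum>z\<in>{z \<in> ?J. ?e z < 0}. nat (- ?e z))"
      by (rule sum.mono_neutral_right[OF fin]) auto
    then show "degree ?q = N" using assms(10) S.poles_eq by (simp add: degree_linear_factors[OF fin] num_poles_def)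
  qed
  have rat: "rational_map_of_degree \<rho> (max M N)"
    unfolding rational_map_of_degree_def \<rho>_def
    using linear_factors_nonzero[OF fin] coprime_linear_factors[OF fin inj_on_subset[OF \<phi>(2) JD]] deg by blast
  have val: "sphere_val f w = \<rho> (Some (\<phi> w))" if w: "w \<in> D" for w
  proof -
    have \<phi>_eq: "\<phi> w = \<phi> z \<longleftrightarrow> w = z" if "z \<in> ?J" for z
      using inj_onD[OF \<phi>(2), of w z] w that JD by auto
    have q0: "poly ?q (\<phi> w) = 0 \<longleftrightarrow> w \<in> {z \<in> ?J. ?e z < 0}"
      using \<phi>_eq by (auto simp: poly_linear_factors_eq_0[OF fin])
    have p0: "poly ?p (\<phi> w) = 0 \<longleftrightarrow> w \<in> {z \<in> ?J. ?e z > 0}"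
      using \<phi>_eq by (auto simp: poly_linear_factors_eq_0[OF fin])
    have pole: "sphere_val f w = None \<longleftrightarrow> w \<in> {z \<in> ?J. ?e z < 0}" using S.poles_eq w by blast
    have zero: "sphere_val f w = Some 0 \<longleftrightarrow> w \<in> {z \<in> ?J. ?e z > 0}" using S.zeros_eq w by blast
    show ?thesis
    proof (cases "w \<in> ?J")
      case True
      then have "\<not> (sphere_val f w \<noteq> None \<and> sphere_val f w \<noteq> Some 0)"
        by (auto simp: S.divisor_def sphere_val_def)
      then show ?thesis using pole zero p0 q0 by (auto simp: \<rho>_def)
    next
      case False
      then have "f w = poly ?p (\<phi> w) / poly ?q (\<phi> w)"
        using rep[of w] w \<phi>_eq by (subst linear_factors_quotient[OF fin]) auto
      then show ?thesis using pole q0 False by (auto simp: \<rho>_def sphere_val_def split: if_splits)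
    qed
  qed
  have roots: "x \<in> Some ` \<phi> ` D \<or> x = None" if "\<rho> x = Some 0 \<or> \<rho> x = None" for x
  proof (cases x)
    case (Some y)
    then have "poly ?p y = 0 \<or> poly ?q y = 0" using that by (auto simp: \<rho>_def split: if_splits)
    then show ?thesis using Some JD by (auto simp: poly_linear_factors_eq_0[OF fin])
  qed simp
  have ord: "order_at_infinity \<rho> = int N - int M"
    unfolding \<rho>_def order_at_infinity_linear_factors[OF fin] S.sum_zorder assms(9,10) by simp
  show ?thesis
    using \<phi> rat val roots ord by (intro exI[of _ \<phi>] exI[of _ \<rho>]) auto
qed

end
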